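(* Let $n\ge1$ and $V=\mathbb{Q}^n$. The map $\xi:(V^* )^n_{ng}\to\mathrm{Dist}(V,\tilde K_n^M(V))$ defined in the context induces a well-defined map $$\xi:C_{n-1}(V)\to\mathrm{Dist}(V,\tilde K_n^M(V))$$ such that $\partial^*(\xi)=0$ and $\xi|_\gamma=\xi$ for every $\gamma\in\mathrm{GL}_n(\mathbb{Q})$. In other words, $\xi\in Z^{n-1}(V,\mathrm{Dist}(V,\tilde K_n^M(V)))$.
   Context: **Test functions and distributions.** $V=\mathbb{Q}^n$ is the space of row vectors, on which $\mathrm{GL}(V)=\mathrm{GL}_n(\mathbb{Q})$ acts by $x\mapsto x\gamma$; $V^*=\mathrm{Hom}(V,\mathbb{Q})$ has the left action $(\gamma\cdot\lambda)(x)=\lambda(x\gamma)$, with dual standard basis $e_1^*,\dots,e_n^*$; $V_{\mathbb{C}}=\mathbb{C}^n$, to which linear forms are extended. $\mathcal{S}(V)$ is the abelian group of locally constant functions on $V$ with bounded support, generated by the characteristic functions $\chi_{a+d\mathbb{Z}^n}$ ($a\in\mathbb{Q}^n$, $d\in\mathbb{N}$), with $(\gamma\cdot f)(x)=f(x\gamma)$. $\mathrm{Dist}(V,M)=\mathrm{Hom}_{\mathbb{Z}}(\mathcal{S}(V),M)$; for a right $\mathrm{GL}(V)$-module $M$, $(\mu|_\gamma)(f)=\mu(\gamma\cdot f)|_\gamma$. **Milnor K-groups.** For $w=(r,\lambda)\in\mathbb{Q}\times V^*$ let $\varepsilon_w(z)=\exp(2\pi i(\lambda(z)-r))$, $z\in\mathbb{C}^n$.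 Let $\mathcal{O}_{\mathbb{Q}}(V_{\mathbb{C}})$ be the ring of meromorphic functions on $V_{\mathbb{C}}$ with possible poles only on $V=\mathbb{Q}^n$. Let $\mathcal{E}(V)$, resp. $\mathcal{C}(V)$, be the subgroup of the unit group $\mathcal{O}_{\mathbb{Q}}(V_{\mathbb{C}})^*$ generated by all $\varepsilon_w$, resp. all $\varepsilon_w$ and $1-\varepsilon_w$, with $\lambda\neq0$. Let $\mathcal{R}(V)=\mathbb{Z}[\varepsilon_w,1-\varepsilon_w: w=(r,\lambda),\ \lambda\ne0]=\{\sum_{j=1}^m m_j\varepsilon_{w_j}: w_j\in\mathbb{Q}\times V^*,\ m_j\in\mathbb{Z}\}$, a subring of $\mathcal{O}_{\mathbb{Q}}(V_{\mathbb{C}})$; the elements of $\mathcal{C}(V)$ are regarded as units of $\mathcal{R}(V)$. For a commutative ring $A$, $K^M(A)=\bigoplus_{m\ge0}K^M_m(A)$, where $K_0^M(A)=\mathbb{Z}$, $K_1^M(A)=A^*$ and, for $m\ge2$, $K_m^M(A)$ is $(A^* )^{\otimes m}$ modulo the subgroup generated by the $a_1\otimes\cdots\otimes a_m$ with $a_i+a_j=0$ or $1$ for some $i\ne j$; $\{x_1,\dots,x_m\}$ is the class of $x_1\otimes\cdots\otimes x_m$. Put $K_n^M(V)=K_n^M(\mathcal{R}(V))$ and $K^M(V)=K^M(\mathcal{R}(V))$. Let $\tilde J(V)$ be the ideal of $K^M(V)$ generated by $\{-1\}$ and all $\{x_1,\dots,x_m\}$ ($m\ge1$) with all $x_i\in\mathcal{C}(V)$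 and at least one $x_i\in\mathcal{E}(V)$. Put $\tilde J_n(V)=\tilde J(V)\cap K_n^M(V)$ and $\tilde K_n^M(V)=K_n^M(V)/\tilde J_n(V)$. $\mathrm{GL}(V)$ acts on the right by $(F|_\gamma)(z)=F(z\gamma^{-1})$ and $\{F_1,\dots,F_m\}|_\gamma=\{F_1|_\gamma,\dots,F_m|_\gamma\}$. **The complex.** For $k\ge0$, $(V^* )^{k+1}_{ng}\subset(V^* )^{k+1}$ is the set of $(\lambda_0,\dots,\lambda_k)$ such that every $m$-element subset of $\{\lambda_0,\dots,\lambda_k\}$ with $m\le n$ is linearly independent. $C_k(V)$ is the free abelian group on $(V^* )^{k+1}_{ng}/(\mathbb{Q}^+)^{k+1}$ (orbits under componentwise scaling by positive rationals); $[\lambda_0,\dots,\lambda_k]$ denotes the orbit of $(\lambda_0,\dots,\lambda_k)$. For $k\ge1$, $\partial:C_k(V)\to C_{k-1}(V)$ is $\partial[\lambda_0,\dots,\lambda_k]=\sum_{i=0}^k(-1)^i[\lambda_0,\dots,\widehat{\lambda_i},\dots,\lambda_k]$. For a right $\mathrm{GL}(V)$-module $M$ and $\xi\in\mathrm{Hom}(C_k(V),M)$, $(\xi|_\gamma)([\lambda_0,\dots,\lambda_k])=\xi([\gamma\cdot\lambda_0,\dots,\gamma\cdot\lambda_k])|_\gamma$. $C^k(V,M)$ is the group of $\xi\in\mathrm{Hom}(C_k(V),M)$ with $\xi|_\gamma=\xi$ for all $\gamma\in\mathrm{GL}(V)$, with coboundary $\partial^*$ induced by $\partial$, and $Z^k(V,M)$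 is the subgroup of cocycles. **The map $\xi$.** Write $e(x)=e^{2\pi i x}$. For $g=\sum_jb_j\chi_{a_j+d_j\mathbb{Z}^n}\in\mathcal{S}(V)$ with $b_j\in\mathbb{Z}$, $a_j=(a_j^{(1)},\dots,a_j^{(n)})\in\mathbb{Q}^n$, $d_j\in\mathbb{N}$, put $$\xi(e_1^*,\dots,e_n^* )(g)=\sum_jb_j\Big\{1-e\big(\tfrac{z_1-a_j^{(1)}}{d_j}\big),\dots,1-e\big(\tfrac{z_n-a_j^{(n)}}{d_j}\big)\Big\}\in\tilde K_n^M(V),$$ which does not depend on the presentation of $g$. For $(\lambda_0,\dots,\lambda_{n-1})\in(V^* )^n_{ng}$ (a basis of $V^*$), let $\gamma\in\mathrm{GL}(V)$ be the unique element with $\gamma\cdot\lambda_i=e_{i+1}^*$ for $0\le i\le n-1$, and put $\xi(\lambda_0,\dots,\lambda_{n-1})(f)=\big(\xi(e_1^*,\dots,e_n^* )(\gamma\cdot f)\big)|_\gamma$ for $f\in\mathcal{S}(V)$.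
   Formalization: Poles are allowed along rational affine hyperplanes (not only on Q^n, where 1-ε_w is no unit for n≥2), and R(V) is the ring of exponential sums with inverses of C(V) adjoined, since 1-ε_w is not invertible among the sums. *)

theory Defs
  imports
    "HOL-Analysis.Analysis"
    "HOL-Algebra.Free_Abelian_Groups"
    "HOL-Algebra.Product_Groups"
    "HOL-Algebra.Generated_Groups"
    "HOL-Algebra.Generated_Rings"
    "HOL-Algebra.Ideal"
begin

text \<open>Abelian groups, including the groups of homomorphisms and the Milnor K-groups, are groups
  of HOL-Algebra and hence written multiplicatively.  The dimension is \<open>n = CARD('n)\<close>, and \<open>V\<close> is the type \<^typ>\<open>rat^'n\<close> of row vectors.\<close>

section \<open>Homomorphism groups and maps defined on representatives\<close>

definition hom_group :: "('a, 'c) monoid_scheme \<Rightarrow> ('b, 'd) monoid_scheme \<Rightarrow> ('a \<Rightarrow> 'b) monoid" where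
  "hom_group G H = \<lparr>carrier = hom G H \<inter> extensional (carrier G),
     monoid.mult = (\<lambda>f g. \<lambda>x\<in>carrier G. f x \<otimes>\<^bsub>H\<^esub> g x),
     one = (\<lambda>x\<in>carrier G. \<one>\<^bsub>H\<^esub>)\<rparr>"

text \<open>The function \<open>p c \<mapsto> \<phi> c\<close> (\<open>c \<in> S\<close>), for a \<open>\<phi>\<close> that is constant on the fibres of \<open>p\<close>; the
  definite description is unspecified where \<open>\<phi>\<close> is not.\<close>

definition descend :: "'c set \<Rightarrow> ('c \<Rightarrow> 'a) \<Rightarrow> ('c \<Rightarrow> 'b) \<Rightarrow> 'a \<Rightarrow> 'b" where
  "descend S p \<phi> x = (THE y. \<exists>c\<in>S. p c = x \<and> y = \<phi> c)"

section \<open>Milnor K-theory of a commutative ring\<close>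

text \<open>Tensor powers are presented by generators \<open>x\<^sub>1 \<otimes> \<dots> \<otimes> x\<^sub>m\<close>, encoded as lists of length \<open>m\<close>,
  and multilinearity relations.  For \<open>m = 0\<close> this is the free group on the empty list, i.e. the
  integers, and for \<open>m = 1\<close> it is \<open>G\<close> itself, up to canonical isomorphism.\<close>

definition tensor_words :: "('a, 'c) monoid_scheme \<Rightarrow> nat \<Rightarrow> 'a list set" where
  "tensor_words G m = {xs. length xs = m \<and> set xs \<subseteq> carrier G}"

definition tensor_chains :: "('a, 'c) monoid_scheme \<Rightarrow> nat \<Rightarrow> ('a list \<Rightarrow>\<^sub>0 int) monoid" where
  "tensor_chains G m = free_Abelian_group (tensor_words G m)"

definition multilinear_rels :: "('a, 'c) monoid_scheme \<Rightarrow> nat \<Rightarrow> ('a list \<Rightarrow>\<^sub>0 int) set" where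
  "multilinear_rels G m = {frag_of (us @ [x \<otimes>\<^bsub>G\<^esub> y] @ vs) - frag_of (us @ [x] @ vs) - frag_of (us @ [y] @ vs)
     | us x y vs. us @ [x] @ vs \<in> tensor_words G m \<and> y \<in> carrier G}"

definition tensor_power ::
    "('a, 'c) monoid_scheme \<Rightarrow> nat \<Rightarrow> ('a list \<Rightarrow>\<^sub>0 int) set monoid" where
  "tensor_power G m = tensor_chains G m Mod generate (tensor_chains G m) (multilinear_rels G m)"

definition tensor_class ::
    "('a, 'c) monoid_scheme \<Rightarrow> nat \<Rightarrow> ('a list \<Rightarrow>\<^sub>0 int) \<Rightarrow> ('a list \<Rightarrow>\<^sub>0 int) set" where
  "tensor_class G m c =
     generate (tensor_chains G m) (multilinear_rels G m) #>\<^bsub>tensor_chains G m\<^esub> c"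

definition steinberg_tensors :: "('a, 'c) ring_scheme \<Rightarrow> nat \<Rightarrow> ('a list \<Rightarrow>\<^sub>0 int) set set" where
  "steinberg_tensors A m = {tensor_class (units_of A) m (frag_of xs) | xs.
     xs \<in> tensor_words (units_of A) m \<and>
     (\<exists>i<m. \<exists>j<m. i \<noteq> j \<and> (xs ! i \<oplus>\<^bsub>A\<^esub> xs ! j = \<zero>\<^bsub>A\<^esub> \<or> xs ! i \<oplus>\<^bsub>A\<^esub> xs ! j = \<one>\<^bsub>A\<^esub>))}"

text \<open>For \<open>m \<le> 1\<close> there are no Steinberg tensors, so that \<open>K\<^sub>0\<close> and \<open>K\<^sub>1\<close> are the integers and
  the unit group.\<close>

definition milnor_K :: "('a, 'c) ring_scheme \<Rightarrow> nat \<Rightarrow> ('a list \<Rightarrow>\<^sub>0 int) set set monoid" where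
  "milnor_K A m = tensor_power (units_of A) m
     Mod generate (tensor_power (units_of A) m) (steinberg_tensors A m)"

definition K_class :: "('a, 'c) ring_scheme \<Rightarrow> nat \<Rightarrow> ('a list \<Rightarrow>\<^sub>0 int) \<Rightarrow> ('a list \<Rightarrow>\<^sub>0 int) set set" where
  "K_class A m c = generate (tensor_power (units_of A) m) (steinberg_tensors A m)
     #>\<^bsub>tensor_power (units_of A) m\<^esub> tensor_class (units_of A) m c"

definition K_symbol :: "('a, 'c) ring_scheme \<Rightarrow> 'a list \<Rightarrow> ('a list \<Rightarrow>\<^sub>0 int) set set" where
  "K_symbol A xs = K_class A (length xs) (frag_of xs)"

definition chain_concat :: "('a list \<Rightarrow>\<^sub>0 int) \<Rightarrow> ('a list \<Rightarrow>\<^sub>0 int) \<Rightarrow> ('a list \<Rightarrow>\<^sub>0 int)" where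
  "chain_concat a b = frag_extend (\<lambda>xs. frag_extend (\<lambda>ys. frag_of (xs @ ys)) b) a"

definition K_mult :: "('a, 'c) ring_scheme \<Rightarrow> nat \<Rightarrow> nat \<Rightarrow>
    ('a list \<Rightarrow>\<^sub>0 int) set set \<Rightarrow> ('a list \<Rightarrow>\<^sub>0 int) set set \<Rightarrow> ('a list \<Rightarrow>\<^sub>0 int) set set" where
  "K_mult A p q X Y = descend
     (carrier (tensor_chains (units_of A) p) \<times> carrier (tensor_chains (units_of A) q))
     (\<lambda>(a, b). (K_class A p a, K_class A q b))
     (\<lambda>(a, b). K_class A (p + q) (chain_concat a b)) (X, Y)"

definition K_incl :: "('a, 'c) ring_scheme \<Rightarrow> nat \<Rightarrow>
    ('a list \<Rightarrow>\<^sub>0 int) set set \<Rightarrow> nat \<Rightarrow> ('a list \<Rightarrow>\<^sub>0 int) set set" where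
  "K_incl A m X = (\<lambda>k. if k = m then X else \<one>\<^bsub>milnor_K A k\<^esub>)"

text \<open>The graded ring: the direct sum of all \<open>K\<^sub>m\<close>, with \<open>{x\<^sub>1,\<dots>,x\<^sub>p} {y\<^sub>1,\<dots>,y\<^sub>q} =
  {x\<^sub>1,\<dots>,x\<^sub>p,y\<^sub>1,\<dots>,y\<^sub>q}\<close>.\<close>

definition milnor_ring :: "('a, 'c) ring_scheme \<Rightarrow> (nat \<Rightarrow> ('a list \<Rightarrow>\<^sub>0 int) set set) ring" where
  "milnor_ring A = \<lparr>carrier = carrier (sum_group UNIV (milnor_K A)),
     monoid.mult = (\<lambda>f g m. \<Otimes>\<^bsub>milnor_K A m\<^esub>p\<in>{..m}. K_mult A p (m - p) (f p) (g (m - p))),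
     one = K_incl A 0 (K_symbol A []),
     zero = \<one>\<^bsub>sum_group UNIV (milnor_K A)\<^esub>,
     add = monoid.mult (sum_group UNIV (milnor_K A))\<rparr>"

section \<open>The space, its dual, and test functions\<close>

type_synonym 'n form = "rat^'n \<Rightarrow> rat"

definition dual :: "('n::finite) form set" where
  "dual = {l. Vector_Spaces.linear (*s) (*) l}"

definition form_act :: "rat^'n^'n \<Rightarrow> ('n::finite) form \<Rightarrow> 'n form" where
  "form_act \<gamma> l = (\<lambda>x. l (x v* \<gamma>))"

definition form_ext :: "('n::finite) form \<Rightarrow> complex^'n \<Rightarrow> complex" where
  "form_ext l z = (\<Sum>i\<in>UNIV. of_rat (l (axis i 1)) * z $ i)"

text \<open>The function \<open>\<chi>\<^bsub>a + d\<int>\<^sup>n\<^esub>\<close>.\<close>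

definition coset_fn :: "rat^'n \<Rightarrow> nat \<Rightarrow> rat^'n \<Rightarrow> int" where
  "coset_fn a d x = of_bool (\<forall>i. \<exists>k::int. x $ i = a $ i + of_nat d * of_int k)"

text \<open>A list of triples \<open>(b\<^sub>j, a\<^sub>j, d\<^sub>j)\<close> presents \<open>\<Sum>\<^sub>j b\<^sub>j \<chi>\<^bsub>a\<^sub>j + d\<^sub>j\<int>\<^sup>n\<^esub>\<close>.  The group \<open>S(V)\<close> is taken
  to be the group generated by the characteristic functions.\<close>

definition presentations :: "(int \<times> (rat^'n) \<times> nat) list set" where
  "presentations = {ps. \<forall>(b, a, d)\<in>set ps. d > 0}"

definition presented :: "(int \<times> (rat^'n) \<times> nat) list \<Rightarrow> rat^'n \<Rightarrow> int" where
  "presented ps x = (\<Sum>(b, a, d)\<leftarrow>ps. b * coset_fn a d x)"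

definition test_fns :: "(rat^'n \<Rightarrow> int) monoid" where
  "test_fns = \<lparr>carrier = presented ` presentations,
     monoid.mult = (\<lambda>f g x. f x + g x), one = (\<lambda>x. 0)\<rparr>"

definition test_act :: "rat^'n^'n \<Rightarrow> (rat^'n \<Rightarrow> int) \<Rightarrow> (rat^'n \<Rightarrow> int)" where
  "test_act \<gamma> f = (\<lambda>x. f (x v* \<gamma>))"

definition Dist :: "('m, 'c) monoid_scheme \<Rightarrow> ((rat^'n \<Rightarrow> int) \<Rightarrow> 'm) monoid" where
  "Dist M = hom_group test_fns M"

definition dist_act :: "(rat^'n^'n \<Rightarrow> 'm \<Rightarrow> 'm) \<Rightarrow> rat^'n^'n \<Rightarrow>
    ((rat^'n \<Rightarrow> int) \<Rightarrow> 'm) \<Rightarrow> ((rat^'n \<Rightarrow> int) \<Rightarrow> 'm)" where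
  "dist_act act \<gamma> \<mu> = (\<lambda>f\<in>carrier test_fns. act \<gamma> (\<mu> (test_act \<gamma> f)))"

section \<open>Meromorphic functions\<close>

text \<open>The functions \<open>(1 - \<epsilon>\<^sub>w)\<^sup>-\<^sup>1\<close> have poles along rational affine hyperplanes, which for
  \<open>n = 1\<close> are the points of \<open>\<rat>\<close>; this is the polar locus allowed here.  A meromorphic
  function with such poles is determined by its values on the dense complement
  \<open>generic\<close> of all these hyperplanes, and is represented by its restriction to it.\<close>

definition generic :: "(complex^'n) set" where
  "generic = {z. \<forall>l\<in>dual. \<forall>r::rat. l \<noteq> (\<lambda>x. 0) \<longrightarrow> form_ext l z \<noteq> of_rat r}"

definition multi_holomorphic_on :: "(complex^'n \<Rightarrow> complex) \<Rightarrow> (complex^'n) set \<Rightarrow> bool" where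
  "multi_holomorphic_on f W \<longleftrightarrow>
     (\<forall>z\<in>W. \<exists>D. (f has_derivative D) (at z) \<and> (\<forall>c v. D (c *s v) = c * D v))"

definition merom_ring :: "(complex^'n \<Rightarrow> complex) ring" where
  "merom_ring = \<lparr>carrier = {f \<in> extensional generic. \<forall>p. \<exists>W g h. open W \<and> p \<in> W \<and>
       multi_holomorphic_on g W \<and> multi_holomorphic_on h W \<and>
       (\<forall>z\<in>W \<inter> generic. h z \<noteq> 0 \<and> f z = g z / h z)},
     monoid.mult = (\<lambda>f g. \<lambda>z\<in>generic. f z * g z),
     one = (\<lambda>z\<in>generic. 1),
     zero = (\<lambda>z\<in>generic. 0),
     add = (\<lambda>f g. \<lambda>z\<in>generic. f z + g z)\<rparr>"

definition merom_act :: "rat^'n^'n \<Rightarrow> (complex^'n \<Rightarrow> complex) \<Rightarrow> (complex^'n \<Rightarrow> complex)" where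
  "merom_act \<gamma> F = (\<lambda>z\<in>generic. F (z v* map_matrix of_rat (matrix_inv \<gamma>)))"

definition eps :: "rat \<Rightarrow> ('n::finite) form \<Rightarrow> complex^'n \<Rightarrow> complex" where
  "eps r l = (\<lambda>z\<in>generic. exp (2 * of_real pi * \<i> * (form_ext l z - of_rat r)))"

definition one_minus_eps :: "rat \<Rightarrow> ('n::finite) form \<Rightarrow> complex^'n \<Rightarrow> complex" where
  "one_minus_eps r l = \<one>\<^bsub>merom_ring\<^esub> \<ominus>\<^bsub>merom_ring\<^esub> eps r l"

definition E_units :: "(complex^'n \<Rightarrow> complex) set" where
  "E_units = generate (units_of merom_ring) {eps r l | r l. l \<in> dual \<and> l \<noteq> (\<lambda>x. 0)}"

definition C_units :: "(complex^'n \<Rightarrow> complex) set" where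
  "C_units = generate (units_of merom_ring)
     ({eps r l | r l. l \<in> dual \<and> l \<noteq> (\<lambda>x. 0)} \<union> {one_minus_eps r l | r l. l \<in> dual \<and> l \<noteq> (\<lambda>x. 0)})"

text \<open>The integral exponential sums \<open>\<Sum>\<^sub>j m\<^sub>j \<epsilon>\<^bsub>w\<^sub>j\<^esub>\<close>; here \<open>\<lambda> = 0\<close> is allowed.\<close>

definition exp_sums :: "(complex^'n \<Rightarrow> complex) set" where
  "exp_sums = {\<lambda>z\<in>generic. \<Sum>(m, r, l)\<leftarrow>ws. of_int m * eps r l z
     | ws :: (int \<times> rat \<times> 'n form) list. \<forall>(m, r, l)\<in>set ws. l \<in> dual}"

text \<open>An element \<open>1 - \<epsilon>\<^sub>w\<close> has no inverse among the exponential sums.  For the elements of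
  \<open>C(V)\<close> to be units of \<open>R(V)\<close>, their inverses are adjoined.\<close>

definition R_ring :: "(complex^'n \<Rightarrow> complex) ring" where
  "R_ring = merom_ring\<lparr>carrier := generate_ring merom_ring (exp_sums \<union> C_units)\<rparr>"

section \<open>The quotient of the Milnor K-group\<close>

type_synonym 'n Kelem = "((complex^'n \<Rightarrow> complex) list \<Rightarrow>\<^sub>0 int) set set"

definition J_ideal :: "(nat \<Rightarrow> ('n::finite) Kelem) set" where
  "J_ideal = Idl\<^bsub>milnor_ring R_ring\<^esub>
     (insert (K_incl R_ring 1 (K_symbol R_ring [\<ominus>\<^bsub>R_ring\<^esub> \<one>\<^bsub>R_ring\<^esub>]))
        {K_incl R_ring (length xs) (K_symbol R_ring xs) | xs.
           set xs \<subseteq> C_units \<and> set xs \<inter> E_units \<noteq> {}})"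

definition J_part :: "nat \<Rightarrow> ('n::finite) Kelem set" where
  "J_part m = {X \<in> carrier (milnor_K R_ring m). K_incl R_ring m X \<in> J_ideal}"

definition K_tilde :: "nat \<Rightarrow> ('n::finite) Kelem set monoid" where
  "K_tilde m = milnor_K R_ring m Mod J_part m"

definition K_tilde_class :: "nat \<Rightarrow> ('n::finite) Kelem \<Rightarrow> 'n Kelem set" where
  "K_tilde_class m X = J_part m #>\<^bsub>milnor_K R_ring m\<^esub> X"

definition K_act :: "nat \<Rightarrow> rat^'n^'n \<Rightarrow> ('n::finite) Kelem \<Rightarrow> 'n Kelem" where
  "K_act m \<gamma> = descend (carrier (tensor_chains (units_of R_ring) m)) (K_class R_ring m)
     (\<lambda>c. K_class R_ring m (frag_extend (\<lambda>xs. frag_of (map (merom_act \<gamma>) xs)) c))"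

definition K_tilde_act :: "nat \<Rightarrow> rat^'n^'n \<Rightarrow> ('n::finite) Kelem set \<Rightarrow> 'n Kelem set" where
  "K_tilde_act m \<gamma> = descend (carrier (milnor_K R_ring m)) (K_tilde_class m)
     (\<lambda>X. K_tilde_class m (K_act m \<gamma> X))"

section \<open>The complex\<close>

definition indep_family :: "(nat \<Rightarrow> ('n::finite) form) \<Rightarrow> nat set \<Rightarrow> bool" where
  "indep_family l I \<longleftrightarrow>
     (\<forall>c::nat \<Rightarrow> rat. (\<forall>x. (\<Sum>i\<in>I. c i * l i x) = 0) \<longrightarrow> (\<forall>i\<in>I. c i = 0))"

text \<open>Subsets of \<open>{\<lambda>\<^sub>0, \<dots>, \<lambda>\<^sub>k}\<close> are indexed subfamilies, so that a repeated entry counts as a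
  dependence; in particular the tuples of length \<open>n\<close> are exactly the ordered bases.\<close>

definition ng_tuples :: "nat \<Rightarrow> ('n::finite) form list set" where
  "ng_tuples k = {ls. length ls = k + 1 \<and> set ls \<subseteq> dual \<and>
     (\<forall>I\<subseteq>{..k}. card I \<le> CARD('n) \<longrightarrow> indep_family ((!) ls) I)}"

definition orbit :: "('n::finite) form list \<Rightarrow> 'n form list set" where
  "orbit ls = {map2 (\<lambda>c l x. c * l x) cs ls | cs :: rat list.
     length cs = length ls \<and> (\<forall>c\<in>set cs. c > 0)}"

definition C_group :: "nat \<Rightarrow> (('n::finite) form list set \<Rightarrow>\<^sub>0 int) monoid" where
  "C_group k = free_Abelian_group (orbit ` ng_tuples k)"

text \<open>Deletion of an entry and the action of \<open>\<gamma>\<close> map orbits onto orbits, hence the images.\<close>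

definition boundary :: "nat \<Rightarrow> (('n::finite) form list set \<Rightarrow>\<^sub>0 int) \<Rightarrow> ('n form list set \<Rightarrow>\<^sub>0 int)" where
  "boundary k = frag_extend (\<lambda>Q. \<Sum>i\<le>k. frag_cmul ((-1) ^ i)
     (frag_of ((\<lambda>ls. take i ls @ drop (Suc i) ls) ` Q)))"

definition C_act :: "rat^'n^'n \<Rightarrow> (('n::finite) form list set \<Rightarrow>\<^sub>0 int) \<Rightarrow> ('n form list set \<Rightarrow>\<^sub>0 int)" where
  "C_act \<gamma> = frag_extend (\<lambda>Q. frag_of (map (form_act \<gamma>) ` Q))"

text \<open>A right \<open>GL(V)\<close>-module is a group \<open>M\<close> with its action \<open>act \<gamma> m = m|\<^sub>\<gamma>\<close>.\<close>

definition cochain_act :: "(rat^'n^'n \<Rightarrow> 'm \<Rightarrow> 'm) \<Rightarrow> nat \<Rightarrow> rat^'n^'n \<Rightarrow>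
    ((('n::finite) form list set \<Rightarrow>\<^sub>0 int) \<Rightarrow> 'm) \<Rightarrow> (('n form list set \<Rightarrow>\<^sub>0 int) \<Rightarrow> 'm)" where
  "cochain_act act k \<gamma> \<xi> = (\<lambda>c\<in>carrier (C_group k). act \<gamma> (\<xi> (C_act \<gamma> c)))"

definition coboundary :: "nat \<Rightarrow>
    ((('n::finite) form list set \<Rightarrow>\<^sub>0 int) \<Rightarrow> 'm) \<Rightarrow> (('n form list set \<Rightarrow>\<^sub>0 int) \<Rightarrow> 'm)" where
  "coboundary k \<xi> = (\<lambda>c\<in>carrier (C_group (k + 1)). \<xi> (boundary (k + 1) c))"

definition cochains :: "('m, 'c) monoid_scheme \<Rightarrow> (rat^'n^'n \<Rightarrow> 'm \<Rightarrow> 'm) \<Rightarrow> nat \<Rightarrow>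
    ((('n::finite) form list set \<Rightarrow>\<^sub>0 int) \<Rightarrow> 'm) set" where
  "cochains M act k = {\<xi> \<in> carrier (hom_group (C_group k) M).
     \<forall>\<gamma>. invertible \<gamma> \<longrightarrow> cochain_act act k \<gamma> \<xi> = \<xi>}"

definition cocycles :: "('m, 'c) monoid_scheme \<Rightarrow> (rat^'n^'n \<Rightarrow> 'm \<Rightarrow> 'm) \<Rightarrow> nat \<Rightarrow>
    ((('n::finite) form list set \<Rightarrow>\<^sub>0 int) \<Rightarrow> 'm) set" where
  "cocycles M act k = {\<xi> \<in> cochains M act k.
     coboundary k \<xi> = \<one>\<^bsub>hom_group (C_group (k + 1)) M\<^esub>}"

section \<open>The map on bases\<close>

text \<open>The coordinates are numbered according to the linear order on the index type.\<close>

definition coords :: "('n::{finite,linorder}) list" where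
  "coords = sorted_list_of_set UNIV"

definition std_factor :: "rat^'n \<Rightarrow> nat \<Rightarrow> 'n::finite \<Rightarrow> complex^'n \<Rightarrow> complex" where
  "std_factor a d i =
     (\<lambda>z\<in>generic. 1 - exp (2 * of_real pi * \<i> * ((z $ i - of_rat (a $ i)) / of_nat d)))"

definition xi_std :: "(rat^('n::{finite,linorder}) \<Rightarrow> int) \<Rightarrow> 'n Kelem set" where
  "xi_std = descend presentations presented
     (\<lambda>ps. foldr (\<lambda>(b, a, d) y.
          K_tilde_class CARD('n) (K_symbol R_ring (map (std_factor a d) coords))
            [^]\<^bsub>K_tilde CARD('n)\<^esub> b \<otimes>\<^bsub>K_tilde CARD('n)\<^esub> y)
        ps \<one>\<^bsub>K_tilde CARD('n)\<^esub>)"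

definition to_std :: "('n::{finite,linorder}) form list \<Rightarrow> rat^('n::{finite,linorder})^('n::{finite,linorder})" where
  "to_std ls = (THE \<gamma>. invertible \<gamma> \<and>
     (\<forall>i<CARD('n). form_act \<gamma> (ls ! i) = (\<lambda>x. x $ (coords ! i))))"

definition xi :: "('n::{finite,linorder}) form list \<Rightarrow> (rat^('n::{finite,linorder}) \<Rightarrow> int) \<Rightarrow> 'n Kelem set" where
  "xi ls = (\<lambda>f\<in>carrier test_fns.
     K_tilde_act CARD('n) (to_std ls) (xi_std (test_act (to_std ls) f)))"

end

theory Submission
  imports Defs "HOL-Computational_Algebra.Fundamental_Theorem_Algebra"
begin

text \<open>A pair \<open>(r, \<lambda>)\<close> with \<open>\<lambda> \<noteq> 0\<close> has two shadows: the function \<open>1 - e(\<lambda>(z) - r)\<close> and the condition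
  \<open>\<lambda>(x) - r \<in> \<int>\<close> on \<open>x \<in> V\<close>.  For a list of \<open>n\<close> pairs the former give a symbol in the quotient K-group and
  the latter a box in \<open>V\<close>.  If the forms of the pairs are rational multiples of those of a basis, the value
  of \<open>\<xi>\<close> at this basis on the box is the symbol: positive multiples are
  handled by the distribution relation \<open>1 - w\<^sup>m = \<Prod>\<^sub>j (1 - \<zeta>\<^sup>j w)\<close>, and a change of sign alters an entry only by
  an element of \<open>E(V)\<close>.  As such boxes span the test functions, invariance under scaling and under the linear
  group can be read off on symbols.

  For the cocycle relation, rescale \<open>\<lambda>\<^sub>0, \<dots>, \<lambda>\<^sub>n\<close> so that \<open>\<lambda>\<^sub>n = \<lambda>\<^sub>0 + \<dots> + \<lambda>\<^bsub>n-1\<^esub>\<close>.  A box for the first \<open>n\<close> forms is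
  then a box for any \<open>n\<close> of the \<open>n + 1\<close> forms, and what remains is a relation between symbols with
  entries \<open>1 - x\<^sub>0, \<dots>, 1 - x\<^bsub>n-1\<^esub>\<close> and \<open>1 - x\<^sub>0 \<cdots> x\<^bsub>n-1\<^esub>\<close> for \<open>x\<^sub>i \<in> E(V)\<close>.  It follows by induction from the case
  of two factors, where \<open>1 - x y = (1 - x) + x (1 - y)\<close> exhibits a Steinberg relation.\<close>

section \<open>Chains and relations presenting the Milnor K-groups\<close>

text \<open>Two features of the quotient shape the argument. Since -1 = e(-1/2) lies in E(V),
  symbols are alternating and an entry counts only up to a factor in E(V). Moreover, the
  coefficients that express \<lambda>_n in the other forms are non-zero by general position but may
  be negative, whereas orbits allow positive scaling only. The comparison of symbol and box must
  therefore cover both signs, and 1 - t = -t (1 - 1/t) with -t in E(V) is exactly what the quotient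
  absorbs. General position enters a second time: the induction on the number of factors divides by
  1 - x_0 ... x_{k-1}, a unit because the partial sum \<lambda>_0 + ... + \<lambda>_{k-1} does not
  vanish. That \<xi> is well defined on test functions also rests on the distribution relation:
  presentations are refined to cosets modulo a common D, where the coefficient of a coset is the
  value of the function on it. Calculations take place in the type \<open>ktilde\<close>, a module
  over the integers, and are carried to the quotient K-group by \<open>ktilde_val\<close>.\<close>

lemma descend_eq:
  assumes "c \<in> S" "\<And>c'. c' \<in> S \<Longrightarrow> p c' = p c \<Longrightarrow> \<phi> c' = \<phi> c"
  shows "descend S p \<phi> (p c) = \<phi> c"
  unfolding descend_def using assms by (intro the_equality) blast+

text \<open>The Milnor K-group is a tower of two quotients, multilinearity first and Steinberg
  relations second. With the kernel of the composite map computed once, equality of classes can be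
  tested on chains, without handling cosets of cosets.\<close>

lemma (in comm_group) double_quotient:
  assumes S1: "S1 \<subseteq> carrier G" and S2: "S2 \<subseteq> carrier G"
  defines "H1 \<equiv> generate G S1"
  defines "Q \<equiv> G Mod H1"
  defines "H2 \<equiv> generate Q ((\<lambda>x. H1 #> x) ` S2)"
  defines "\<pi> \<equiv> \<lambda>x. H2 #>\<^bsub>Q\<^esub> (H1 #> x)"
  shows "comm_group (Q Mod H2)" "\<pi> \<in> hom G (Q Mod H2)" "carrier (Q Mod H2) = \<pi> ` carrier G"
    "kernel G (Q Mod H2) \<pi> = generate G (S1 \<union> S2)"
proof -
  have sg1: "subgroup H1 G" using S1 by (simp add: H1_def generate_is_subgroup)
  then interpret N1: normal H1 G by (rule subgroup_imp_normal)
  interpret Q: comm_group Q unfolding Q_def by (rule abelian_FactGroup[OF sg1])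
  have h1: "(\<lambda>x. H1 #> x) \<in> hom G Q" unfolding Q_def by (rule N1.r_coset_hom_Mod)
  then interpret g1: group_hom G Q "\<lambda>x. H1 #> x" by unfold_locales
  have im2: "(\<lambda>x. H1 #> x) ` S2 \<subseteq> carrier Q" using S2 g1.hom_closed by auto
  have sg2: "subgroup H2 Q" unfolding H2_def by (rule Q.generate_is_subgroup[OF im2])
  then interpret N2: normal H2 Q by (rule Q.subgroup_imp_normal)
  show cg: "comm_group (Q Mod H2)" by (rule Q.abelian_FactGroup[OF sg2])
  interpret QQ: comm_group "Q Mod H2" by (rule cg)
  have h2: "(\<lambda>x. H2 #>\<^bsub>Q\<^esub> x) \<in> hom Q (Q Mod H2)" by (rule N2.r_coset_hom_Mod)
  show h: "\<pi> \<in> hom G (Q Mod H2)"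
    unfolding \<pi>_def using h1 h2 by (auto simp: hom_def Pi_def)
  then interpret g: group_hom G "Q Mod H2" \<pi> by unfold_locales
  show "carrier (Q Mod H2) = \<pi> ` carrier G"
    unfolding carrier_FactGroup \<pi>_def by (simp add: Q_def carrier_FactGroup image_image)
  have H2: "H2 = (\<lambda>x. H1 #> x) ` generate G S2"
    unfolding H2_def by (rule g1.generate_img[OF S2])
  have g2: "generate G S2 \<subseteq> carrier G" using S2 generate_incl by blast
  show "kernel G (Q Mod H2) \<pi> = generate G (S1 \<union> S2)"
  proof
    show "generate G (S1 \<union> S2) \<subseteq> kernel G (Q Mod H2) \<pi>"
    proof (rule generate_subgroup_incl[OF _ g.subgroup_kernel])
      have "x \<in> kernel G (Q Mod H2) \<pi>" if "x \<in> S1" for x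
      proof -
        have "x \<in> H1" using that by (simp add: H1_def generate.incl)
        then have "H1 #> x = H1" using S1 sg1 that by (meson coset_join2 subsetD)
        moreover have "H1 = \<one>\<^bsub>Q\<^esub>" by (simp add: Q_def)
        ultimately show ?thesis using that S1
          using \<pi>_def Q.coset_join2[OF Q.one_closed sg2] N2.one_closed by (auto simp: kernel_def)
      qed
      moreover have "x \<in> kernel G (Q Mod H2) \<pi>" if "x \<in> S2" for x
      proof -
        have "H1 #> x \<in> H2" using that by (simp add: H2_def generate.incl)
        then have "H2 #>\<^bsub>Q\<^esub> (H1 #> x) = H2"
          by (meson N2.subset Q.coset_join2 sg2 subsetD)
        then show ?thesis using that S2 by (auto simp: kernel_def \<pi>_def)
      qed
      ultimately show "S1 \<union> S2 \<subseteq> kernel G (Q Mod H2) \<pi>" by blast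
    qed
    show "kernel G (Q Mod H2) \<pi> \<subseteq> generate G (S1 \<union> S2)"
    proof
      fix x assume "x \<in> kernel G (Q Mod H2) \<pi>"
      then have x: "x \<in> carrier G" and "H2 #>\<^bsub>Q\<^esub> (H1 #> x) = H2" by (auto simp: kernel_def \<pi>_def)
      then have "H1 #> x \<in> H2" using Q.coset_join1 sg2 g1.hom_closed
        by (metis N2.is_subgroup)
      \<comment> \<open>Modulo \<open>H1\<close> the element x agrees with some s generated by
        \<open>S2\<close>; the discrepancy t lies in \<open>H1\<close>, which gives the
        factorization x = t s.\<close>
      then obtain s where s: "s \<in> generate G S2" and eq: "H1 #> x = H1 #> s" using H2 by auto
      have sc: "s \<in> carrier G" using s g2 by blast
      have "x \<in> H1 #> s" using eq rcos_self[OF x sg1] by simp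
      then obtain t where t: "t \<in> H1" "x = t \<otimes> s" by (auto simp: r_coset_def)
      have "t \<in> generate G (S1 \<union> S2)" using t mono_generate[of S1 "S1 \<union> S2"] by (auto simp: H1_def)
      moreover have "s \<in> generate G (S1 \<union> S2)" using s mono_generate[of S2 "S1 \<union> S2"] by auto
      ultimately show "x \<in> generate G (S1 \<union> S2)" using t by (simp add: generate.eng)
    qed
  qed
qed

definition steinberg_words :: "('a, 'c) ring_scheme \<Rightarrow> nat \<Rightarrow> ('a list \<Rightarrow>\<^sub>0 int) set" where
  "steinberg_words A m = {frag_of xs | xs. xs \<in> tensor_words (units_of A) m \<and>
     (\<exists>i<m. \<exists>j<m. i \<noteq> j \<and> (xs ! i \<oplus>\<^bsub>A\<^esub> xs ! j = \<zero>\<^bsub>A\<^esub> \<or> xs ! i \<oplus>\<^bsub>A\<^esub> xs ! j = \<one>\<^bsub>A\<^esub>))}"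

definition K_relations :: "('a, 'c) ring_scheme \<Rightarrow> nat \<Rightarrow> ('a list \<Rightarrow>\<^sub>0 int) set" where
  "K_relations A m = multilinear_rels (units_of A) m \<union> steinberg_words A m"

text \<open>The kernel of \<open>K_class A m\<close> (see \<open>kernel_K_class\<close>): equality
  in the K-group becomes membership of a difference in this subgroup of chains.\<close>

definition K_null :: "('a, 'c) ring_scheme \<Rightarrow> nat \<Rightarrow> ('a list \<Rightarrow>\<^sub>0 int) set" where
  "K_null A m = generate (tensor_chains (units_of A) m) (K_relations A m)"

definition K_chains :: "('a, 'c) ring_scheme \<Rightarrow> nat \<Rightarrow> ('a list \<Rightarrow>\<^sub>0 int) set" where
  "K_chains A m = carrier (tensor_chains (units_of A) m)"

lemma K_chains_iff: "c \<in> K_chains A m \<longleftrightarrow> Poly_Mapping.keys c \<subseteq> tensor_words (units_of A) m"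
  by (simp add: K_chains_def tensor_chains_def)

lemma K_chains_0 [simp]: "0 \<in> K_chains A m"
  by (simp add: K_chains_iff)

lemma K_chains_diff: "a \<in> K_chains A m \<Longrightarrow> b \<in> K_chains A m \<Longrightarrow> a - b \<in> K_chains A m"
  using keys_diff[of a b] by (auto simp: K_chains_iff)

lemma K_chains_add: "a \<in> K_chains A m \<Longrightarrow> b \<in> K_chains A m \<Longrightarrow> a + b \<in> K_chains A m"
  using keys_add[of a b] by (auto simp: K_chains_iff)

lemma K_chains_cmul: "a \<in> K_chains A m \<Longrightarrow> frag_cmul k a \<in> K_chains A m"
  using keys_cmul[of k a] by (auto simp: K_chains_iff)

lemma frag_of_in_K_chains [simp]: "frag_of xs \<in> K_chains A m \<longleftrightarrow> xs \<in> tensor_words (units_of A) m"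
  by (simp add: K_chains_iff)

lemma tensor_words_append:
  "xs \<in> tensor_words G p \<Longrightarrow> ys \<in> tensor_words G q \<Longrightarrow> xs @ ys \<in> tensor_words G (p + q)"
  by (auto simp: tensor_words_def)

lemma K_chains_induct [consumes 1, case_names zero one diff]:
  assumes "c \<in> K_chains A m" "P 0" "\<And>xs. xs \<in> tensor_words (units_of A) m \<Longrightarrow> P (frag_of xs)"
    "\<And>a b. P a \<Longrightarrow> P b \<Longrightarrow> P (a - b)"
  shows "P c"
  using assms by (intro frag_induction[of c "tensor_words (units_of A) m" P]) (auto simp: K_chains_iff)

context ring
begin

lemma multilinear_rels_chains: "multilinear_rels (units_of R) m \<subseteq> K_chains R m"
proof -
  interpret U: group "units_of R" by (rule units_group)
  show ?thesis
    unfolding multilinear_rels_def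
    by (auto intro!: K_chains_diff simp: tensor_words_def)
qed

lemma K_relations_chains: "K_relations R m \<subseteq> K_chains R m"
  using multilinear_rels_chains by (auto simp: K_relations_def steinberg_words_def)

lemma comm_group_chains: "comm_group (tensor_chains (units_of R) m)"
  by (simp add: tensor_chains_def abelian_free_Abelian_group)

lemma
  shows comm_group_milnor_K: "comm_group (milnor_K R m)"
    and K_class_hom: "K_class R m \<in> hom (tensor_chains (units_of R) m) (milnor_K R m)"
    and carrier_milnor_K: "carrier (milnor_K R m) = K_class R m ` K_chains R m"
    and kernel_K_class: "kernel (tensor_chains (units_of R) m) (milnor_K R m) (K_class R m) = K_null R m"
proof -
  let ?S = "steinberg_words R m"
  interpret C: comm_group "tensor_chains (units_of R) m" by (rule comm_group_chains)
  have S: "?S \<subseteq> carrier (tensor_chains (units_of R) m)" by (auto simp: steinberg_words_def tensor_chains_def)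
  \<comment> \<open>Steinberg tensors are the images of Steinberg words, which is the shape in which
    \<open>double_quotient\<close> expects the second set of relations.\<close>
  have st: "steinberg_tensors R m = (\<lambda>c. tensor_class (units_of R) m c) ` ?S"
    by (auto simp: steinberg_tensors_def steinberg_words_def image_def)
  note D = C.double_quotient[OF multilinear_rels_chains[of m, unfolded K_chains_def] S]
  have *: "milnor_K R m = tensor_chains (units_of R) m Mod
     generate (tensor_chains (units_of R) m) (multilinear_rels (units_of R) m) Mod
     generate (tensor_chains (units_of R) m Mod
      generate (tensor_chains (units_of R) m) (multilinear_rels (units_of R) m))
        ((\<lambda>c. tensor_class (units_of R) m c) ` ?S)"
    by (simp only: milnor_K_def tensor_power_def st)
  have **: "K_class R m = (\<lambda>c. generate (tensor_chains (units_of R) m Mod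
      generate (tensor_chains (units_of R) m) (multilinear_rels (units_of R) m))
        ((\<lambda>c. tensor_class (units_of R) m c) ` ?S) #>\<^bsub>tensor_chains (units_of R) m Mod
      generate (tensor_chains (units_of R) m) (multilinear_rels (units_of R) m)\<^esub> tensor_class (units_of R) m c)"
    by (rule ext) (simp only: K_class_def tensor_power_def st)
  show "comm_group (milnor_K R m)" using D(1) by (simp only: * tensor_class_def)
  show "K_class R m \<in> hom (tensor_chains (units_of R) m) (milnor_K R m)"
    using D(2) by (simp only: * ** tensor_class_def)
  show "carrier (milnor_K R m) = K_class R m ` K_chains R m"
    using D(3) by (simp only: * ** tensor_class_def K_chains_def)
  show "kernel (tensor_chains (units_of R) m) (milnor_K R m) (K_class R m) = K_null R m"
    using D(4) by (simp only: * ** tensor_class_def K_null_def K_relations_def)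
qed

lemma K_class_closed: "c \<in> K_chains R m \<Longrightarrow> K_class R m c \<in> carrier (milnor_K R m)"
  using carrier_milnor_K by auto

lemma K_class_add:
  "a \<in> K_chains R m \<Longrightarrow> b \<in> K_chains R m \<Longrightarrow> K_class R m (a + b) = K_class R m a \<otimes>\<^bsub>milnor_K R m\<^esub> K_class R m b"
  using K_class_hom[of m] by (auto simp: hom_def K_chains_def tensor_chains_def)

lemma group_hom_K_class: "group_hom (tensor_chains (units_of R) m) (milnor_K R m) (K_class R m)"
  using comm_group_chains comm_group_milnor_K K_class_hom
  by (simp add: comm_group_def group_hom_axioms_def group_hom_def)

lemma K_class_eq_iff:
  assumes "a \<in> K_chains R m" "b \<in> K_chains R m"
  shows "K_class R m a = K_class R m b \<longleftrightarrow> a - b \<in> K_null R m"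
proof -
  interpret g: comm_group "milnor_K R m" by (rule comm_group_milnor_K)
  have ab: "a - b \<in> K_chains R m" using assms by (rule K_chains_diff)
  have "K_class R m a = K_class R m (a - b) \<otimes>\<^bsub>milnor_K R m\<^esub> K_class R m b"
    using K_class_add[OF ab assms(2)] by simp
  then have "K_class R m a = K_class R m b \<longleftrightarrow> K_class R m (a - b) = \<one>\<^bsub>milnor_K R m\<^esub>"
    using g.right_cancel[OF K_class_closed[OF assms(2)] K_class_closed[OF ab] g.one_closed]
      g.l_one[OF K_class_closed[OF assms(2)]] by argo
  also have "\<dots> \<longleftrightarrow> a - b \<in> K_null R m"
    using ab by (simp add: kernel_K_class[symmetric] kernel_def K_chains_def)
  finally show ?thesis .
qed

lemma K_null_iff: "c \<in> K_null R m \<longleftrightarrow> c \<in> K_chains R m \<and> K_class R m c = \<one>\<^bsub>milnor_K R m\<^esub>"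
  using kernel_K_class[of m] by (auto simp: kernel_def K_chains_def)

lemma K_null_0: "0 \<in> K_null R m"
  using K_class_eq_iff[of 0 m 0] by simp

lemma K_null_diff: "a \<in> K_null R m \<Longrightarrow> b \<in> K_null R m \<Longrightarrow> a - b \<in> K_null R m"
  by (metis K_class_eq_iff K_null_iff)

lemma K_null_uminus: "a \<in> K_null R m \<Longrightarrow> - a \<in> K_null R m"
  using K_null_diff[OF K_null_0] by force

lemma K_null_add: "a \<in> K_null R m \<Longrightarrow> b \<in> K_null R m \<Longrightarrow> a + b \<in> K_null R m"
  using K_null_diff[of a m "- b"] K_null_uminus by force

lemma K_null_rel: "r \<in> K_relations R m \<Longrightarrow> r \<in> K_null R m"
  by (simp add: K_null_def generate.incl)

lemma K_null_induct [consumes 1, case_names zero rel diff]: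
  assumes "c \<in> K_null R m" "P 0" "\<And>r. r \<in> K_relations R m \<Longrightarrow> P r"
    "\<And>a b. P a \<Longrightarrow> P b \<Longrightarrow> P (a - b)"
  shows "P c"
  using assms(1) unfolding K_null_def
proof (induction rule: generate.induct)
  case one
  then show ?case using assms(2) by (simp add: tensor_chains_def)
next
  case (incl h)
  then show ?case using assms by blast
next
  case (inv h)
  then have "Poly_Mapping.keys h \<subseteq> tensor_words (units_of R) m"
    using K_relations_chains K_chains_iff by blast
  then show ?case
    using assms(4)[OF assms(2) assms(3)[OF inv]] by (simp add: tensor_chains_def)
next
  case (eng h1 h2)
  \<comment> \<open>The hypothesis on \<open>P\<close> only covers differences, so the sum
    \<open>h1 + h2\<close> is presented as one.\<close>
  have "P (h1 - (0 - h2))" using eng assms by blast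
  then show ?case by (simp add: tensor_chains_def)
qed

end

section \<open>Functoriality and products\<close>

definition chain_map :: "('a \<Rightarrow> 'b) \<Rightarrow> ('a list \<Rightarrow>\<^sub>0 int) \<Rightarrow> ('b list \<Rightarrow>\<^sub>0 int)" where
  "chain_map h = frag_extend (\<lambda>xs. frag_of (map h xs))"

lemma chain_map_simps [simp]:
  "chain_map h 0 = 0" "chain_map h (frag_of xs) = frag_of (map h xs)"
  "chain_map h (a - b) = chain_map h a - chain_map h b"
  "chain_map h (a + b) = chain_map h a + chain_map h b"
  "chain_map h (frag_cmul k a) = frag_cmul k (chain_map h a)"
  by (simp_all add: chain_map_def frag_extend_diff frag_extend_add frag_extend_cmul)

lemma ring_hom_Units:
  assumes "ring R" "ring S" "h \<in> ring_hom R S" "x \<in> Units R"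
  shows "h x \<in> Units S"
proof -
  interpret R: ring R by fact
  interpret S: ring S by fact
  have "h x \<otimes>\<^bsub>S\<^esub> h (inv\<^bsub>R\<^esub> x) = \<one>\<^bsub>S\<^esub>" "h (inv\<^bsub>R\<^esub> x) \<otimes>\<^bsub>S\<^esub> h x = \<one>\<^bsub>S\<^esub>"
    using assms(3,4) R.Units_closed R.Units_inv_closed
    by (metis R.Units_r_inv R.Units_l_inv ring_hom_mult ring_hom_one)+
  moreover have "h x \<in> carrier S" "h (inv\<^bsub>R\<^esub> x) \<in> carrier S"
    using assms(3,4) R.Units_closed R.Units_inv_closed by (meson ring_hom_closed)+
  ultimately show ?thesis unfolding Units_def by blast
qed

context
  fixes R S :: "('a, 'c) ring_scheme" and h
  assumes R: "ring R" and S: "ring S" and h: "h \<in> ring_hom R S"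
begin

lemma map_tensor_words: "xs \<in> tensor_words (units_of R) m \<Longrightarrow> map h xs \<in> tensor_words (units_of S) m"
  using ring_hom_Units[OF R S h] by (auto simp: tensor_words_def units_of_carrier)

lemma chain_map_closed: "c \<in> K_chains R m \<Longrightarrow> chain_map h c \<in> K_chains S m"
  by (induction rule: K_chains_induct) (auto intro: map_tensor_words K_chains_diff)

lemma chain_map_relations:
  assumes "r \<in> K_relations R m" shows "chain_map h r \<in> K_relations S m"
proof -
  interpret R: ring R by (rule R)
  interpret S: ring S by (rule S)
  from assms consider (lin) us x y vs where
      "r = frag_of (us @ [x \<otimes>\<^bsub>R\<^esub> y] @ vs) - frag_of (us @ [x] @ vs) - frag_of (us @ [y] @ vs)"
      "us @ [x] @ vs \<in> tensor_words (units_of R) m" "y \<in> Units R"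
    | (st) xs i j where "r = frag_of xs" "xs \<in> tensor_words (units_of R) m" "i < m" "j < m" "i \<noteq> j"
       "xs ! i \<oplus>\<^bsub>R\<^esub> xs ! j = \<zero>\<^bsub>R\<^esub> \<or> xs ! i \<oplus>\<^bsub>R\<^esub> xs ! j = \<one>\<^bsub>R\<^esub>"
    by (auto simp: K_relations_def steinberg_words_def multilinear_rels_def units_of_mult units_of_carrier)
  then show ?thesis
  proof cases
    case lin
    have "x \<in> carrier R" "y \<in> carrier R"
      using lin by (auto simp: tensor_words_def units_of_carrier)
    then have "h (x \<otimes>\<^bsub>R\<^esub> y) = h x \<otimes>\<^bsub>S\<^esub> h y" using h by (simp add: ring_hom_mult)
    then have "chain_map h r = frag_of (map h us @ [h x \<otimes>\<^bsub>S\<^esub> h y] @ map h vs)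
        - frag_of (map h us @ [h x] @ map h vs) - frag_of (map h us @ [h y] @ map h vs)"
      using lin by simp
    moreover have "map h us @ [h x] @ map h vs \<in> tensor_words (units_of S) m"
      using map_tensor_words[OF lin(2)] by simp
    moreover have "h y \<in> Units S" using ring_hom_Units[OF R S h lin(3)] .
    ultimately show ?thesis unfolding K_relations_def multilinear_rels_def units_of_mult units_of_carrier
      by blast
  next
    case st
    have "xs ! i \<in> carrier R" "xs ! j \<in> carrier R"
      using st nth_mem by (auto simp: tensor_words_def units_of_carrier)
    then have "h (xs ! i \<oplus>\<^bsub>R\<^esub> xs ! j) = h (xs ! i) \<oplus>\<^bsub>S\<^esub> h (xs ! j)" using h by (simp add: ring_hom_add)
    then have "map h xs ! i \<oplus>\<^bsub>S\<^esub> map h xs ! j = \<zero>\<^bsub>S\<^esub> \<or> map h xs ! i \<oplus>\<^bsub>S\<^esub> map h xs ! j = \<one>\<^bsub>S\<^esub>"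
      using st ring_hom_zero[OF h R S] ring_hom_one[OF h] by (auto simp: tensor_words_def)
    with st map_tensor_words[OF st(2)] show ?thesis
      unfolding K_relations_def steinberg_words_def by auto
  qed
qed

lemma chain_map_null: "c \<in> K_null R m \<Longrightarrow> chain_map h c \<in> K_null S m"
  by (induction rule: ring.K_null_induct[OF R, consumes 1])
     (auto intro: ring.K_null_0[OF S] ring.K_null_diff[OF S] ring.K_null_rel[OF S chain_map_relations])

lemma K_class_chain_map_cong:
  assumes "a \<in> K_chains R m" "b \<in> K_chains R m" "K_class R m a = K_class R m b"
  shows "K_class S m (chain_map h a) = K_class S m (chain_map h b)"
  using assms chain_map_null[of "a - b" m]
  by (simp add: ring.K_class_eq_iff[OF R] ring.K_class_eq_iff[OF S] chain_map_closed)

text \<open>Functoriality of K_m; for \<open>h = merom_act \<gamma>\<close> this is the action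
  \<open>K_act\<close> (see \<open>K_act_eq\<close>).\<close>

definition "K_map m = descend (K_chains R m) (K_class R m) (\<lambda>c. K_class S m (chain_map h c))"

lemma K_map_class: "c \<in> K_chains R m \<Longrightarrow> K_map m (K_class R m c) = K_class S m (chain_map h c)"
  unfolding K_map_def by (rule descend_eq; (assumption | (rule K_class_chain_map_cong; assumption)))

lemma K_map_hom: "K_map m \<in> hom (milnor_K R m) (milnor_K S m)"
proof (rule homI)
  fix x assume "x \<in> carrier (milnor_K R m)"
  then obtain a where a: "a \<in> K_chains R m" "x = K_class R m a"
    by (auto simp: ring.carrier_milnor_K[OF R])
  then show "K_map m x \<in> carrier (milnor_K S m)"
    by (simp add: K_map_class chain_map_closed ring.K_class_closed[OF S])
  fix y assume "y \<in> carrier (milnor_K R m)"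
  then obtain b where b: "b \<in> K_chains R m" "y = K_class R m b"
    by (auto simp: ring.carrier_milnor_K[OF R])
  have "x \<otimes>\<^bsub>milnor_K R m\<^esub> y = K_class R m (a + b)"
    using a b by (simp add: ring.K_class_add[OF R])
  then show "K_map m (x \<otimes>\<^bsub>milnor_K R m\<^esub> y) = K_map m x \<otimes>\<^bsub>milnor_K S m\<^esub> K_map m y"
    using a b by (simp add: K_map_class K_chains_add ring.K_class_add[OF S] chain_map_closed)
qed

end

section \<open>Concatenation of chains and the product of K-groups\<close>

lemma chain_concat_left [simp]:
  "chain_concat 0 b = 0" "chain_concat (a - a') b = chain_concat a b - chain_concat a' b"
  "chain_concat (frag_of xs) b = frag_extend (\<lambda>ys. frag_of (xs @ ys)) b"
  by (simp_all add: chain_concat_def frag_extend_diff)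

lemma chain_concat_right [simp]:
  "chain_concat a 0 = 0" "chain_concat a (b - b') = chain_concat a b - chain_concat a b'"
proof -
  show "chain_concat a 0 = 0"
    by (induction a rule: frag_induction[OF subset_UNIV]) auto
  show "chain_concat a (b - b') = chain_concat a b - chain_concat a b'"
    by (induction a rule: frag_induction[OF subset_UNIV]) (auto simp: frag_extend_diff)
qed

lemma chain_concat_closed:
  assumes "a \<in> K_chains R p" "b \<in> K_chains R q"
  shows "chain_concat a b \<in> K_chains R (p + q)"
  using assms(1)
proof (induction rule: K_chains_induct)
  case (one xs)
  show ?case using assms(2) one
    by (induction rule: K_chains_induct) (auto intro: K_chains_diff tensor_words_append simp: frag_extend_diff)
qed (auto intro: K_chains_diff)

lemma chain_map_concat: "chain_map h (chain_concat a b) = chain_concat (chain_map h a) (chain_map h b)"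
proof (induction a rule: frag_induction[OF subset_UNIV])
  case (2 xs)
  show ?case
    by (induction b rule: frag_induction[OF subset_UNIV]) (auto simp: frag_extend_diff)
qed auto

context ring
begin

text \<open>Both kinds of relation concern only one or two slots of a word, so surrounding it by
  further entries yields a relation again. Null chains hence absorb concatenation on either side,
  which makes \<open>K_mult\<close> independent of representatives.\<close>

lemma relation_concat:
  assumes "r \<in> K_relations R m" "ys \<in> tensor_words (units_of R) p" "zs \<in> tensor_words (units_of R) q"
  shows "frag_extend (\<lambda>xs. frag_of (ys @ xs @ zs)) r \<in> K_relations R (p + m + q)"
  using assms(1) unfolding K_relations_def
proof (rule UnE)
  assume "r \<in> multilinear_rels (units_of R) m"
  then obtain us x y vs where r:
      "r = frag_of (us @ [x \<otimes>\<^bsub>units_of R\<^esub> y] @ vs) - frag_of (us @ [x] @ vs) - frag_of (us @ [y] @ vs)"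
      "us @ [x] @ vs \<in> tensor_words (units_of R) m" "y \<in> carrier (units_of R)"
    by (auto simp: multilinear_rels_def)
  then have "frag_extend (\<lambda>xs. frag_of (ys @ xs @ zs)) r = frag_of ((ys @ us) @ [x \<otimes>\<^bsub>units_of R\<^esub> y] @ (vs @ zs))
    - frag_of ((ys @ us) @ [x] @ (vs @ zs)) - frag_of ((ys @ us) @ [y] @ (vs @ zs))"
    by (simp add: frag_extend_diff)
  moreover have "(ys @ us) @ [x] @ (vs @ zs) \<in> tensor_words (units_of R) (p + m + q)"
    using tensor_words_append[OF tensor_words_append[OF assms(2) r(2)] assms(3)] by simp
  ultimately have "frag_extend (\<lambda>xs. frag_of (ys @ xs @ zs)) r \<in> multilinear_rels (units_of R) (p + m + q)"
    unfolding multilinear_rels_def using r(3) by blast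
  then show "frag_extend (\<lambda>xs. frag_of (ys @ xs @ zs)) r
      \<in> multilinear_rels (units_of R) (p + m + q) \<union> steinberg_words R (p + m + q)" by simp
next
  assume "r \<in> steinberg_words R m"
  then obtain xs i j where r: "r = frag_of xs" "xs \<in> tensor_words (units_of R) m" "i < m" "j < m" "i \<noteq> j"
    "xs ! i \<oplus> xs ! j = \<zero> \<or> xs ! i \<oplus> xs ! j = \<one>" by (auto simp: steinberg_words_def)
  let ?w = "ys @ xs @ zs"
  have "?w ! (p + i) \<oplus> ?w ! (p + j) = \<zero> \<or> ?w ! (p + i) \<oplus> ?w ! (p + j) = \<one>"
    using r assms(2) by (auto simp: tensor_words_def nth_append)
  moreover have "p + i < p + m + q" "p + j < p + m + q" "p + i \<noteq> p + j" using r by auto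
  moreover have "?w \<in> tensor_words (units_of R) (p + m + q)"
    using tensor_words_append[OF tensor_words_append[OF assms(2) r(2)] assms(3)] by simp
  ultimately have "frag_of ?w \<in> steinberg_words R (p + m + q)" unfolding steinberg_words_def by blast
  then show "frag_extend (\<lambda>xs. frag_of (ys @ xs @ zs)) r
      \<in> multilinear_rels (units_of R) (p + m + q) \<union> steinberg_words R (p + m + q)" using r by simp
qed

lemma relation_concat_right:
  assumes "r \<in> K_relations R p" "ys \<in> tensor_words (units_of R) q"
  shows "chain_concat r (frag_of ys) \<in> K_relations R (p + q)"
  using relation_concat[OF assms(1), of "[]" 0 ys q] assms(2) by (simp add: tensor_words_def chain_concat_def)

lemma relation_concat_left:
  assumes "r \<in> K_relations R q" "ys \<in> tensor_words (units_of R) p"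
  shows "chain_concat (frag_of ys) r \<in> K_relations R (p + q)"
  using relation_concat[OF assms(1), of ys p "[]" 0] assms(2) by (simp add: tensor_words_def)

lemma null_concat_right:
  assumes "a \<in> K_null R p" "b \<in> K_chains R q"
  shows "chain_concat a b \<in> K_null R (p + q)"
  using assms(1)
proof (induction rule: K_null_induct)
  case (rel r)
  show ?case using assms(2)
    by (induction rule: K_chains_induct)
       (auto intro: K_null_0 K_null_diff K_null_rel relation_concat_right[OF rel])
qed (auto intro: K_null_0 K_null_diff)

lemma null_concat_left:
  assumes "b \<in> K_null R q" "a \<in> K_chains R p"
  shows "chain_concat a b \<in> K_null R (p + q)"
  using assms(1)
proof (induction rule: K_null_induct)
  case (rel r)
  show ?case using assms(2)
  proof (induction rule: K_chains_induct)
    case (one xs)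
    show ?case using K_null_rel[OF relation_concat_left[OF rel one]] .
  qed (auto intro: K_null_0 K_null_diff)
qed (auto intro: K_null_0 K_null_diff)

lemma K_mult_class:
  assumes "a \<in> K_chains R p" "b \<in> K_chains R q"
  shows "K_mult R p q (K_class R p a) (K_class R q b) = K_class R (p + q) (chain_concat a b)"
proof -
  have *: "K_class R (p + q) (chain_concat a' b') = K_class R (p + q) (chain_concat a b)"
    if a': "a' \<in> K_chains R p" "K_class R p a' = K_class R p a"
     and b': "b' \<in> K_chains R q" "K_class R q b' = K_class R q b" for a' b'
  proof -
    \<comment> \<open>Change one factor at a time: a'b' - ab = (a' - a) b' + a (b' - b).\<close>
    have "chain_concat (a' - a) b' \<in> K_null R (p + q)"
      using a' b' assms by (intro null_concat_right) (auto simp: K_class_eq_iff)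
    moreover have "chain_concat a (b' - b) \<in> K_null R (p + q)"
      using a' b' assms by (intro null_concat_left) (auto simp: K_class_eq_iff)
    ultimately have "chain_concat (a' - a) b' + chain_concat a (b' - b) \<in> K_null R (p + q)"
      by (rule K_null_add)
    then show ?thesis
      using a' b' assms by (simp add: K_class_eq_iff chain_concat_closed)
  qed
  let ?p = "\<lambda>(a, b). (K_class R p a, K_class R q b)" and ?f = "\<lambda>(a, b). K_class R (p + q) (chain_concat a b)"
  have "descend (K_chains R p \<times> K_chains R q) ?p ?f (?p (a, b)) = ?f (a, b)"
  proof (rule descend_eq)
    show "(a, b) \<in> K_chains R p \<times> K_chains R q" using assms by simp
    fix c assume c: "c \<in> K_chains R p \<times> K_chains R q" "?p c = ?p (a, b)"
    obtain a' b' where "c = (a', b')" by (cases c)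
    with c *[of a' b'] show "?f c = ?f (a, b)" by simp
  qed
  then show ?thesis by (simp add: K_mult_def K_chains_def)
qed

end

section \<open>Meromorphic functions and exponentials\<close>

lemma multi_holomorphic_const: "multi_holomorphic_on (\<lambda>z. c) W"
  unfolding multi_holomorphic_on_def by (auto intro!: exI[of _ "\<lambda>v. 0"])

lemma multi_holomorphic_add:
  assumes "multi_holomorphic_on f W" "multi_holomorphic_on g W"
  shows "multi_holomorphic_on (\<lambda>z. f z + g z) W"
  unfolding multi_holomorphic_on_def
proof
  fix z assume "z \<in> W"
  then obtain D E where "(f has_derivative D) (at z)" "\<And>c v. D (c *s v) = c * D v"
    "(g has_derivative E) (at z)" "\<And>c v. E (c *s v) = c * E v"
    using assms unfolding multi_holomorphic_on_def by meson
  then show "\<exists>D. ((\<lambda>z. f z + g z) has_derivative D) (at z) \<and> (\<forall>c v. D (c *s v) = c * D v)"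
    by (intro exI[of _ "\<lambda>v. D v + E v"]) (auto intro: has_derivative_add simp: ring_distribs)
qed

lemma multi_holomorphic_mult:
  assumes "multi_holomorphic_on f W" "multi_holomorphic_on g W"
  shows "multi_holomorphic_on (\<lambda>z. f z * g z) W"
  unfolding multi_holomorphic_on_def
proof
  fix z assume "z \<in> W"
  then obtain D E where "(f has_derivative D) (at z)" "\<And>c v. D (c *s v) = c * D v"
    "(g has_derivative E) (at z)" "\<And>c v. E (c *s v) = c * E v"
    using assms unfolding multi_holomorphic_on_def by meson
  then show "\<exists>D. ((\<lambda>z. f z * g z) has_derivative D) (at z) \<and> (\<forall>c v. D (c *s v) = c * D v)"
    by (intro exI[of _ "\<lambda>v. f z * E v + D v * g z"] conjI has_derivative_mult) (simp_all add: algebra_simps)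
qed

lemma multi_holomorphic_subset: "multi_holomorphic_on f W \<Longrightarrow> W' \<subseteq> W \<Longrightarrow> multi_holomorphic_on f W'"
  unfolding multi_holomorphic_on_def by blast

lemma form_ext_add: "form_ext l (x + y) = form_ext l x + form_ext l y"
  by (simp add: form_ext_def algebra_simps sum.distrib)

lemma form_ext_scale: "form_ext l (c *s x) = c * form_ext l x"
  by (simp add: form_ext_def sum_distrib_left algebra_simps)

lemma bounded_linear_form_ext: "bounded_linear (form_ext l)"
proof -
  have "linear (form_ext l)"
  proof (rule linearI)
    fix r :: real and x :: "complex^'a"
    have "r *\<^sub>R x = complex_of_real r *s x" by (simp add: vec_eq_iff) (simp add: scaleR_conv_of_real)
    then show "form_ext l (r *\<^sub>R x) = r *\<^sub>R form_ext l x"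
      by (simp add: form_ext_scale scaleR_conv_of_real)
  qed (rule form_ext_add)
  then show ?thesis by (simp add: linear_conv_bounded_linear)
qed

lemma multi_holomorphic_exp:
  "multi_holomorphic_on (\<lambda>z. exp (2 * of_real pi * \<i> * (form_ext l z - of_rat r))) W"
  unfolding multi_holomorphic_on_def
proof
  fix z
  have "((\<lambda>z. 2 * of_real pi * \<i> * (form_ext l z - of_rat r)) has_derivative
      (\<lambda>v. 2 * of_real pi * \<i> * (form_ext l v - 0))) (at z)"
    by (intro has_derivative_mult_right has_derivative_diff has_derivative_const
      bounded_linear_imp_has_derivative[OF bounded_linear_form_ext])
  from has_derivative_compose[OF this DERIV_exp[unfolded has_field_derivative_def]]
  have "((\<lambda>z. exp (2 * of_real pi * \<i> * (form_ext l z - of_rat r))) has_derivative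
    (\<lambda>v. exp (2 * of_real pi * \<i> * (form_ext l z - of_rat r)) * (2 * of_real pi * \<i> * form_ext l v))) (at z)"
    by simp
  then show "\<exists>D. ((\<lambda>z. exp (2 * of_real pi * \<i> * (form_ext l z - of_rat r))) has_derivative D) (at z) \<and>
      (\<forall>c v. D (c *s v) = c * D v)"
    by (intro exI conjI) (auto simp: form_ext_scale)
qed

lemma merom_carrier_iff: "f \<in> carrier merom_ring \<longleftrightarrow> f \<in> extensional generic \<and> (\<forall>p. \<exists>W g h. open W \<and> p \<in> W \<and>
       multi_holomorphic_on g W \<and> multi_holomorphic_on h W \<and>
       (\<forall>z\<in>W \<inter> generic. h z \<noteq> 0 \<and> f z = g z / h z))"
  by (simp add: merom_ring_def)

lemma merom_quotient_in_carrier: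
  assumes "multi_holomorphic_on g UNIV" "multi_holomorphic_on h UNIV" "\<And>z. z \<in> generic \<Longrightarrow> h z \<noteq> 0"
  shows "(\<lambda>z\<in>generic. g z / h z) \<in> carrier merom_ring"
  unfolding merom_carrier_iff using assms by (auto intro!: exI[of _ UNIV])

lemma merom_in_carrier:
  assumes "multi_holomorphic_on g UNIV"
  shows "(\<lambda>z\<in>generic. g z) \<in> carrier merom_ring"
  using merom_quotient_in_carrier[OF assms multi_holomorphic_const[of 1]] by simp

lemma merom_combine:
  assumes f: "f \<in> carrier merom_ring" and f': "f' \<in> carrier merom_ring"
  shows "(\<lambda>z\<in>generic. f z * f' z) \<in> carrier merom_ring" "(\<lambda>z\<in>generic. f z + f' z) \<in> carrier merom_ring"
proof -
  \<comment> \<open>Intersecting the two neighbourhoods presents both functions as quotients over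
    one \<open>W\<close>, ready for common denominators.\<close>
  have "\<exists>W g h g' h'. open W \<and> p \<in> W \<and>
       multi_holomorphic_on g W \<and> multi_holomorphic_on h W \<and> multi_holomorphic_on g' W \<and> multi_holomorphic_on h' W \<and>
       (\<forall>z\<in>W \<inter> generic. h z \<noteq> 0 \<and> h' z \<noteq> 0 \<and> f z = g z / h z \<and> f' z = g' z / h' z)" for p
  proof -
    obtain W g h where 1: "open W" "p \<in> W" "multi_holomorphic_on g W" "multi_holomorphic_on h W"
       "\<forall>z\<in>W \<inter> generic. h z \<noteq> 0 \<and> f z = g z / h z"
      using f unfolding merom_carrier_iff by meson
    obtain W' g' h' where 2: "open W'" "p \<in> W'" "multi_holomorphic_on g' W'" "multi_holomorphic_on h' W'"
       "\<forall>z\<in>W' \<inter> generic. h' z \<noteq> 0 \<and> f' z = g' z / h' z"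
      using f' unfolding merom_carrier_iff by meson
    show ?thesis
      using 1 2 by (intro exI[of _ "W \<inter> W'"] exI[of _ g] exI[of _ h] exI[of _ g'] exI[of _ h'])
        (auto intro: multi_holomorphic_subset)
  qed
  note * = this
  show "(\<lambda>z\<in>generic. f z * f' z) \<in> carrier merom_ring"
    unfolding merom_carrier_iff
  proof (intro conjI allI)
    fix p
    obtain W g h g' h' where w: "open W" "p \<in> W"
       "multi_holomorphic_on g W" "multi_holomorphic_on h W" "multi_holomorphic_on g' W" "multi_holomorphic_on h' W"
       "\<forall>z\<in>W \<inter> generic. h z \<noteq> 0 \<and> h' z \<noteq> 0 \<and> f z = g z / h z \<and> f' z = g' z / h' z"
      using *[of p] by blast
    show "\<exists>W g h. open W \<and> p \<in> W \<and>
       multi_holomorphic_on g W \<and> multi_holomorphic_on h W \<and>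
       (\<forall>z\<in>W \<inter> generic. h z \<noteq> 0 \<and> (\<lambda>z\<in>generic. f z * f' z) z = g z / h z)"
      using w by (intro exI[of _ W] exI[of _ "\<lambda>z. g z * g' z"] exI[of _ "\<lambda>z. h z * h' z"])
        (auto intro: multi_holomorphic_mult)
  qed simp
  show "(\<lambda>z\<in>generic. f z + f' z) \<in> carrier merom_ring"
    unfolding merom_carrier_iff
  proof (intro conjI allI)
    fix p
    obtain W g h g' h' where w: "open W" "p \<in> W"
       "multi_holomorphic_on g W" "multi_holomorphic_on h W" "multi_holomorphic_on g' W" "multi_holomorphic_on h' W"
       "\<forall>z\<in>W \<inter> generic. h z \<noteq> 0 \<and> h' z \<noteq> 0 \<and> f z = g z / h z \<and> f' z = g' z / h' z"
      using *[of p] by blast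
    show "\<exists>W g h. open W \<and> p \<in> W \<and>
       multi_holomorphic_on g W \<and> multi_holomorphic_on h W \<and>
       (\<forall>z\<in>W \<inter> generic. h z \<noteq> 0 \<and> (\<lambda>z\<in>generic. f z + f' z) z = g z / h z)"
      using w by (intro exI[of _ W] exI[of _ "\<lambda>z. g z * h' z + g' z * h z"] exI[of _ "\<lambda>z. h z * h' z"])
        (auto intro!: multi_holomorphic_mult multi_holomorphic_add simp: add_frac_eq)
  qed simp
qed

lemma merom_ops:
  "f \<otimes>\<^bsub>merom_ring\<^esub> g = (\<lambda>z\<in>generic. f z * g z)"
  "f \<oplus>\<^bsub>merom_ring\<^esub> g = (\<lambda>z\<in>generic. f z + g z)"
  "\<one>\<^bsub>merom_ring\<^esub> = (\<lambda>z\<in>generic. 1)" "\<zero>\<^bsub>merom_ring\<^esub> = (\<lambda>z\<in>generic. 0)"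
  by (simp_all add: merom_ring_def)

lemma merom_extensional: "f \<in> carrier merom_ring \<Longrightarrow> f \<in> extensional generic"
  by (simp add: merom_carrier_iff)

lemma merom_restrict: "f \<in> carrier merom_ring \<Longrightarrow> (\<lambda>z\<in>generic. f z) = f"
  by (simp add: merom_extensional extensional_restrict)

lemma cring_merom_ring: "cring (merom_ring :: (complex^'n::finite \<Rightarrow> complex) ring)"
proof (rule cringI)
  show "abelian_group (merom_ring :: (complex^'n \<Rightarrow> complex) ring)"
  proof (rule abelian_groupI)
    fix x :: "complex^'n \<Rightarrow> complex" assume x: "x \<in> carrier merom_ring"
    have "(\<lambda>z\<in>generic. - 1 * x z) \<in> carrier merom_ring"
      using merom_combine(1)[OF merom_in_carrier[OF multi_holomorphic_const[of "-1"]] x]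
      by (simp cong: restrict_cong)
    then show "\<exists>y\<in>carrier merom_ring. y \<oplus>\<^bsub>merom_ring\<^esub> x = \<zero>\<^bsub>merom_ring\<^esub>"
      by (intro bexI[of _ "\<lambda>z\<in>generic. - 1 * x z"]) (auto simp: merom_ops fun_eq_iff restrict_def)
  qed (auto simp: merom_ops merom_combine merom_in_carrier multi_holomorphic_const merom_restrict
       algebra_simps cong: restrict_cong)
  show "comm_monoid (merom_ring :: (complex^'n \<Rightarrow> complex) ring)"
    by (rule comm_monoidI)
      (auto simp: merom_ops merom_combine merom_in_carrier multi_holomorphic_const merom_restrict
       algebra_simps cong: restrict_cong)
qed (auto simp: merom_ops algebra_simps cong: restrict_cong)

interpretation merom: cring "merom_ring :: (complex^'n::finite \<Rightarrow> complex) ring"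
  by (rule cring_merom_ring)

lemma merom_ring_UnitsI:
  assumes "multi_holomorphic_on f UNIV" "\<And>z. z \<in> generic \<Longrightarrow> f z \<noteq> 0"
  shows "(\<lambda>z\<in>generic. f z) \<in> Units merom_ring"
proof -
  have "(\<lambda>z\<in>generic. f z) \<in> carrier merom_ring" "(\<lambda>z\<in>generic. 1 / f z) \<in> carrier merom_ring"
    using assms by (auto intro: merom_in_carrier merom_quotient_in_carrier multi_holomorphic_const)
  then show ?thesis
    unfolding Units_def using assms(2)
    by (auto simp: merom_ops cong: restrict_cong intro!: bexI[of _ "\<lambda>z\<in>generic. 1 / f z"])
qed

section \<open>Exponentials as units, and the ring R(V)\<close>

lemma eps_in_Units: "eps r l \<in> Units merom_ring"
  unfolding eps_def by (rule merom_ring_UnitsI) (auto intro: multi_holomorphic_exp)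

lemma one_minus_eps_eq:
  "one_minus_eps r l = (\<lambda>z\<in>generic. 1 - exp (2 * of_real pi * \<i> * (form_ext l z - of_rat r)))"
proof -
  have e: "eps r l \<in> carrier merom_ring" using eps_in_Units by (rule merom.Units_closed)
  have "(\<lambda>z\<in>generic. - 1 * eps r l z) \<in> carrier merom_ring"
    using merom_combine(1)[OF merom_in_carrier[OF multi_holomorphic_const[of "-1"]] e]
    by (simp cong: restrict_cong)
  then have "\<ominus>\<^bsub>merom_ring\<^esub> eps r l = (\<lambda>z\<in>generic. - 1 * eps r l z)"
    using e by (intro merom.minus_equality) (auto simp: merom_ops cong: restrict_cong)
  then show ?thesis
    by (auto simp: one_minus_eps_def a_minus_def merom_ops eps_def cong: restrict_cong)
qed

lemma exp_two_pi_i_eq_1: "exp (2 * of_real pi * \<i> * w) = 1 \<longleftrightarrow> (\<exists>k::int. w = of_int k)"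
proof -
  have "exp (2 * of_real pi * \<i> * w) = exp 0 \<longleftrightarrow> (\<exists>k::int. 2 * of_real pi * \<i> * w = 0 + of_int (2 * k) * of_real pi * \<i>)"
    by (subst exp_eq) (simp add: algebra_simps)
  also have "\<dots> \<longleftrightarrow> (\<exists>k::int. w = of_int k)" by (simp add: algebra_simps)
  finally show ?thesis by simp
qed

lemma generic_eps_neq_1:
  assumes "z \<in> generic" "l \<in> dual" "l \<noteq> (\<lambda>x. 0)"
  shows "exp (2 * of_real pi * \<i> * (form_ext l z - of_rat r)) \<noteq> 1"
proof
  assume "exp (2 * of_real pi * \<i> * (form_ext l z - of_rat r)) = 1"
  then obtain k :: int where "form_ext l z - of_rat r = of_int k" unfolding exp_two_pi_i_eq_1 by blast
  then have "form_ext l z = of_rat (r + of_int k)" by (simp add: of_rat_add algebra_simps)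
  then show False using assms by (auto simp: generic_def)
qed

text \<open>The zeros of 1 - \<epsilon> lie on the hyperplanes where l takes a value in r + \<int>.
  The set \<open>generic\<close> avoids them, so the pointwise inverse is again a quotient of
  holomorphic functions.\<close>

lemma one_minus_eps_in_Units:
  assumes "l \<in> dual" "l \<noteq> (\<lambda>x. 0)"
  shows "one_minus_eps r l \<in> Units merom_ring"
  unfolding one_minus_eps_eq
proof (rule merom_ring_UnitsI)
  have "multi_holomorphic_on (\<lambda>z. 1 + (- 1) * exp (2 * of_real pi * \<i> * (form_ext l z - of_rat r))) UNIV"
    by (intro multi_holomorphic_add multi_holomorphic_mult multi_holomorphic_const multi_holomorphic_exp)
  then show "multi_holomorphic_on (\<lambda>z. 1 - exp (2 * of_real pi * \<i> * (form_ext l z - of_rat r))) UNIV" by simp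
qed (use generic_eps_neq_1[OF _ assms] in fastforce)

lemma C_generators_Units:
  "{eps r l | r l. l \<in> dual \<and> l \<noteq> (\<lambda>x. 0)} \<union> {one_minus_eps r l | r l. l \<in> dual \<and> l \<noteq> (\<lambda>x. 0)}
    \<subseteq> carrier (units_of merom_ring)"
  by (auto simp: units_of_carrier eps_in_Units one_minus_eps_in_Units)

lemma subgroup_C_units: "subgroup C_units (units_of merom_ring)"
  unfolding C_units_def by (rule group.generate_is_subgroup[OF merom.units_group C_generators_Units])

lemma subgroup_E_units: "subgroup E_units (units_of merom_ring)"
  unfolding E_units_def by (rule group.generate_is_subgroup[OF merom.units_group]) (use C_generators_Units in blast)

lemma E_units_subset_C_units: "E_units \<subseteq> C_units"
  unfolding E_units_def C_units_def
  by (rule group.mono_generate[OF merom.units_group]) blast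

lemma C_units_Units: "C_units \<subseteq> Units merom_ring"
  using subgroup.subset[OF subgroup_C_units] by (simp add: units_of_carrier)

lemma exp_sums_carrier: "exp_sums \<subseteq> carrier merom_ring"
proof
  fix f :: "complex^'n \<Rightarrow> complex" assume "f \<in> exp_sums"
  then obtain ws :: "(int \<times> rat \<times> 'n form) list" where f: "f = (\<lambda>z\<in>generic. \<Sum>(m, r, l)\<leftarrow>ws. of_int m * eps r l z)"
    by (auto simp: exp_sums_def)
  have "(\<lambda>z\<in>generic. \<Sum>(m, r, l)\<leftarrow>ws. of_int m * eps r l z) \<in> carrier merom_ring"
  proof (induction ws)
    case (Cons w ws)
    obtain m r l where w: "w = (m, r, l)" by (cases w)
    have "eps r l \<in> carrier merom_ring" by (simp add: eps_in_Units merom.Units_closed)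
    then have "(\<lambda>z\<in>generic. (\<lambda>z\<in>generic. of_int m) z * eps r l z) \<in> carrier merom_ring"
      by (intro merom_combine merom_in_carrier multi_holomorphic_const)
    moreover have "(\<lambda>z\<in>generic. \<Sum>(m, r, l)\<leftarrow>w # ws. of_int m * eps r l z) =
      (\<lambda>z\<in>generic. (\<lambda>z\<in>generic. (\<lambda>z\<in>generic. of_int m) z * eps r l z) z +
         (\<lambda>z\<in>generic. \<Sum>(m, r, l)\<leftarrow>ws. of_int m * eps r l z) z)"
      by (auto simp: w restrict_def fun_eq_iff)
    ultimately show ?case using merom_combine(2)[OF _ Cons] by presburger
  next
    case Nil
    then show ?case using merom_in_carrier[OF multi_holomorphic_const[of 0]] by (simp add: restrict_def)
  qed
  then show "f \<in> carrier merom_ring" using f by simp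
qed

lemma R_generators_carrier: "exp_sums \<union> C_units \<subseteq> carrier merom_ring"
  using exp_sums_carrier C_units_Units merom.Units_closed by blast

lemma ring_R_ring: "ring R_ring"
  unfolding R_ring_def by (rule merom.generate_ring_is_ring[OF R_generators_carrier])

interpretation R: ring "R_ring :: (complex^'n::finite \<Rightarrow> complex) ring"
  by (rule ring_R_ring)

lemma R_ring_ops [simp]:
  "f \<otimes>\<^bsub>R_ring\<^esub> g = f \<otimes>\<^bsub>merom_ring\<^esub> g" "f \<oplus>\<^bsub>R_ring\<^esub> g = f \<oplus>\<^bsub>merom_ring\<^esub> g"
  "\<one>\<^bsub>R_ring\<^esub> = \<one>\<^bsub>merom_ring\<^esub>" "\<zero>\<^bsub>R_ring\<^esub> = \<zero>\<^bsub>merom_ring\<^esub>"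
  by (simp_all add: R_ring_def)

lemma R_ring_carrier: "carrier R_ring = generate_ring merom_ring (exp_sums \<union> C_units)"
  by (simp add: R_ring_def)

lemma R_ring_subset: "carrier R_ring \<subseteq> carrier merom_ring"
  unfolding R_ring_carrier by (rule merom.generate_ring_incl[OF R_generators_carrier])

text \<open>Inverses are available because \<open>C_units\<close> is a group that belongs as a whole
  to the generating set of \<open>R_ring\<close>.\<close>

lemma C_units_R: "C_units \<subseteq> Units R_ring"
proof
  fix x :: "complex^'n \<Rightarrow> complex" assume x: "x \<in> C_units"
  let ?U = "units_of (merom_ring :: (complex^'n \<Rightarrow> complex) ring)"
  have y: "inv\<^bsub>?U\<^esub> x \<in> C_units" by (rule subgroup.m_inv_closed[OF subgroup_C_units x])
  have "x \<otimes>\<^bsub>?U\<^esub> inv\<^bsub>?U\<^esub> x = \<one>\<^bsub>?U\<^esub>" "inv\<^bsub>?U\<^esub> x \<otimes>\<^bsub>?U\<^esub> x = \<one>\<^bsub>?U\<^esub>"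
    using group.r_inv[OF merom.units_group] group.l_inv[OF merom.units_group]
      subgroup.mem_carrier[OF subgroup_C_units x] by blast+
  moreover have "x \<in> carrier R_ring" "inv\<^bsub>?U\<^esub> x \<in> carrier R_ring"
    using x y by (auto simp: R_ring_carrier intro: generate_ring.incl)
  ultimately show "x \<in> Units R_ring"
    unfolding Units_def by (auto simp: units_of_mult units_of_one)
qed

lemma C_units_mult: "x \<in> C_units \<Longrightarrow> y \<in> C_units \<Longrightarrow> x \<otimes>\<^bsub>merom_ring\<^esub> y \<in> C_units"
  using subgroup.m_closed[OF subgroup_C_units, of x y] by (simp add: units_of_mult)

lemma one_E_units: "\<one>\<^bsub>merom_ring\<^esub> \<in> E_units"
  using subgroup.one_closed[OF subgroup_E_units] by (simp add: units_of_one)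

lemma C_units_inverse:
  fixes x :: "complex^'n::finite \<Rightarrow> complex"
  assumes "x \<in> C_units"
  obtains y where "y \<in> C_units" "x \<otimes>\<^bsub>merom_ring\<^esub> y = \<one>\<^bsub>merom_ring\<^esub>"
proof
  let ?U = "units_of (merom_ring :: (complex^'n \<Rightarrow> complex) ring)"
  show "inv\<^bsub>?U\<^esub> x \<in> C_units" by (rule subgroup.m_inv_closed[OF subgroup_C_units assms])
  show "x \<otimes>\<^bsub>merom_ring\<^esub> inv\<^bsub>?U\<^esub> x = \<one>\<^bsub>merom_ring\<^esub>"
    using group.r_inv[OF merom.units_group] subgroup.mem_carrier[OF subgroup_C_units assms]
    by (metis units_of_mult units_of_one)
qed

section \<open>The action of the linear group on functions\<close>

lemma matrix_inv:
  assumes "invertible A"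
  shows "A ** matrix_inv A = mat 1" "matrix_inv A ** A = mat 1"
  using someI_ex[OF assms[unfolded invertible_def]] by (simp_all add: matrix_inv_def)

lemma dual_iff: "l \<in> dual \<longleftrightarrow> (\<forall>x y. l (x + y) = l x + l y) \<and> (\<forall>c x. l (c *s x) = c * l x)"
proof -
  have "vector_space ((*) :: rat \<Rightarrow> rat \<Rightarrow> rat)" by unfold_locales (auto simp: algebra_simps)
  moreover have "vector_space ((*s) :: rat \<Rightarrow> rat^'a \<Rightarrow> rat^'a)" by unfold_locales
  ultimately show ?thesis by (auto simp: dual_def Vector_Spaces.linear_iff)
qed

lemma dual_add: "l \<in> dual \<Longrightarrow> l (x + y) = l x + l y"
  and dual_scale: "l \<in> dual \<Longrightarrow> l (c *s x) = c * l x"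
  by (simp_all add: dual_iff)

lemma dual_0: "l \<in> dual \<Longrightarrow> l 0 = 0"
  using dual_scale[of l 0 0] by simp

lemma dual_sum: "l \<in> dual \<Longrightarrow> l (\<Sum>i\<in>A. f i) = (\<Sum>i\<in>A. l (f i))"
  by (induction A rule: infinite_finite_induct) (auto simp: dual_0 dual_add)

lemma dual_expand: "l \<in> dual \<Longrightarrow> l x = (\<Sum>i\<in>UNIV. x $ i * l (axis i 1))"
  by (subst basis_expansion[symmetric]) (simp add: dual_sum dual_scale)

lemma coord_dual: "(\<lambda>x. x $ i) \<in> dual"
  by (simp add: dual_iff)

lemma dual_smult: "l \<in> dual \<Longrightarrow> (\<lambda>x. c * l x) \<in> dual"
  by (simp add: dual_iff algebra_simps)

lemma dual_plus: "l \<in> dual \<Longrightarrow> m \<in> dual \<Longrightarrow> (\<lambda>x. l x + m x) \<in> dual"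
  by (simp add: dual_iff algebra_simps)

lemma dual_zero: "(\<lambda>x. 0) \<in> dual"
  by (simp add: dual_iff)

lemma form_act_dual: "l \<in> dual \<Longrightarrow> form_act \<gamma> l \<in> dual"
  by (simp add: dual_iff form_act_def vector_matrix_left_distrib scalar_vector_matrix_assoc)

lemma form_act_mult: "form_act A (form_act B l) = form_act (A ** B) l"
  by (simp add: form_act_def vector_matrix_mul_assoc)

lemma form_act_mat_1 [simp]: "form_act (mat 1) l = l"
  by (simp add: form_act_def)

lemma form_act_inverse:
  assumes "invertible \<gamma>"
  shows "form_act (matrix_inv \<gamma>) (form_act \<gamma> l) = l" "form_act \<gamma> (form_act (matrix_inv \<gamma>) l) = l"
  by (simp_all add: form_act_mult matrix_inv[OF assms])

lemma form_act_eq_0_iff: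
  assumes "invertible \<gamma>"
  shows "form_act \<gamma> l = (\<lambda>x. 0) \<longleftrightarrow> l = (\<lambda>x. 0)"
proof
  assume "form_act \<gamma> l = (\<lambda>x. 0)"
  then have "form_act (matrix_inv \<gamma>) (form_act \<gamma> l) = (\<lambda>x. 0)" by (simp add: form_act_def)
  then show "l = (\<lambda>x. 0)" by (simp add: form_act_inverse[OF assms])
qed (simp add: form_act_def)

lemma invertible_matrix_inv: "invertible \<gamma> \<Longrightarrow> invertible (matrix_inv \<gamma>)"
  using matrix_inv unfolding invertible_def by blast

text \<open>This duality turns a substitution in z into an action on forms. It is the source of
  \<open>merom_act_eps\<close>, by which \<gamma> replaces the form l by \<gamma>^-1 l.\<close>

lemma form_ext_vector_matrix:
  assumes "l \<in> dual"
  shows "form_ext l (z v* map_matrix of_rat g) = form_ext (form_act g l) z"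
proof -
  have "form_ext (form_act g l) z = (\<Sum>i\<in>UNIV. of_rat (\<Sum>j\<in>UNIV. g $ i $ j * l (axis j 1)) * z $ i)"
  proof -
    have "(axis i 1 v* g) = g $ i" for i
      by (simp add: vec_eq_iff vector_matrix_mult_def axis_def if_distrib if_distribR cong: if_cong)
    then have "form_act g l (axis i 1) = (\<Sum>j\<in>UNIV. g $ i $ j * l (axis j 1))" for i
      unfolding form_act_def by (simp only: dual_expand[OF assms, of "g $ i"])
    then show ?thesis by (simp only: form_ext_def)
  qed
  also have "\<dots> = (\<Sum>i\<in>UNIV. \<Sum>j\<in>UNIV. of_rat (l (axis j 1)) * (z $ i * of_rat (g $ i $ j)))"
    by (simp add: of_rat_sum of_rat_mult sum_distrib_left mult_ac)
  also have "\<dots> = (\<Sum>j\<in>UNIV. \<Sum>i\<in>UNIV. of_rat (l (axis j 1)) * (z $ i * of_rat (g $ i $ j)))"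
    by (rule sum.swap)
  also have "\<dots> = form_ext l (z v* map_matrix of_rat g)"
    by (simp add: form_ext_def vector_matrix_mult_def sum_distrib_left)
  finally show ?thesis by simp
qed

text \<open>An invertible matrix permutes the non-zero forms and thereby the excluded
  hyperplanes.\<close>

lemma generic_vector_matrix:
  fixes g :: "rat^'n^'n"
  assumes "invertible g" "z \<in> generic"
  shows "z v* map_matrix of_rat g \<in> generic"
proof -
  have "form_ext (form_act g l) z \<noteq> of_rat r" if "l \<in> dual" "l \<noteq> (\<lambda>x. 0)" for l r
    using assms that form_act_dual[of l g] form_act_eq_0_iff[of g l] by (auto simp: generic_def)
  then show ?thesis
    unfolding generic_def using form_ext_vector_matrix[of _ z g] by force
qed

lemma bounded_linear_vector_matrix: "bounded_linear (\<lambda>z :: complex^'n. z v* (G :: complex^'n^'n))"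
proof -
  have "linear (\<lambda>z. z v* G)"
    by (rule linearI) (auto simp: vector_matrix_left_distrib vector_matrix_mult_def vec_eq_iff scaleR_sum_right
      sum.distrib distrib_right)
  then show ?thesis by (simp add: linear_conv_bounded_linear)
qed

lemma multi_holomorphic_vector_matrix:
  fixes G :: "complex^'n^'n"
  assumes "multi_holomorphic_on f W"
  shows "multi_holomorphic_on (\<lambda>z. f (z v* G)) ((\<lambda>z. z v* G) -` W)"
  unfolding multi_holomorphic_on_def
proof
  fix z assume "z \<in> (\<lambda>z. z v* G) -` W"
  then obtain D where D: "(f has_derivative D) (at (z v* G))" "\<And>c v. D (c *s v) = c * D v"
    using assms unfolding multi_holomorphic_on_def by (meson vimageD)
  have "((\<lambda>z. f (z v* G)) has_derivative (\<lambda>v. D (v v* G))) (at z)"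
    using has_derivative_compose[of "\<lambda>z. z v* G" "\<lambda>z. z v* G" z UNIV f D] D(1)
      bounded_linear_imp_has_derivative[OF bounded_linear_vector_matrix] by blast
  then show "\<exists>D. ((\<lambda>z. f (z v* G)) has_derivative D) (at z) \<and> (\<forall>c v. D (c *s v) = c * D v)"
    by (intro exI conjI) (auto simp: D(2) scalar_vector_matrix_assoc)
qed

lemma merom_act_carrier:
  assumes "invertible \<gamma>" "f \<in> carrier merom_ring"
  shows "merom_act \<gamma> f \<in> carrier merom_ring"
  unfolding merom_carrier_iff
proof (intro conjI allI)
  fix p
  let ?t = "\<lambda>z. z v* map_matrix of_rat (matrix_inv \<gamma>)"
  obtain W g h where w: "open W" "?t p \<in> W" "multi_holomorphic_on g W" "multi_holomorphic_on h W"
       "\<forall>z\<in>W \<inter> generic. h z \<noteq> 0 \<and> f z = g z / h z"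
    using assms(2) unfolding merom_carrier_iff by meson
  have "open (?t -` W)"
    using w(1) by (intro open_vimage linear_continuous_on bounded_linear_vector_matrix) auto
  then show "\<exists>W g h. open W \<and> p \<in> W \<and>
       multi_holomorphic_on g W \<and> multi_holomorphic_on h W \<and>
       (\<forall>z\<in>W \<inter> generic. h z \<noteq> 0 \<and> merom_act \<gamma> f z = g z / h z)"
    using w generic_vector_matrix[OF invertible_matrix_inv[OF assms(1)]]
    by (intro exI[of _ "?t -` W"] exI[of _ "\<lambda>z. g (?t z)"] exI[of _ "\<lambda>z. h (?t z)"])
      (auto intro: multi_holomorphic_vector_matrix simp: merom_act_def)
qed (simp add: merom_act_def)

lemma merom_act_hom:
  assumes "invertible \<gamma>"
  shows "merom_act \<gamma> \<in> ring_hom merom_ring merom_ring"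
  using generic_vector_matrix[OF invertible_matrix_inv[OF assms]]
  by (intro ring_hom_memI merom_act_carrier[OF assms])
    (auto simp: merom_ops merom_act_def cong: restrict_cong)

lemma merom_act_eps:
  assumes "invertible \<gamma>" "l \<in> dual"
  shows "merom_act \<gamma> (eps r l) = eps r (form_act (matrix_inv \<gamma>) l)"
  using generic_vector_matrix[OF invertible_matrix_inv[OF assms(1)]]
  by (auto simp: merom_act_def eps_def form_ext_vector_matrix[OF assms(2)] cong: restrict_cong)

lemma merom_act_one_minus_eps:
  assumes "invertible \<gamma>" "l \<in> dual"
  shows "merom_act \<gamma> (one_minus_eps r l) = one_minus_eps r (form_act (matrix_inv \<gamma>) l)"
  using generic_vector_matrix[OF invertible_matrix_inv[OF assms(1)]]
  by (auto simp: merom_act_def one_minus_eps_eq form_ext_vector_matrix[OF assms(2)] cong: restrict_cong)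

lemma group_hom_merom_act:
  assumes "invertible \<gamma>"
  shows "group_hom (units_of merom_ring) (units_of merom_ring) (merom_act \<gamma>)"
proof -
  have "merom_act \<gamma> \<in> hom (units_of merom_ring) (units_of merom_ring)"
    using ring_hom_Units[OF merom.ring_axioms merom.ring_axioms merom_act_hom[OF assms]]
      ring_hom_mult[OF merom_act_hom[OF assms]] merom.Units_closed
    by (auto simp: hom_def units_of_carrier units_of_mult)
  then show ?thesis
    by (simp add: group_hom_def group_hom_axioms_def merom.units_group)
qed

lemma merom_act_generate:
  assumes "invertible \<gamma>" "S \<subseteq> carrier (units_of merom_ring)" "merom_act \<gamma> ` S \<subseteq> S"
    "x \<in> generate (units_of merom_ring) S"
  shows "merom_act \<gamma> x \<in> generate (units_of merom_ring) S"
proof -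
  interpret group_hom "units_of merom_ring" "units_of merom_ring" "merom_act \<gamma>"
    by (rule group_hom_merom_act[OF assms(1)])
  show ?thesis using generate_img[OF assms(2)] mono_generate[OF assms(3)] assms(4) by blast
qed

lemma merom_act_E_units:
  assumes \<gamma>: "invertible \<gamma>" and x: "x \<in> E_units"
  shows "merom_act \<gamma> x \<in> E_units"
  using x unfolding E_units_def
proof (rule merom_act_generate[OF \<gamma>, rotated 2])
  show "merom_act \<gamma> ` {eps r l | r l. l \<in> dual \<and> l \<noteq> (\<lambda>x. 0)} \<subseteq> {eps r l | r l. l \<in> dual \<and> l \<noteq> (\<lambda>x. 0)}"
    using \<gamma> form_act_eq_0_iff[OF invertible_matrix_inv[OF \<gamma>]]
    by (auto simp: merom_act_eps) (metis form_act_dual)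
qed (use C_generators_Units in blast)

lemma merom_act_C_units:
  assumes \<gamma>: "invertible \<gamma>" and x: "x \<in> C_units"
  shows "merom_act \<gamma> x \<in> C_units"
  using x unfolding C_units_def
proof (rule merom_act_generate[OF \<gamma> C_generators_Units, rotated])
  let ?S = "{eps r l | r l. l \<in> dual \<and> l \<noteq> (\<lambda>x. 0)} \<union> {one_minus_eps r l | r l. l \<in> dual \<and> l \<noteq> (\<lambda>x. 0)}"
  show "merom_act \<gamma> ` ?S \<subseteq> ?S"
    using \<gamma> form_act_eq_0_iff[OF invertible_matrix_inv[OF \<gamma>]]
    by (auto simp: merom_act_eps merom_act_one_minus_eps) (metis form_act_dual)+
qed

lemma merom_act_exp_sums:
  assumes "invertible \<gamma>" "f \<in> exp_sums"
  shows "merom_act \<gamma> f \<in> exp_sums"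
proof -
  obtain ws where f: "f = (\<lambda>z\<in>generic. \<Sum>(m, r, l)\<leftarrow>ws. of_int m * eps r l z)"
    and ws: "\<forall>(m, r, l)\<in>set ws. l \<in> dual"
    using assms(2) by (auto simp: exp_sums_def)
  let ?ws = "map (\<lambda>(m, r, l). (m, r, form_act (matrix_inv \<gamma>) l)) ws"
  let ?t = "\<lambda>z. z v* map_matrix of_rat (matrix_inv \<gamma>)"
  have "(\<Sum>(m, r, l)\<leftarrow>ws. of_int m * eps r l (?t z)) = (\<Sum>(m, r, l)\<leftarrow>?ws. of_int m * eps r l z)" if z: "z \<in> generic" for z
  proof -
    have "eps r l (?t z) = eps r (form_act (matrix_inv \<gamma>) l) z" if "l \<in> dual" for r l
      using merom_act_eps[OF assms(1) that, of r] z by (auto simp: merom_act_def fun_eq_iff split: if_splits)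
    with ws show ?thesis by (induction ws) auto
  qed
  then have "merom_act \<gamma> f = (\<lambda>z\<in>generic. \<Sum>(m, r, l)\<leftarrow>?ws. of_int m * eps r l z)"
    using generic_vector_matrix[OF invertible_matrix_inv[OF assms(1)]]
    by (auto simp: merom_act_def f cong: restrict_cong)
  moreover have "\<forall>(m, r, l)\<in>set ?ws. l \<in> dual" using ws by (auto simp: form_act_dual)
  ultimately show ?thesis unfolding exp_sums_def by blast
qed

text \<open>Stability is checked on the two generating sets, exponential sums and C(V), and spreads
  through the ring operations since \<open>merom_act \<gamma>\<close> is already a ring endomorphism
  of \<open>merom_ring\<close>.\<close>

lemma merom_act_R_hom:
  fixes \<gamma> :: "rat^'n^'n"
  assumes "invertible \<gamma>"
  shows "merom_act \<gamma> \<in> ring_hom R_ring R_ring"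
proof (rule ring_hom_memI)
  note h = merom_act_hom[OF assms]
  fix x y :: "complex^'n \<Rightarrow> complex" assume x: "x \<in> carrier R_ring"
  then show "merom_act \<gamma> x \<in> carrier R_ring"
    unfolding R_ring_carrier
  proof (induction rule: generate_ring.induct)
    case one
    then show ?case using ring_hom_one[OF h] by (simp add: generate_ring.one)
  next
    case (incl h)
    then show ?case using merom_act_exp_sums[OF assms] merom_act_C_units[OF assms]
      by (auto intro: generate_ring.incl)
  next
    case (a_inv x)
    interpret h: ring_hom_ring merom_ring merom_ring "merom_act \<gamma>"
      by (rule ring_hom_ringI2[OF merom.ring_axioms merom.ring_axioms h])
    have "x \<in> carrier merom_ring" using a_inv merom.generate_ring_in_carrier[OF R_generators_carrier] by blast
    then show ?case using a_inv by (simp add: generate_ring.a_inv)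
  next
    case (eng_add x y)
    then have "x \<in> carrier merom_ring" "y \<in> carrier merom_ring"
      using merom.generate_ring_in_carrier[OF R_generators_carrier] by blast+
    then show ?case using eng_add by (simp add: ring_hom_add[OF h] generate_ring.eng_add)
  next
    case (eng_mult x y)
    then have "x \<in> carrier merom_ring" "y \<in> carrier merom_ring"
      using merom.generate_ring_in_carrier[OF R_generators_carrier] by blast+
    then show ?case using eng_mult by (simp add: ring_hom_mult[OF h] generate_ring.eng_mult)
  qed
  assume "y \<in> carrier R_ring"
  with x have "x \<in> carrier merom_ring" "y \<in> carrier merom_ring" using R_ring_subset by blast+
  then show "merom_act \<gamma> (x \<otimes>\<^bsub>R_ring\<^esub> y) = merom_act \<gamma> x \<otimes>\<^bsub>R_ring\<^esub> merom_act \<gamma> y"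
    "merom_act \<gamma> (x \<oplus>\<^bsub>R_ring\<^esub> y) = merom_act \<gamma> x \<oplus>\<^bsub>R_ring\<^esub> merom_act \<gamma> y"
    by (simp_all add: ring_hom_mult[OF h] ring_hom_add[OF h])
qed (simp add: ring_hom_one[OF merom_act_hom[OF assms]])

lemma merom_act_minus_one:
  assumes "invertible \<gamma>"
  shows "merom_act \<gamma> (\<ominus>\<^bsub>R_ring\<^esub> \<one>\<^bsub>R_ring\<^esub>) = \<ominus>\<^bsub>R_ring\<^esub> \<one>\<^bsub>R_ring\<^esub>"
proof -
  interpret h: ring_hom_ring R_ring R_ring "merom_act \<gamma>"
    by (rule ring_hom_ringI2[OF R.ring_axioms R.ring_axioms merom_act_R_hom[OF assms]])
  show ?thesis by (simp only: h.hom_a_inv[OF R.one_closed] h.hom_one)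
qed

section \<open>Multiplicativity of the exponentials\<close>

lemma form_ext_plus: "form_ext (\<lambda>x. l x + m x) z = form_ext l z + form_ext m z"
  by (simp add: form_ext_def of_rat_add algebra_simps sum.distrib)

lemma form_ext_smult: "form_ext (\<lambda>x. c * l x) z = of_rat c * form_ext l z"
  by (simp add: form_ext_def of_rat_mult sum_distrib_left mult_ac)

lemma form_ext_coord: "form_ext (\<lambda>x. x $ i) z = z $ i"
  by (simp add: form_ext_def axis_def if_distrib if_distribR cong: if_cong)

lemma eps_mult: "eps r l \<otimes>\<^bsub>merom_ring\<^esub> eps s m = eps (r + s) (\<lambda>x. l x + m x)"
  unfolding merom_ops eps_def
  by (rule restrict_ext) (simp add: form_ext_plus of_rat_add mult_exp_exp algebra_simps)

text \<open>The generators of E(V) have non-zero forms, but a constant \<epsilon> is the product of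
  two of them with opposite forms. All roots of unity therefore lie in E(V), in particular
  -1.\<close>

lemma eps_E_units:
  assumes "l \<in> dual"
  shows "eps r l \<in> E_units"
proof (cases "l = (\<lambda>x. 0)")
  case False
  then show ?thesis using assms unfolding E_units_def by (blast intro: generate.incl)
next
  case True
  fix i
  let ?c = "\<lambda>x :: rat^'a. x $ i" and ?m = "\<lambda>x :: rat^'a. (-1) * x $ i"
  have "?c (axis i 1) \<noteq> 0" "?m (axis i 1) \<noteq> 0" by (simp_all)
  then have "?c \<noteq> (\<lambda>x. 0)" "?m \<noteq> (\<lambda>x. 0)" by metis+
  then have "eps r ?c \<in> E_units" "eps 0 ?m \<in> E_units"
    unfolding E_units_def using coord_dual[of i] dual_smult[OF coord_dual, of "-1" i]
    by (blast intro: generate.incl)+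
  then have "eps r ?c \<otimes>\<^bsub>units_of merom_ring\<^esub> eps 0 ?m \<in> E_units"
    by (rule subgroup.m_closed[OF subgroup_E_units])
  then show ?thesis using eps_mult[of r ?c 0 ?m] True by (simp add: units_of_mult)
qed

lemma one_minus_eps_C_units:
  assumes "l \<in> dual" "l \<noteq> (\<lambda>x. 0)"
  shows "one_minus_eps r l \<in> C_units"
  using assms unfolding C_units_def by (blast intro: generate.incl)

section \<open>The graded ring and its ideal\<close>

lemma hom_finprod:
  assumes "comm_group G" "comm_group H" "h \<in> hom G H" "f \<in> A \<rightarrow> carrier G"
  shows "h (finprod G f A) = finprod H (\<lambda>x. h (f x)) A"
proof -
  interpret G: comm_group G by fact
  interpret H: comm_group H by fact
  interpret group_hom G H h using assms(3) by unfold_locales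
  show ?thesis using assms(4)
  proof (induction A rule: infinite_finite_induct)
    case (insert x A)
    then have "(\<lambda>x. h (f x)) \<in> A \<rightarrow> carrier H" "h (f x) \<in> carrier H"
      using hom_closed by (blast intro: funcsetI)+
    with insert show ?case by (auto simp: G.finprod_insert H.finprod_insert G.finprod_closed)
  qed auto
qed

lemma (in ring) K_mult_closed:
  assumes "X \<in> carrier (milnor_K R p)" "Y \<in> carrier (milnor_K R q)"
  shows "K_mult R p q X Y \<in> carrier (milnor_K R (p + q))"
  using assms by (auto simp: carrier_milnor_K K_mult_class chain_concat_closed)

lemma (in ring) group_milnor_K: "group (milnor_K R m)"
  using comm_group_milnor_K by (rule comm_group.axioms)

lemma (in ring) carrier_milnor_ring:
  "carrier (milnor_ring R) = {f. (\<forall>m. f m \<in> carrier (milnor_K R m)) \<and> finite {m. f m \<noteq> \<one>\<^bsub>milnor_K R m\<^esub>}}"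
  by (auto simp: milnor_ring_def carrier_sum_group[OF group_milnor_K])

lemma (in ring) K_incl_closed: "X \<in> carrier (milnor_K R m) \<Longrightarrow> K_incl R m X \<in> carrier (milnor_ring R)"
  using group.is_monoid[OF group_milnor_K]
  by (auto simp: carrier_milnor_ring K_incl_def monoid.one_closed intro: finite_subset[of _ "{m}"])

lemma milnor_ring_ops:
  "f \<oplus>\<^bsub>milnor_ring R\<^esub> g = (\<lambda>m. f m \<otimes>\<^bsub>milnor_K R m\<^esub> g m)"
  "\<zero>\<^bsub>milnor_ring R\<^esub> = (\<lambda>m. \<one>\<^bsub>milnor_K R m\<^esub>)"
  "\<one>\<^bsub>milnor_ring R\<^esub> = K_incl R 0 (K_symbol R [])"
  "f \<otimes>\<^bsub>milnor_ring R\<^esub> g = (\<lambda>m. \<Otimes>\<^bsub>milnor_K R m\<^esub>p\<in>{..m}. K_mult R p (m - p) (f p) (g (m - p)))"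
  by (simp_all add: milnor_ring_def fun_eq_iff)

definition milnor_ring_map :: "('a, 'c) ring_scheme \<Rightarrow> ('a, 'c) ring_scheme \<Rightarrow> ('a \<Rightarrow> 'a) \<Rightarrow>
    (nat \<Rightarrow> ('a list \<Rightarrow>\<^sub>0 int) set set) \<Rightarrow> nat \<Rightarrow> ('a list \<Rightarrow>\<^sub>0 int) set set" where
  "milnor_ring_map R S h f = (\<lambda>m. K_map R S h m (f m))"

context
  fixes R S :: "('a, 'c) ring_scheme" and h
  assumes R: "ring R" and S: "ring S" and h: "h \<in> ring_hom R S"
begin

lemma K_map_one: "K_map R S h m \<one>\<^bsub>milnor_K R m\<^esub> = \<one>\<^bsub>milnor_K S m\<^esub>"
  by (rule hom_one[OF K_map_hom[OF R S h] ring.group_milnor_K[OF R] ring.group_milnor_K[OF S]])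

lemma K_map_closed: "X \<in> carrier (milnor_K R m) \<Longrightarrow> K_map R S h m X \<in> carrier (milnor_K S m)"
  by (rule hom_in_carrier[OF K_map_hom[OF R S h]])

lemma K_map_symbol:
  "xs \<in> tensor_words (units_of R) (length xs) \<Longrightarrow> K_map R S h (length xs) (K_symbol R xs) = K_symbol S (map h xs)"
  unfolding K_symbol_def by (simp add: K_map_class[OF R S h])

lemma milnor_ring_map_incl:
  "milnor_ring_map R S h (K_incl R m X) = K_incl S m (K_map R S h m X)"
  by (auto simp: milnor_ring_map_def K_incl_def K_map_one fun_eq_iff)

lemma K_map_mult:
  assumes "X \<in> carrier (milnor_K R p)" "Y \<in> carrier (milnor_K R q)"
  shows "K_map R S h (p + q) (K_mult R p q X Y) = K_mult S p q (K_map R S h p X) (K_map R S h q Y)"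
  using assms
  by (auto simp: ring.carrier_milnor_K[OF R] ring.K_mult_class[OF R] ring.K_mult_class[OF S]
    K_map_class[OF R S h] chain_concat_closed chain_map_closed[OF R S h] chain_map_concat)

text \<open>Ideals can be pulled back along this map; in this way \<open>J_ideal_act\<close> shows
  the ideal to be stable under the linear group.\<close>

lemma milnor_ring_map_hom: "milnor_ring_map R S h \<in> ring_hom (milnor_ring R) (milnor_ring S)"
proof (rule ring_hom_memI)
  fix x assume x: "x \<in> carrier (milnor_ring R)"
  have "finite {m. K_map R S h m (x m) \<noteq> \<one>\<^bsub>milnor_K S m\<^esub>}"
    using x K_map_one by (auto simp: ring.carrier_milnor_ring[OF R] elim!: rev_finite_subset)
  with x show "milnor_ring_map R S h x \<in> carrier (milnor_ring S)"
    by (auto simp: ring.carrier_milnor_ring[OF R] ring.carrier_milnor_ring[OF S] milnor_ring_map_def K_map_closed)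
  fix y assume y: "y \<in> carrier (milnor_ring R)"
  show "milnor_ring_map R S h (x \<oplus>\<^bsub>milnor_ring R\<^esub> y) = milnor_ring_map R S h x \<oplus>\<^bsub>milnor_ring S\<^esub> milnor_ring_map R S h y"
    using x y by (auto simp: milnor_ring_ops milnor_ring_map_def ring.carrier_milnor_ring[OF R]
        hom_mult[OF K_map_hom[OF R S h]])
  show "milnor_ring_map R S h (x \<otimes>\<^bsub>milnor_ring R\<^esub> y) = milnor_ring_map R S h x \<otimes>\<^bsub>milnor_ring S\<^esub> milnor_ring_map R S h y"
  proof
    fix m
    have c: "K_mult R p (m - p) (x p) (y (m - p)) \<in> carrier (milnor_K R m)"
      and e: "K_map R S h m (K_mult R p (m - p) (x p) (y (m - p)))
        = K_mult S p (m - p) (K_map R S h p (x p)) (K_map R S h (m - p) (y (m - p)))" if "p \<in> {..m}" for p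
      using that x y ring.K_mult_closed[OF R, of "x p" p "y (m - p)" "m - p"]
        K_map_mult[of "x p" p "y (m - p)" "m - p"]
      by (auto simp: ring.carrier_milnor_ring[OF R])
    have c': "K_mult S p (m - p) (K_map R S h p (x p)) (K_map R S h (m - p) (y (m - p))) \<in> carrier (milnor_K S m)"
      if "p \<in> {..m}" for p
      using K_map_closed[OF c[OF that]] e[OF that] by simp
    have "milnor_ring_map R S h (x \<otimes>\<^bsub>milnor_ring R\<^esub> y) m =
      K_map R S h m (\<Otimes>\<^bsub>milnor_K R m\<^esub>p\<in>{..m}. K_mult R p (m - p) (x p) (y (m - p)))"
      by (simp add: milnor_ring_map_def milnor_ring_ops)
    \<comment> \<open>A graded component of a product is a finite product in the group K_m, and the
      homomorphism \<open>K_map\<close> passes through it.\<close>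
    also have "\<dots> = (\<Otimes>\<^bsub>milnor_K S m\<^esub>p\<in>{..m}. K_map R S h m (K_mult R p (m - p) (x p) (y (m - p))))"
      using c by (intro hom_finprod ring.comm_group_milnor_K R S K_map_hom[OF R S h]) auto
    also have "\<dots> = (\<Otimes>\<^bsub>milnor_K S m\<^esub>p\<in>{..m}. K_mult S p (m - p) (K_map R S h p (x p)) (K_map R S h (m - p) (y (m - p))))"
    proof -
      interpret comm_group "milnor_K S m" by (rule ring.comm_group_milnor_K[OF S])
      show ?thesis using e c' by (intro finprod_cong') auto
    qed
    finally show "milnor_ring_map R S h (x \<otimes>\<^bsub>milnor_ring R\<^esub> y) m =
        (milnor_ring_map R S h x \<otimes>\<^bsub>milnor_ring S\<^esub> milnor_ring_map R S h y) m"
      by (simp add: milnor_ring_map_def milnor_ring_ops)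
  qed
next
  show "milnor_ring_map R S h \<one>\<^bsub>milnor_ring R\<^esub> = \<one>\<^bsub>milnor_ring S\<^esub>"
    using K_map_symbol[of "[]"] by (simp add: milnor_ring_ops milnor_ring_map_incl tensor_words_def)
qed

end

lemma K_symbol_closed:
  assumes "ring R" "set xs \<subseteq> Units R"
  shows "K_symbol R xs \<in> carrier (milnor_K R (length xs))"
  unfolding K_symbol_def using assms
  by (intro ring.K_class_closed) (auto simp: tensor_words_def units_of_carrier)

section \<open>The ideal and its graded parts\<close>

definition J_generators :: "(nat \<Rightarrow> ('n::finite) Kelem) set" where
  "J_generators = insert (K_incl R_ring 1 (K_symbol R_ring [\<ominus>\<^bsub>R_ring\<^esub> \<one>\<^bsub>R_ring\<^esub>]))
        {K_incl R_ring (length xs) (K_symbol R_ring xs) | xs.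
           set xs \<subseteq> C_units \<and> set xs \<inter> E_units \<noteq> {}}"

lemma J_generators_closed: "J_generators \<subseteq> carrier (milnor_ring R_ring)"
proof -
  have "\<ominus>\<^bsub>R_ring\<^esub> \<one>\<^bsub>R_ring\<^esub> \<in> Units (R_ring :: (complex^'n \<Rightarrow> complex) ring)"
    using R.Units_minus_one_closed by blast
  then have "K_incl R_ring 1 (K_symbol R_ring [\<ominus>\<^bsub>R_ring\<^esub> \<one>\<^bsub>R_ring\<^esub> :: complex^'n \<Rightarrow> complex]) \<in> carrier (milnor_ring R_ring)"
    using K_symbol_closed[OF ring_R_ring, of "[\<ominus>\<^bsub>R_ring\<^esub> \<one>\<^bsub>R_ring\<^esub> :: complex^'n \<Rightarrow> complex]"]
    by (intro R.K_incl_closed) simp_all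
  moreover have "K_incl R_ring (length xs) (K_symbol R_ring xs) \<in> carrier (milnor_ring R_ring)"
    if "set xs \<subseteq> C_units" for xs :: "(complex^'n \<Rightarrow> complex) list"
    using that C_units_R by (intro R.K_incl_closed K_symbol_closed ring_R_ring) blast
  ultimately show ?thesis unfolding J_generators_def by blast
qed

lemma J_ideal_eq: "J_ideal = Idl\<^bsub>milnor_ring R_ring\<^esub> J_generators"
  by (simp add: J_ideal_def J_generators_def)

text \<open>The ring axioms for the graded K-group need not be verified: without them it would have no ideals,
  and the generated ideal would be the intersection of the empty family.\<close>

lemma J_ideal_not_ring: "\<not> ring (milnor_ring (R_ring :: (complex^'n \<Rightarrow> complex) ring)) \<Longrightarrow> (J_ideal :: (nat \<Rightarrow> ('n::finite) Kelem) set) = UNIV"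
  unfolding J_ideal_eq genideal_def using ideal.axioms(2) by blast

lemma J_generators_act:
  assumes "invertible \<gamma>" "x \<in> J_generators"
  shows "milnor_ring_map R_ring R_ring (merom_act \<gamma>) x \<in> J_generators"
proof -
  note h = merom_act_R_hom[OF assms(1)]
  note rr = ring_R_ring ring_R_ring h
  from assms(2) consider "x = K_incl R_ring 1 (K_symbol R_ring [\<ominus>\<^bsub>R_ring\<^esub> \<one>\<^bsub>R_ring\<^esub>])"
    | xs where "x = K_incl R_ring (length xs) (K_symbol R_ring xs)" "set xs \<subseteq> C_units" "set xs \<inter> E_units \<noteq> {}"
    unfolding J_generators_def by blast
  then show ?thesis
  proof cases
    case 1
    have "K_map R_ring R_ring (merom_act \<gamma>) (length [\<ominus>\<^bsub>R_ring\<^esub> \<one>\<^bsub>R_ring\<^esub> :: complex^'a \<Rightarrow> complex])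
      (K_symbol R_ring [\<ominus>\<^bsub>R_ring\<^esub> \<one>\<^bsub>R_ring\<^esub>]) = K_symbol R_ring [\<ominus>\<^bsub>R_ring\<^esub> \<one>\<^bsub>R_ring\<^esub>]"
      by (subst K_map_symbol[OF rr])
        (simp_all only: list.map merom_act_minus_one[OF assms(1)],
         simp add: tensor_words_def units_of_carrier R.Units_minus_one_closed del: R_ring_ops)
    then show ?thesis unfolding 1 milnor_ring_map_incl[OF rr] by (simp add: J_generators_def del: R_ring_ops)
  next
    case 2
    have "xs \<in> tensor_words (units_of R_ring) (length xs)"
      using 2 C_units_R by (auto simp: tensor_words_def units_of_carrier)
    then have "milnor_ring_map R_ring R_ring (merom_act \<gamma>) x =
      K_incl R_ring (length (map (merom_act \<gamma>) xs)) (K_symbol R_ring (map (merom_act \<gamma>) xs))"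
      by (simp add: 2(1) milnor_ring_map_incl[OF rr] K_map_symbol[OF rr])
    moreover have "set (map (merom_act \<gamma>) xs) \<subseteq> C_units" "set (map (merom_act \<gamma>) xs) \<inter> E_units \<noteq> {}"
      using 2 merom_act_C_units[OF assms(1)] merom_act_E_units[OF assms(1)] by auto
    ultimately show ?thesis unfolding J_generators_def by blast
  qed
qed

text \<open>The preimage of the ideal under the ring endomorphism is an ideal containing the
  generators, hence contains the ideal that they generate. Were the ring axioms to fail, the ideal
  would be everything by \<open>J_ideal_not_ring\<close>.\<close>

lemma J_ideal_act:
  fixes x :: "nat \<Rightarrow> ('n::finite) Kelem"
  assumes "invertible \<gamma>" "x \<in> J_ideal"
  shows "milnor_ring_map R_ring R_ring (merom_act \<gamma>) x \<in> J_ideal"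
proof (cases "ring (milnor_ring (R_ring :: (complex^'n \<Rightarrow> complex) ring))")
  case True
  let ?M = "milnor_ring (R_ring :: (complex^'n \<Rightarrow> complex) ring)"
  let ?\<Phi> = "milnor_ring_map R_ring R_ring (merom_act \<gamma>)"
  interpret M: ring ?M by (rule True)
  interpret \<Phi>: ring_hom_ring ?M ?M ?\<Phi>
    by (rule ring_hom_ringI2[OF True True milnor_ring_map_hom[OF ring_R_ring ring_R_ring merom_act_R_hom[OF assms(1)]]])
  have id: "ideal J_ideal ?M"
    unfolding J_ideal_eq by (rule M.genideal_ideal[OF J_generators_closed])
  have "J_generators \<subseteq> {r \<in> carrier ?M. ?\<Phi> r \<in> J_ideal}"
    using J_generators_closed J_generators_act[OF assms(1)] M.genideal_self[OF J_generators_closed]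
    unfolding J_ideal_eq by blast
  then have "J_ideal \<subseteq> {r \<in> carrier ?M. ?\<Phi> r \<in> J_ideal}"
    using M.genideal_minimal[OF \<Phi>.ideal_vimage[OF id]] by (simp add: J_ideal_eq)
  then show ?thesis using assms(2) by blast
qed (simp add: J_ideal_not_ring)

lemma K_act_eq:
  assumes "invertible \<gamma>"
  shows "K_act m \<gamma> = K_map R_ring R_ring (merom_act \<gamma>) m"
  unfolding K_act_def K_map_def[OF ring_R_ring ring_R_ring merom_act_R_hom[OF assms]] K_chains_def chain_map_def ..

lemma J_part_act:
  assumes "invertible \<gamma>" "X \<in> J_part m"
  shows "K_act m \<gamma> X \<in> J_part m"
proof -
  note rr = ring_R_ring ring_R_ring merom_act_R_hom[OF assms(1)]
  show ?thesis
    using assms J_ideal_act[OF assms(1), of "K_incl R_ring m X"]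
    by (simp add: J_part_def K_act_eq[OF assms(1)] milnor_ring_map_incl[OF rr] K_map_closed[OF rr])
qed

lemma K_incl_one: "K_incl R m \<one>\<^bsub>milnor_K R m\<^esub> = \<zero>\<^bsub>milnor_ring R\<^esub>"
  by (auto simp: K_incl_def milnor_ring_ops fun_eq_iff)

lemma (in ring) K_incl_mult: "K_incl R m (X \<otimes>\<^bsub>milnor_K R m\<^esub> Y) = K_incl R m X \<oplus>\<^bsub>milnor_ring R\<^esub> K_incl R m Y"
  using group.is_monoid[OF group_milnor_K] by (auto simp: K_incl_def milnor_ring_ops fun_eq_iff monoid.l_one monoid.one_closed)

text \<open>\<open>K_incl\<close> carries the group law of K_m to addition in the graded ring, so
  the degree m part of an ideal inherits closure under products and inverses.\<close>

lemma subgroup_J_part: "subgroup (J_part m :: ('n::finite) Kelem set) (milnor_K R_ring m)"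
proof (cases "ring (milnor_ring (R_ring :: (complex^'n \<Rightarrow> complex) ring))")
  case True
  let ?M = "milnor_ring (R_ring :: (complex^'n \<Rightarrow> complex) ring)"
  let ?K = "milnor_K (R_ring :: (complex^'n \<Rightarrow> complex) ring) m"
  interpret M: ring ?M by (rule True)
  interpret K: comm_group ?K by (rule R.comm_group_milnor_K)
  interpret J: ideal J_ideal ?M
    unfolding J_ideal_eq by (rule M.genideal_ideal[OF J_generators_closed])
  show ?thesis
  proof (rule K.subgroupI)
    show "J_part m \<subseteq> carrier ?K" by (auto simp: J_part_def)
    have "\<one>\<^bsub>?K\<^esub> \<in> J_part m"
      by (simp only: J_part_def mem_Collect_eq K_incl_one J.zero_closed K.one_closed simp_thms)
    then show "(J_part m :: 'n Kelem set) \<noteq> {}" by blast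
    show "a \<otimes>\<^bsub>?K\<^esub> b \<in> J_part m" if "a \<in> J_part m" "b \<in> J_part m" for a b
      using that J.a_closed by (auto simp: J_part_def R.K_incl_mult)
    show "inv\<^bsub>?K\<^esub> a \<in> J_part m" if a: "a \<in> J_part m" for a
    proof -
      have ac: "a \<in> carrier ?K" "K_incl R_ring m a \<in> J_ideal" using a by (auto simp: J_part_def)
      have "K_incl R_ring m (inv\<^bsub>?K\<^esub> a) \<oplus>\<^bsub>?M\<^esub> K_incl R_ring m a = \<zero>\<^bsub>?M\<^esub>"
        using ac by (simp add: R.K_incl_mult[symmetric] K_incl_one)
      then have "\<ominus>\<^bsub>?M\<^esub> K_incl R_ring m a = K_incl R_ring m (inv\<^bsub>?K\<^esub> a)"
        using ac by (intro M.minus_equality R.K_incl_closed) auto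
      then show ?thesis using ac J.a_inv_closed by (metis (mono_tags, lifting) J_part_def K.inv_closed mem_Collect_eq)
    qed
  qed
next
  case False
  then have "J_part m = carrier (milnor_K (R_ring :: (complex^'n \<Rightarrow> complex) ring) m)"
    by (simp add: J_part_def J_ideal_not_ring)
  then show ?thesis by (simp add: group.subgroup_self R.group_milnor_K)
qed

lemma K_symbol_J_part:
  fixes xs :: "(complex^'n::finite \<Rightarrow> complex) list"
  assumes "set xs \<subseteq> C_units" "set xs \<inter> E_units \<noteq> {}"
  shows "K_symbol R_ring xs \<in> J_part (length xs)"
proof -
  have "K_incl R_ring (length xs) (K_symbol R_ring xs) \<in> J_generators"
    using assms by (auto simp: J_generators_def)
  moreover have "J_generators \<subseteq> (J_ideal :: (nat \<Rightarrow> 'n Kelem) set)"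
    using ring.genideal_self[OF _ J_generators_closed] J_ideal_not_ring unfolding J_ideal_eq by blast
  ultimately show ?thesis
    using assms(1) C_units_R by (auto simp: J_part_def intro!: K_symbol_closed ring_R_ring)
qed

section \<open>The quotient K-group as a type\<close>

definition K_tilde_chain :: "nat \<Rightarrow> ((complex^'n::finite \<Rightarrow> complex) list \<Rightarrow>\<^sub>0 int) \<Rightarrow> 'n Kelem set" where
  "K_tilde_chain m c = K_tilde_class m (K_class R_ring m c)"

text \<open>The kernel of \<open>K_tilde_chain m\<close> on chains: by
  \<open>K_tilde_chain_eq_iff\<close>, equality in the quotient means that a difference lies
  here.\<close>

definition tilde_null :: "nat \<Rightarrow> ((complex^'n::finite \<Rightarrow> complex) list \<Rightarrow>\<^sub>0 int) set" where
  "tilde_null m = {c \<in> K_chains R_ring m. K_class R_ring m c \<in> J_part m}"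

lemma comm_group_K_tilde: "comm_group (K_tilde m)"
  unfolding K_tilde_def by (rule comm_group.abelian_FactGroup[OF R.comm_group_milnor_K subgroup_J_part])

lemma group_hom_K_tilde_chain: "group_hom (tensor_chains (units_of R_ring) m) (K_tilde m) (K_tilde_chain m)"
proof -
  have "normal (J_part m) (milnor_K R_ring m)"
    by (rule comm_group.subgroup_imp_normal[OF R.comm_group_milnor_K subgroup_J_part])
  from normal.r_coset_hom_Mod[OF this]
  have "K_tilde_class m \<in> hom (milnor_K R_ring m) (K_tilde m)"
    unfolding K_tilde_def K_tilde_class_def[abs_def] .
  from hom_compose[OF R.K_class_hom this]
  have "K_tilde_chain m \<in> hom (tensor_chains (units_of R_ring) m) (K_tilde m)"
    by (auto simp: hom_def K_tilde_chain_def compose_def)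
  then show ?thesis
    by (intro group_hom.intro group_hom_axioms.intro comm_group.axioms(2) R.comm_group_chains comm_group_K_tilde)
qed

lemma carrier_K_tilde: "carrier (K_tilde m) = K_tilde_chain m ` K_chains R_ring m"
  by (simp add: K_tilde_def carrier_FactGroup R.carrier_milnor_K image_image K_tilde_chain_def K_tilde_class_def)

lemma K_tilde_chain_add:
  "a \<in> K_chains R_ring m \<Longrightarrow> b \<in> K_chains R_ring m \<Longrightarrow>
    K_tilde_chain m (a + b) = K_tilde_chain m a \<otimes>\<^bsub>K_tilde m\<^esub> K_tilde_chain m b"
  using hom_mult[OF group_hom.homh[OF group_hom_K_tilde_chain[of m]], of a b]
  by (simp add: K_chains_def tensor_chains_def)

lemma K_tilde_chain_0: "K_tilde_chain m 0 = \<one>\<^bsub>K_tilde m\<^esub>"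
  using group_hom.hom_one[OF group_hom_K_tilde_chain[of m]] by (simp add: tensor_chains_def)

lemma K_tilde_chain_cmul:
  assumes "a \<in> K_chains R_ring m"
  shows "K_tilde_chain m (frag_cmul k a) = K_tilde_chain m a [^]\<^bsub>K_tilde m\<^esub> k"
proof -
  interpret group_hom "tensor_chains (units_of R_ring) m" "K_tilde m" "K_tilde_chain m"
    by (rule group_hom_K_tilde_chain)
  show ?thesis
    using hom_int_pow[of a k] assms by (simp add: K_chains_def tensor_chains_def)
qed

lemma K_tilde_chain_eq_iff:
  assumes "a \<in> K_chains R_ring m" "b \<in> K_chains R_ring m"
  shows "K_tilde_chain m a = K_tilde_chain m b \<longleftrightarrow> a - b \<in> tilde_null m"
proof -
  interpret g: comm_group "K_tilde m" by (rule comm_group_K_tilde)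
  have ab: "a - b \<in> K_chains R_ring m" using assms by (rule K_chains_diff)
  have c: "K_tilde_chain m x \<in> carrier (K_tilde m)" if "x \<in> K_chains R_ring m" for x :: "(complex^'a \<Rightarrow> complex) list \<Rightarrow>\<^sub>0 int"
    using that carrier_K_tilde by blast
  have "K_tilde_chain m a = K_tilde_chain m (a - b) \<otimes>\<^bsub>K_tilde m\<^esub> K_tilde_chain m b"
    using K_tilde_chain_add[OF ab assms(2)] by simp
  then have "K_tilde_chain m a = K_tilde_chain m b \<longleftrightarrow> K_tilde_chain m (a - b) = \<one>\<^bsub>K_tilde m\<^esub>"
    using g.right_cancel[OF c[OF assms(2)] c[OF ab] g.one_closed] g.l_one[OF c[OF assms(2)]] by argo
  also have "\<dots> \<longleftrightarrow> K_class R_ring m (a - b) \<in> J_part m"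
    unfolding K_tilde_def K_tilde_chain_def K_tilde_class_def one_FactGroup
    using group.coset_join1[OF R.group_milnor_K _ R.K_class_closed[OF ab] subgroup_J_part]
      group.coset_join2[OF R.group_milnor_K R.K_class_closed[OF ab] subgroup_J_part] by (rule iffI)
  finally show ?thesis using ab by (simp add: tilde_null_def)
qed

lemma tilde_null_diff:
  assumes "a \<in> tilde_null m" "b \<in> tilde_null m"
  shows "a - b \<in> tilde_null m"
proof -
  have "K_tilde_chain m x = K_tilde_chain m 0" if "x \<in> tilde_null m" for x :: "(complex^'a \<Rightarrow> complex) list \<Rightarrow>\<^sub>0 int"
    using that K_tilde_chain_eq_iff[of x m 0] by (simp add: tilde_null_def)
  with assms show ?thesis
    using K_tilde_chain_eq_iff[of a m b] by (simp add: tilde_null_def)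
qed

lemma K_null_tilde_null: "c \<in> K_null R_ring m \<Longrightarrow> c \<in> tilde_null m"
  using subgroup.one_closed[OF subgroup_J_part] by (auto simp: R.K_null_iff tilde_null_def)

lemma tilde_null_0: "0 \<in> tilde_null m"
  by (intro K_null_tilde_null R.K_null_0)

lemma tilde_null_uminus: "a \<in> tilde_null m \<Longrightarrow> - a \<in> tilde_null m"
  using tilde_null_diff[OF tilde_null_0] by force

lemma tilde_null_add: "a \<in> tilde_null m \<Longrightarrow> b \<in> tilde_null m \<Longrightarrow> a + b \<in> tilde_null m"
  using tilde_null_diff[of a m "- b"] tilde_null_uminus by force

lemma tilde_null_cmul: "a \<in> tilde_null m \<Longrightarrow> frag_cmul k a \<in> tilde_null m"
  by (rule frag_closure_minus_cmul[of "\<lambda>c. c \<in> tilde_null m"]) (auto intro: tilde_null_0 tilde_null_diff)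

lemma tilde_null_act:
  assumes "invertible \<gamma>" "c \<in> tilde_null m"
  shows "chain_map (merom_act \<gamma>) c \<in> tilde_null m"
proof -
  note rr = ring_R_ring ring_R_ring merom_act_R_hom[OF assms(1)]
  have "c \<in> K_chains R_ring m" "K_act m \<gamma> (K_class R_ring m c) \<in> J_part m"
    using assms(2) J_part_act[OF assms(1)] by (auto simp: tilde_null_def)
  then show ?thesis
    by (simp add: tilde_null_def K_act_eq[OF assms(1)] K_map_class[OF rr] chain_map_closed[OF rr])
qed

text \<open>All chains are divided out here, including those not supported on words of units.  The classes of the chains
  of degree \<open>n\<close> form the subgroup \<open>ktilde_carrier\<close>, a copy of \<open>K_tilde CARD('n)\<close> for which additive notation
  and finite sums are available.\<close>

quotient_type (overloaded) 'n ktilde = "(complex^'n::finite \<Rightarrow> complex) list \<Rightarrow>\<^sub>0 int" /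
    "\<lambda>a b. a - b \<in> tilde_null CARD('n)"
proof (rule equivpI)
  show "reflp (\<lambda>a b :: (complex^'n \<Rightarrow> complex) list \<Rightarrow>\<^sub>0 int. a - b \<in> tilde_null CARD('n))"
    by (simp add: reflp_def tilde_null_0)
  show "symp (\<lambda>a b :: (complex^'n \<Rightarrow> complex) list \<Rightarrow>\<^sub>0 int. a - b \<in> tilde_null CARD('n))"
    using tilde_null_uminus by (fastforce simp: symp_def)
  show "transp (\<lambda>a b :: (complex^'n \<Rightarrow> complex) list \<Rightarrow>\<^sub>0 int. a - b \<in> tilde_null CARD('n))"
    using tilde_null_add by (fastforce simp: transp_def)
qed

instantiation ktilde :: (finite) ab_group_add
begin

lift_definition zero_ktilde :: "'a ktilde" is 0 .

lift_definition plus_ktilde :: "'a ktilde \<Rightarrow> 'a ktilde \<Rightarrow> 'a ktilde" is "(+)"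
  subgoal for a b c d
    using tilde_null_add[of "a - b" "CARD('a)" "c - d"] by (simp add: algebra_simps)
  done

lift_definition minus_ktilde :: "'a ktilde \<Rightarrow> 'a ktilde \<Rightarrow> 'a ktilde" is "(-)"
  subgoal for a b c d
    using tilde_null_diff[of "a - b" "CARD('a)" "c - d"] by (simp add: algebra_simps)
  done

lift_definition uminus_ktilde :: "'a ktilde \<Rightarrow> 'a ktilde" is "uminus"
  subgoal for a b
    using tilde_null_uminus[of "a - b" "CARD('a)"] by simp
  done

instance
  by standard (transfer; simp add: tilde_null_0 algebra_simps)+

end

text \<open>Integer multiples, set up as a module structure so that the rules for scaling sums
  become available.\<close>

lift_definition zscale :: "int \<Rightarrow> ('n::finite) ktilde \<Rightarrow> 'n ktilde" is frag_cmul
  subgoal for k a b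
    using tilde_null_cmul[of "a - b" "CARD('n)" k] frag_cmul_distrib2[of k "a - b" b] by simp
  done

interpretation zscale: Modules.module "zscale :: int \<Rightarrow> ('n::finite) ktilde \<Rightarrow> 'n ktilde"
proof
  fix a b :: int and x y :: "'n ktilde"
  show "zscale a (x + y) = zscale a x + zscale a y"
    by transfer (simp add: frag_cmul_distrib2 tilde_null_0)
  show "zscale (a + b) x = zscale a x + zscale b x"
    by transfer (simp add: frag_cmul_distrib tilde_null_0)
  show "zscale a (zscale b x) = zscale (a * b) x"
    by transfer (simp add: tilde_null_0)
  show "zscale 1 x = x"
    by transfer (simp add: tilde_null_0)
qed

lemma abs_ktilde_eq_iff:
  "abs_ktilde a = abs_ktilde b \<longleftrightarrow> a - b \<in> tilde_null CARD('n)"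
  for a b :: "(complex^'n::finite \<Rightarrow> complex) list \<Rightarrow>\<^sub>0 int"
  by (simp add: ktilde.abs_eq_iff)

lemma abs_ktilde_rep [simp]: "abs_ktilde (rep_ktilde x) = x"
  by (rule Quotient_abs_rep[OF Quotient_ktilde])

definition ktilde_carrier :: "('n::finite) ktilde set" where
  "ktilde_carrier = abs_ktilde ` K_chains R_ring CARD('n)"

text \<open>Meaningful on \<open>ktilde_carrier\<close> only.\<close>

definition ktilde_val :: "('n::finite) ktilde \<Rightarrow> 'n Kelem set" where
  "ktilde_val x = K_tilde_chain CARD('n) (SOME c. c \<in> K_chains R_ring CARD('n) \<and> abs_ktilde c = x)"

lemma ktilde_val_abs:
  fixes c :: "(complex^'n::finite \<Rightarrow> complex) list \<Rightarrow>\<^sub>0 int"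
  assumes "c \<in> K_chains R_ring CARD('n)"
  shows "ktilde_val (abs_ktilde c) = K_tilde_chain CARD('n) c"
proof -
  let ?c = "SOME c'. c' \<in> K_chains R_ring CARD('n) \<and> abs_ktilde c' = abs_ktilde c"
  have "?c \<in> K_chains R_ring CARD('n) \<and> abs_ktilde ?c = abs_ktilde c"
    using assms by (intro someI) blast
  then show ?thesis
    using assms by (simp add: ktilde_val_def abs_ktilde_eq_iff K_tilde_chain_eq_iff)
qed

lemma ktilde_carrier_0 [simp]: "0 \<in> ktilde_carrier"
  unfolding ktilde_carrier_def zero_ktilde_def by (intro imageI K_chains_0)

lemma ktilde_carrier_add [simp]: "x \<in> ktilde_carrier \<Longrightarrow> y \<in> ktilde_carrier \<Longrightarrow> x + y \<in> ktilde_carrier"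
  unfolding ktilde_carrier_def by (auto simp: plus_ktilde.abs_eq intro!: imageI K_chains_add)

lemma ktilde_carrier_scale [simp]: "x \<in> ktilde_carrier \<Longrightarrow> zscale k x \<in> ktilde_carrier"
  unfolding ktilde_carrier_def by (auto simp: zscale.abs_eq intro!: imageI K_chains_cmul)

lemma ktilde_carrier_sum: "(\<And>i. i \<in> A \<Longrightarrow> f i \<in> ktilde_carrier) \<Longrightarrow> sum f A \<in> ktilde_carrier"
  by (induction A rule: infinite_finite_induct) auto

lemma ktilde_val_0: "ktilde_val (0 :: 'n ktilde) = \<one>\<^bsub>K_tilde CARD('n::finite)\<^esub>"
  by (simp add: zero_ktilde_def ktilde_val_abs K_tilde_chain_0)

lemma ktilde_val_add:
  fixes x y :: "('n::finite) ktilde"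
  assumes "x \<in> ktilde_carrier" "y \<in> ktilde_carrier"
  shows "ktilde_val (x + y) = ktilde_val x \<otimes>\<^bsub>K_tilde CARD('n)\<^esub> ktilde_val y"
  using assms by (auto simp: ktilde_carrier_def plus_ktilde.abs_eq ktilde_val_abs K_chains_add K_tilde_chain_add)

lemma ktilde_val_scale:
  fixes x :: "('n::finite) ktilde"
  assumes "x \<in> ktilde_carrier"
  shows "ktilde_val (zscale k x) = ktilde_val x [^]\<^bsub>K_tilde CARD('n)\<^esub> k"
  using assms by (auto simp: ktilde_carrier_def zscale.abs_eq ktilde_val_abs K_chains_cmul K_tilde_chain_cmul)

lemma ktilde_val_closed: "x \<in> ktilde_carrier \<Longrightarrow> ktilde_val x \<in> carrier (K_tilde CARD('n))" for x :: "('n::finite) ktilde"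
  by (auto simp: ktilde_carrier_def ktilde_val_abs carrier_K_tilde)

definition ktilde_act :: "rat^'n^'n \<Rightarrow> ('n::finite) ktilde \<Rightarrow> 'n ktilde" where
  "ktilde_act \<gamma> x = abs_ktilde (chain_map (merom_act \<gamma>) (rep_ktilde x))"

lemma ktilde_act_abs:
  assumes "invertible \<gamma>"
  shows "ktilde_act \<gamma> (abs_ktilde c) = abs_ktilde (chain_map (merom_act \<gamma>) c)"
proof -
  have "rep_ktilde (abs_ktilde c) - c \<in> tilde_null CARD('a)"
    by (simp add: abs_ktilde_eq_iff[symmetric])
  from tilde_null_act[OF assms this] show ?thesis
    by (simp add: ktilde_act_def abs_ktilde_eq_iff)
qed

lemma ktilde_act_0: "invertible \<gamma> \<Longrightarrow> ktilde_act \<gamma> 0 = 0"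
  by (simp add: zero_ktilde_def ktilde_act_abs)

lemma ktilde_act_add:
  assumes "invertible \<gamma>" shows "ktilde_act \<gamma> (x + y) = ktilde_act \<gamma> x + ktilde_act \<gamma> y"
  using ktilde_act_abs[OF assms, of "rep_ktilde x + rep_ktilde y"]
  by (simp add: plus_ktilde.abs_eq[symmetric] ktilde_act_abs[OF assms, symmetric])

lemma ktilde_act_scale:
  assumes "invertible \<gamma>" shows "ktilde_act \<gamma> (zscale k x) = zscale k (ktilde_act \<gamma> x)"
  using ktilde_act_abs[OF assms, of "frag_cmul k (rep_ktilde x)"]
  by (simp add: zscale.abs_eq[symmetric] ktilde_act_abs[OF assms, symmetric])

lemma ktilde_act_closed:
  assumes "invertible \<gamma>" "x \<in> ktilde_carrier" shows "ktilde_act \<gamma> x \<in> ktilde_carrier"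
  using assms(2) chain_map_closed[OF ring_R_ring ring_R_ring merom_act_R_hom[OF assms(1)]]
  by (auto simp: ktilde_carrier_def ktilde_act_abs[OF assms(1)])

text \<open>Both sides can be computed on a chain: the description hidden in
  \<open>K_tilde_act\<close> is unambiguous because \<open>tilde_null\<close> is stable under the
  action.\<close>

lemma K_tilde_act_val:
  fixes x :: "('n::finite) ktilde"
  assumes \<gamma>: "invertible \<gamma>" and x: "x \<in> ktilde_carrier"
  shows "K_tilde_act CARD('n) \<gamma> (ktilde_val x) = ktilde_val (ktilde_act \<gamma> x)"
proof -
  let ?n = "CARD('n)"
  note rr = ring_R_ring ring_R_ring merom_act_R_hom[OF \<gamma>]
  obtain a where a: "a \<in> K_chains R_ring ?n" "x = abs_ktilde a" using x by (auto simp: ktilde_carrier_def)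
  have *: "K_tilde_class ?n (K_act ?n \<gamma> (K_class R_ring ?n b)) = K_tilde_chain ?n (chain_map (merom_act \<gamma>) b)"
    if "b \<in> K_chains R_ring ?n" for b
    using that by (simp add: K_act_eq[OF \<gamma>] K_map_class[OF rr] K_tilde_chain_def)
  have "K_tilde_act ?n \<gamma> (K_tilde_class ?n (K_class R_ring ?n a)) = K_tilde_class ?n (K_act ?n \<gamma> (K_class R_ring ?n a))"
    unfolding K_tilde_act_def
  proof (rule descend_eq)
    show "K_class R_ring ?n a \<in> carrier (milnor_K R_ring ?n)" using a by (simp add: R.K_class_closed)
    fix X assume "X \<in> carrier (milnor_K R_ring ?n)" and eq: "K_tilde_class ?n X = K_tilde_class ?n (K_class R_ring ?n a)"
    then obtain b where b: "b \<in> K_chains R_ring ?n" "X = K_class R_ring ?n b" by (auto simp: R.carrier_milnor_K)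
    then have "b - a \<in> tilde_null ?n" using eq a by (simp add: K_tilde_chain_def[symmetric] K_tilde_chain_eq_iff)
    from tilde_null_act[OF \<gamma> this] show "K_tilde_class ?n (K_act ?n \<gamma> X) = K_tilde_class ?n (K_act ?n \<gamma> (K_class R_ring ?n a))"
      using a b by (simp add: * K_tilde_chain_eq_iff chain_map_closed[OF rr])
  qed
  then show ?thesis
    using a by (simp add: * ktilde_val_abs ktilde_act_abs[OF \<gamma>] chain_map_closed[OF rr] K_tilde_chain_def[symmetric])
qed

section \<open>Symbols and their elementary relations\<close>

definition ksym :: "(complex^'n \<Rightarrow> complex) list \<Rightarrow> ('n::finite) ktilde" where
  "ksym xs = abs_ktilde (frag_of xs)"

lemma C_words: "set xs \<subseteq> C_units \<Longrightarrow> length xs = m \<Longrightarrow> xs \<in> tensor_words (units_of R_ring) m"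
  using C_units_R by (auto simp: tensor_words_def units_of_carrier)

lemma ksym_closed: "set xs \<subseteq> C_units \<Longrightarrow> length xs = CARD('n) \<Longrightarrow> ksym xs \<in> ktilde_carrier"
  for xs :: "(complex^'n::finite \<Rightarrow> complex) list"
  by (auto simp: ksym_def ktilde_carrier_def C_words)

lemma ktilde_val_sym:
  fixes xs :: "(complex^'n::finite \<Rightarrow> complex) list"
  assumes "set xs \<subseteq> C_units" "length xs = CARD('n)"
  shows "ktilde_val (ksym xs) = K_tilde_class CARD('n) (K_symbol R_ring xs)"
  using assms by (simp add: ksym_def ktilde_val_abs C_words K_tilde_chain_def K_symbol_def)

lemma ktilde_act_sym: "invertible \<gamma> \<Longrightarrow> ktilde_act \<gamma> (ksym xs) = ksym (map (merom_act \<gamma>) xs)"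
  by (simp add: ksym_def ktilde_act_abs)

lemma ksym_mult:
  fixes x :: "complex^'n::finite \<Rightarrow> complex"
  assumes "set us \<subseteq> C_units" "set vs \<subseteq> C_units" "x \<in> C_units" "y \<in> C_units" "length us + length vs + 1 = CARD('n)"
  shows "ksym (us @ (x \<otimes>\<^bsub>merom_ring\<^esub> y) # vs) = ksym (us @ x # vs) + ksym (us @ y # vs)"
proof -
  have "frag_of (us @ [x \<otimes>\<^bsub>units_of R_ring\<^esub> y] @ vs) - frag_of (us @ [x] @ vs) - frag_of (us @ [y] @ vs)
    \<in> multilinear_rels (units_of R_ring) CARD('n)"
    unfolding multilinear_rels_def using assms C_units_R C_words[of "us @ [x] @ vs" "CARD('n)"]
    by (auto simp: units_of_carrier intro!: exI)
  then have "frag_of (us @ [x \<otimes>\<^bsub>units_of R_ring\<^esub> y] @ vs) - frag_of (us @ [x] @ vs) - frag_of (us @ [y] @ vs)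
    \<in> tilde_null CARD('n)"
    by (intro K_null_tilde_null R.K_null_rel) (simp add: K_relations_def)
  then show ?thesis
    by (simp add: ksym_def plus_ktilde.abs_eq abs_ktilde_eq_iff units_of_mult diff_diff_eq)
qed

lemma ksym_E:
  fixes xs :: "(complex^'n::finite \<Rightarrow> complex) list"
  assumes "set xs \<subseteq> C_units" "set xs \<inter> E_units \<noteq> {}" "length xs = CARD('n)"
  shows "ksym xs = 0"
  using K_symbol_J_part[OF assms(1,2)] assms C_words
  by (simp add: ksym_def zero_ktilde_def abs_ktilde_eq_iff tilde_null_def K_symbol_def)

lemma ksym_steinberg:
  fixes xs :: "(complex^'n::finite \<Rightarrow> complex) list"
  assumes "set xs \<subseteq> C_units" "length xs = CARD('n)" "i < length xs" "j < length xs" "i \<noteq> j"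
    "xs ! i \<oplus>\<^bsub>merom_ring\<^esub> xs ! j = \<one>\<^bsub>merom_ring\<^esub> \<or> xs ! i \<oplus>\<^bsub>merom_ring\<^esub> xs ! j = \<zero>\<^bsub>merom_ring\<^esub>"
  shows "ksym xs = 0"
proof -
  have "frag_of xs \<in> K_relations R_ring CARD('n)"
    unfolding K_relations_def steinberg_words_def using assms C_words[of xs "CARD('n)"] by auto
  then have "frag_of xs \<in> tilde_null CARD('n)" by (intro K_null_tilde_null R.K_null_rel)
  then show ?thesis by (simp add: ksym_def zero_ktilde_def abs_ktilde_eq_iff)
qed

section \<open>The cocycle relation for symbols\<close>

lemma merom_apply:
  assumes "z \<in> generic"
  shows "(f \<otimes>\<^bsub>merom_ring\<^esub> g) z = f z * g z" "(f \<oplus>\<^bsub>merom_ring\<^esub> g) z = f z + g z"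
    "\<one>\<^bsub>merom_ring\<^esub> z = 1" "\<zero>\<^bsub>merom_ring\<^esub> z = 0"
  using assms by (simp_all add: merom_ops)

lemma merom_eqI:
  assumes "f \<in> extensional generic" "g \<in> extensional generic" "\<And>z. z \<in> generic \<Longrightarrow> f z = g z"
  shows "f = g"
  using assms by (auto intro: extensionalityI)

lemma merom_ops_extensional [simp]:
  "f \<otimes>\<^bsub>merom_ring\<^esub> g \<in> extensional generic" "f \<oplus>\<^bsub>merom_ring\<^esub> g \<in> extensional generic"
  "\<one>\<^bsub>merom_ring\<^esub> \<in> extensional generic" "\<zero>\<^bsub>merom_ring\<^esub> \<in> extensional generic"
  "eps r l \<in> extensional generic" "one_minus_eps r l \<in> extensional generic"
  by (simp_all add: merom_ops eps_def one_minus_eps_eq)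

text \<open>The value is the constant e(-1/2); with \<open>eps_E_units\<close> this places -1 in
  E(V).\<close>

lemma minus_one_eps: "eps (1/2) (\<lambda>x. 0) = (\<lambda>z\<in>generic. -1)"
proof -
  have "exp (2 * of_real pi * \<i> * (0 - of_rat (1/2))) = (-1 :: complex)"
    by (simp add: of_rat_divide exp_minus)
  then show ?thesis by (simp add: eps_def form_ext_def cong: restrict_cong)
qed

lemma E_units_C_units [simp]: "e \<in> E_units \<Longrightarrow> e \<in> C_units"
  using E_units_subset_C_units by blast

text \<open>Multilinearity splits off a symbol with an entry in E(V), which is zero. Entries thus
  matter only modulo E(V).\<close>

lemma ksym_mult_E:
  fixes x :: "complex^'n::finite \<Rightarrow> complex"
  assumes "set us \<subseteq> C_units" "set vs \<subseteq> C_units" "x \<in> C_units" "e \<in> E_units" "length us + length vs + 1 = CARD('n)"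
  shows "ksym (us @ (e \<otimes>\<^bsub>merom_ring\<^esub> x) # vs) = ksym (us @ x # vs)"
  using assms ksym_mult[of us vs e x] ksym_E[of "us @ e # vs"] by auto

text \<open>The constant \<open>-1\<close> belongs to \<open>E(V)\<close>, hence \<open>{u, u} = {u, -u} = 0\<close>.\<close>

lemma ksym_square:
  fixes u :: "complex^'n::finite \<Rightarrow> complex"
  assumes "set us \<subseteq> C_units" "set vs \<subseteq> C_units" "u \<in> C_units" "length us + length vs + 2 = CARD('n)"
  shows "ksym (us @ u # u # vs) = 0"
proof -
  let ?e = "eps (1/2) (\<lambda>x. 0) :: complex^'n \<Rightarrow> complex"
  have e: "?e \<in> E_units" by (rule eps_E_units[OF dual_zero])
  have sum: "u \<oplus>\<^bsub>merom_ring\<^esub> (?e \<otimes>\<^bsub>merom_ring\<^esub> u) = \<zero>\<^bsub>merom_ring\<^esub>"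
    unfolding minus_one_eps by (rule merom_eqI) (auto simp: merom_apply)
  have "ksym (us @ u # (?e \<otimes>\<^bsub>merom_ring\<^esub> u) # vs) = 0"
    using assms e sum
    by (intro ksym_steinberg[where i = "length us" and j = "Suc (length us)"])
      (auto simp: nth_append C_units_mult)
  then show ?thesis
    using ksym_mult_E[of "us @ [u]" vs u ?e] assms e by simp
qed

text \<open>Expand {xy, xy} = 0 bilinearly; the squares {x, x} and {y, y} drop out.\<close>

lemma ksym_swap:
  fixes x :: "complex^'n::finite \<Rightarrow> complex"
  assumes "set us \<subseteq> C_units" "set vs \<subseteq> C_units" "x \<in> C_units" "y \<in> C_units" "length us + length vs + 2 = CARD('n)"
  shows "ksym (us @ x # y # vs) = - ksym (us @ y # x # vs)"
proof -
  have xy: "x \<otimes>\<^bsub>merom_ring\<^esub> y \<in> C_units" using assms by (simp add: C_units_mult)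
  let ?p = "x \<otimes>\<^bsub>merom_ring\<^esub> y"
  have "0 = ksym (us @ ?p # ?p # vs)" using ksym_square[of us vs ?p] assms xy by simp
  also have "\<dots> = ksym (us @ x # ?p # vs) + ksym (us @ y # ?p # vs)"
    using ksym_mult[of us "?p # vs" x y] assms xy by simp
  also have "ksym (us @ x # ?p # vs) = ksym (us @ x # x # vs) + ksym (us @ x # y # vs)"
    using ksym_mult[of "us @ [x]" vs x y] assms by simp
  also have "ksym (us @ y # ?p # vs) = ksym (us @ y # x # vs) + ksym (us @ y # y # vs)"
    using ksym_mult[of "us @ [y]" vs x y] assms by simp
  finally show ?thesis
    using assms ksym_square[of us vs x] ksym_square[of us vs y] by (simp add: eq_neg_iff_add_eq_0)
qed

lemma ksym_inverse:
  fixes x :: "complex^'n::finite \<Rightarrow> complex"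
  assumes "set us \<subseteq> C_units" "set vs \<subseteq> C_units" "x \<in> C_units" "y \<in> C_units"
    "x \<otimes>\<^bsub>merom_ring\<^esub> y = \<one>\<^bsub>merom_ring\<^esub>" "length us + length vs + 1 = CARD('n)"
  shows "ksym (us @ y # vs) = - ksym (us @ x # vs)"
proof -
  have "ksym (us @ \<one>\<^bsub>merom_ring\<^esub> # vs) = 0"
    using assms one_E_units by (intro ksym_E) auto
  then have "ksym (us @ x # vs) + ksym (us @ y # vs) = 0"
    using ksym_mult[of us vs x y] assms by simp
  then show ?thesis by (simp add: eq_neg_iff_add_eq_0 add.commute)
qed

text \<open>With \<open>a = 1 - x\<close>, \<open>b = 1 - y\<close> and \<open>c = 1 - x y\<close>, expand the Steinberg relation \<open>{a / c, x b / c} = 0\<close>.\<close>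

lemma ksym_three_term:
  fixes l m :: "'n::finite form"
  assumes "set us \<subseteq> C_units" "set vs \<subseteq> C_units" "length us + length vs + 2 = CARD('n)"
    and l: "l \<in> dual" "l \<noteq> (\<lambda>x. 0)" and m: "m \<in> dual" "m \<noteq> (\<lambda>x. 0)" and lm: "(\<lambda>x. l x + m x) \<noteq> (\<lambda>x. 0)"
  shows "ksym (us @ one_minus_eps r l # one_minus_eps s m # vs) =
    ksym (us @ one_minus_eps r l # one_minus_eps (r + s) (\<lambda>x. l x + m x) # vs) +
    ksym (us @ one_minus_eps (r + s) (\<lambda>x. l x + m x) # one_minus_eps s m # vs)"
proof -
  let ?a = "one_minus_eps r l" and ?b = "one_minus_eps s m" and ?c = "one_minus_eps (r + s) (\<lambda>x. l x + m x)"
    and ?e = "eps r l"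
  have a: "?a \<in> C_units" and b: "?b \<in> C_units" and c: "?c \<in> C_units" and e: "?e \<in> E_units"
    using assms by (auto intro: one_minus_eps_C_units eps_E_units dual_plus)
  obtain d where d: "d \<in> C_units" and cd: "?c \<otimes>\<^bsub>merom_ring\<^esub> d = \<one>\<^bsub>merom_ring\<^esub>"
    using C_units_inverse[OF c] by blast
  let ?ad = "?a \<otimes>\<^bsub>merom_ring\<^esub> d" and ?bd = "?b \<otimes>\<^bsub>merom_ring\<^esub> d"
  have ad: "?ad \<in> C_units" and bd: "?bd \<in> C_units" using a b d by (auto intro: C_units_mult)
  have sum: "?ad \<oplus>\<^bsub>merom_ring\<^esub> (?e \<otimes>\<^bsub>merom_ring\<^esub> ?bd) = \<one>\<^bsub>merom_ring\<^esub>"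
  proof (rule merom_eqI)
    fix z :: "complex^'n" assume z: "z \<in> generic"
    have "?c z * d z = 1" using cd z by (metis merom_apply(1,3))
    moreover have "?c z = ?a z + ?e z * ?b z"
      using eps_mult[of r l s m] z
      by (auto simp: one_minus_eps_eq eps_def merom_ops fun_eq_iff algebra_simps split: if_splits)
    ultimately show "(?ad \<oplus>\<^bsub>merom_ring\<^esub> (?e \<otimes>\<^bsub>merom_ring\<^esub> ?bd)) z = \<one>\<^bsub>merom_ring\<^esub> z"
      using z by (simp add: merom_apply algebra_simps)
  qed auto
  have "0 = ksym (us @ ?ad # (?e \<otimes>\<^bsub>merom_ring\<^esub> ?bd) # vs)"
    using assms e ad bd sum
    by (intro sym[OF ksym_steinberg[where i = "length us" and j = "Suc (length us)"]])
      (auto simp: nth_append C_units_mult)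
  also have "\<dots> = ksym (us @ ?ad # ?bd # vs)"
    using ksym_mult_E[of "us @ [?ad]" vs ?bd ?e] assms ad bd e by simp
  also have "\<dots> = ksym (us @ ?a # ?bd # vs) + ksym (us @ d # ?bd # vs)"
    using ksym_mult[of us "?bd # vs" ?a d] assms a d bd by simp
  also have "ksym (us @ ?a # ?bd # vs) = ksym (us @ ?a # ?b # vs) + ksym (us @ ?a # d # vs)"
    using ksym_mult[of "us @ [?a]" vs ?b d] assms a b d by simp
  also have "ksym (us @ d # ?bd # vs) = ksym (us @ d # ?b # vs) + ksym (us @ d # d # vs)"
    using ksym_mult[of "us @ [d]" vs ?b d] assms b d by simp
  also have "ksym (us @ d # d # vs) = 0" using ksym_square[of us vs d] assms d by simp
  also have "ksym (us @ ?a # d # vs) = - ksym (us @ ?a # ?c # vs)"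
    using ksym_inverse[of "us @ [?a]" vs ?c d] assms a c d cd by simp
  also have "ksym (us @ d # ?b # vs) = - ksym (us @ ?c # ?b # vs)"
    using ksym_inverse[of us "?b # vs" ?c d] assms b c d cd by simp
  finally show ?thesis by (simp add: algebra_simps eq_diff_eq)
qed

section \<open>Expansion of a symbol along a sum of forms\<close>

definition entry :: "rat \<times> ('n::finite) form \<Rightarrow> complex^'n \<Rightarrow> complex" where
  "entry p = one_minus_eps (fst p) (snd p)"

text \<open>Addition of pairs, under which \<epsilon> is multiplicative: the entry at
  \<open>pair_sum ps\<close> is 1 minus the product of the exponentials of the single pairs.\<close>

definition pair_sum :: "(rat \<times> ('n::finite) form) list \<Rightarrow> rat \<times> 'n form" where
  "pair_sum ps = (\<Sum>p\<leftarrow>ps. fst p, \<lambda>x. \<Sum>p\<leftarrow>ps. snd p x)"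

definition delete_nth :: "nat \<Rightarrow> 'a list \<Rightarrow> 'a list" where
  "delete_nth i xs = take i xs @ drop (Suc i) xs"

definition nonzero_form :: "rat \<times> ('n::finite) form \<Rightarrow> bool" where
  "nonzero_form p \<longleftrightarrow> snd p \<in> dual \<and> snd p \<noteq> (\<lambda>x. 0)"

lemma entry_C: "nonzero_form p \<Longrightarrow> entry p \<in> C_units"
  by (simp add: entry_def nonzero_form_def one_minus_eps_C_units)

lemma length_delete_nth [simp]: "i < length xs \<Longrightarrow> length (delete_nth i xs) = length xs - 1"
  by (auto simp: delete_nth_def)

lemma set_delete_nth: "set (delete_nth i xs) \<subseteq> set xs"
  by (auto simp: delete_nth_def dest: in_set_takeD in_set_dropD)

lemma delete_nth_snoc: "i < length xs \<Longrightarrow> delete_nth i (xs @ [y]) = delete_nth i xs @ [y]"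
  by (simp add: delete_nth_def)

lemma delete_nth_last: "delete_nth (length xs) (xs @ [y]) = xs"
  by (simp add: delete_nth_def)

text \<open>Induction on the number of factors: the three-term relation joins the last pair q to the
  partial sum w before it. The tail \<open>vs\<close> is arbitrary because the hypothesis is used
  twice, with q and with the new sum put in front of \<open>vs\<close>. The condition on partial
  sums makes every 1 - \<epsilon> that is divided by a unit.\<close>

lemma ksym_expand:
  fixes ps :: "(rat \<times> 'n::finite form) list"
  assumes "ps \<noteq> []" "\<And>p. p \<in> set ps \<Longrightarrow> nonzero_form p"
    "\<And>k. 0 < k \<Longrightarrow> k \<le> length ps \<Longrightarrow> nonzero_form (pair_sum (take k ps))"
    "set vs \<subseteq> C_units" "length ps + length vs = CARD('n)"
  shows "ksym (map entry ps @ vs) =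
    (\<Sum>i<length ps. zscale ((-1) ^ (length ps - 1 - i)) (ksym (map entry (delete_nth i ps) @ entry (pair_sum ps) # vs)))"
  using assms
proof (induction ps arbitrary: vs rule: rev_induct)
  case (snoc q ps)
  show ?case
  proof (cases "ps = []")
    case True
    have "pair_sum [q] = q" by (simp add: pair_sum_def)
    then show ?thesis using True by (simp add: delete_nth_def)
  next
    case False
    let ?k = "length ps"
    let ?w = "entry (pair_sum ps)" and ?w' = "entry (pair_sum (ps @ [q]))"
    have nz: "\<And>p. p \<in> set ps \<Longrightarrow> nonzero_form p" "nonzero_form q" using snoc.prems by auto
    have nzs: "nonzero_form (pair_sum (take k ps))" if "0 < k" "k \<le> length ps" for k
      using snoc.prems(3)[of k] that by simp
    have nzps: "nonzero_form (pair_sum ps)" using nzs[of ?k] False by simp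
    have nzq: "nonzero_form (pair_sum (ps @ [q]))" using snoc.prems(3)[of "Suc ?k"] by simp
    have Cps: "set (map entry ps) \<subseteq> C_units" using nz entry_C by auto
    have Cdel: "set (map entry (delete_nth i ps)) \<subseteq> C_units" for i using Cps set_delete_nth[of i ps] by auto
    have C: "entry q \<in> C_units" "?w \<in> C_units" "?w' \<in> C_units" using entry_C[OF nz(2)] entry_C[OF nzps] entry_C[OF nzq] .
    have psq: "fst (pair_sum (ps @ [q])) = fst (pair_sum ps) + fst q"
      "snd (pair_sum (ps @ [q])) = (\<lambda>x. snd (pair_sum ps) x + snd q x)" by (auto simp: pair_sum_def)
    \<comment> \<open>With w' = w + q the relation reads {w, q} = {w, w'} + {w', q}. A swap turns
      the last symbol into -{q, w'}, the term that deletes the i-th entry of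
      \<open>ps @ [q]\<close>.\<close>
    have 3: "ksym (map entry (delete_nth i ps) @ ?w # entry q # vs) =
        ksym (map entry (delete_nth i ps) @ ?w # ?w' # vs) - ksym (map entry (delete_nth i (ps @ [q])) @ ?w' # vs)" if i: "i < ?k" for i
    proof -
      have len: "length (map entry (delete_nth i ps)) + length vs + 2 = CARD('n)"
        using i snoc.prems(5) by simp
      have "ksym (map entry (delete_nth i ps) @ ?w # entry q # vs) =
        ksym (map entry (delete_nth i ps) @ ?w # ?w' # vs) + ksym (map entry (delete_nth i ps) @ ?w' # entry q # vs)"
        unfolding entry_def[of "pair_sum ps"] entry_def[of q] entry_def[of "pair_sum (ps @ [q])"] psq
        by (rule ksym_three_term[OF Cdel snoc.prems(4) len])
           (use nzps nz nzq in \<open>simp_all add: nonzero_form_def psq\<close>)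
      also have "ksym (map entry (delete_nth i ps) @ ?w' # entry q # vs) = - ksym (map entry (delete_nth i ps) @ entry q # ?w' # vs)"
        by (rule ksym_swap[OF Cdel snoc.prems(4) C(3,1) len])
      finally show ?thesis using i by (simp add: delete_nth_snoc)
    qed
    have "ksym (map entry (ps @ [q]) @ vs) = ksym (map entry ps @ entry q # vs)" by simp
    also have "\<dots> = (\<Sum>i<?k. zscale ((-1) ^ (?k - 1 - i)) (ksym (map entry (delete_nth i ps) @ ?w # entry q # vs)))"
      using snoc.IH[OF False nz(1) nzs, of "entry q # vs"] snoc.prems C by simp
    also have "\<dots> = (\<Sum>i<?k. zscale ((-1) ^ (?k - 1 - i)) (ksym (map entry (delete_nth i ps) @ ?w # ?w' # vs))
        + zscale ((-1) ^ (?k - i)) (ksym (map entry (delete_nth i (ps @ [q])) @ ?w' # vs)))"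
    proof (rule sum.cong[OF refl])
      fix i assume "i \<in> {..<?k}"
      then have i: "i < ?k" by simp
      \<comment> \<open>The minus sign of the swap raises the exponent from k - 1 - i to k -
        i.\<close>
      then have "?k - i = Suc (?k - 1 - i)" by simp
      then have "(-1 :: int) ^ (?k - i) = - ((-1) ^ (?k - 1 - i))" by (simp only: power_Suc mult_minus1)
      then show "zscale ((-1) ^ (?k - 1 - i)) (ksym (map entry (delete_nth i ps) @ ?w # entry q # vs)) =
        zscale ((-1) ^ (?k - 1 - i)) (ksym (map entry (delete_nth i ps) @ ?w # ?w' # vs))
        + zscale ((-1) ^ (?k - i)) (ksym (map entry (delete_nth i (ps @ [q])) @ ?w' # vs))"
        by (simp add: 3[OF i] zscale.scale_right_diff_distrib)
    qed
    \<comment> \<open>The first summands are the induction hypothesis for the tail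
      \<open>w' # vs\<close>, read backwards; they recombine to the term in which q itself is
      deleted.\<close>
    also have "\<dots> = ksym (map entry ps @ ?w' # vs)
        + (\<Sum>i<?k. zscale ((-1) ^ (?k - i)) (ksym (map entry (delete_nth i (ps @ [q])) @ ?w' # vs)))"
      using snoc.IH[OF False nz(1) nzs, of "?w' # vs"] snoc.prems C by (simp add: sum.distrib)
    also have "\<dots> = (\<Sum>i<Suc ?k. zscale ((-1) ^ (?k - i)) (ksym (map entry (delete_nth i (ps @ [q])) @ ?w' # vs)))"
      by (simp add: delete_nth_last add.commute)
    finally show ?thesis by simp
  qed
qed simp

text \<open>This is \<open>ksym_expand\<close> with empty tail, multiplied by (-1)^n: its left side
  becomes the term i = n, in which the sum is the deleted pair.\<close>

lemma ksym_cocycle: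
  fixes ps :: "(rat \<times> 'n::finite form) list"
  assumes "length ps = CARD('n)" "\<And>p. p \<in> set ps \<Longrightarrow> nonzero_form p"
    "\<And>k. 0 < k \<Longrightarrow> k \<le> length ps \<Longrightarrow> nonzero_form (pair_sum (take k ps))"
  shows "(\<Sum>i\<le>CARD('n). zscale ((-1) ^ i) (ksym (map entry (delete_nth i (ps @ [pair_sum ps]))))) = 0"
proof -
  let ?n = "CARD('n)" and ?w = "pair_sum ps"
  have "ps \<noteq> []" using assms(1) by auto
  from ksym_expand[OF this assms(2,3), of "[]"] assms(1)
  have "ksym (map entry ps) = (\<Sum>i<?n. zscale ((-1) ^ (?n - 1 - i)) (ksym (map entry (delete_nth i ps) @ [entry ?w])))" by simp
  also have "\<dots> = (\<Sum>i<?n. zscale ((-1) ^ (?n - 1 - i)) (ksym (map entry (delete_nth i (ps @ [?w])))))"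
    using assms(1) by (intro sum.cong) (auto simp: delete_nth_snoc)
  finally have "zscale ((-1) ^ ?n) (ksym (map entry ps)) =
    (\<Sum>i<?n. zscale ((-1) ^ ?n * (-1) ^ (?n - 1 - i)) (ksym (map entry (delete_nth i (ps @ [?w])))))"
    by (simp add: zscale.scale_sum_right)
  also have "\<dots> = (\<Sum>i<?n. - zscale ((-1) ^ i) (ksym (map entry (delete_nth i (ps @ [?w])))))"
  proof (rule sum.cong[OF refl])
    fix i assume "i \<in> {..<?n}"
    \<comment> \<open>Parity: the exponents n and n - 1 - i add up to an even number plus i +
      1.\<close>
    then have "?n + (?n - 1 - i) = 2 * (?n - 1 - i) + Suc i" by auto
    then have "(-1 :: int) ^ ?n * (-1) ^ (?n - 1 - i) = - ((-1) ^ i)"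
      by (simp only: power_add[symmetric]) (simp add: power_add power_mult)
    then show "zscale ((-1) ^ ?n * (-1) ^ (?n - 1 - i)) (ksym (map entry (delete_nth i (ps @ [?w])))) =
        - zscale ((-1) ^ i) (ksym (map entry (delete_nth i (ps @ [?w]))))" by simp
  qed
  finally have "zscale ((-1) ^ ?n) (ksym (map entry ps)) =
    - (\<Sum>i<?n. zscale ((-1) ^ i) (ksym (map entry (delete_nth i (ps @ [?w])))))" by (simp add: sum_negf)
  moreover have "delete_nth ?n (ps @ [?w]) = ps" using delete_nth_last[of ps ?w] assms(1) by simp
  ultimately show ?thesis by (simp add: lessThan_Suc_atMost[symmetric])
qed

section \<open>The distribution relation\<close>

text \<open>Factor X^m - 1 over the m-th roots of unity, evaluate at 1/w and multiply by
  w^m.\<close>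

lemma prod_roots_of_unity:
  fixes w :: complex
  assumes "m > 0"
  shows "(\<Prod>j<m. 1 - w * exp (- (2 * of_real pi * \<i> * of_nat j / of_nat m))) = 1 - w ^ m"
proof (cases "w = 0")
  case False
  let ?p = "Polynomial.monom 1 m - 1 :: complex poly"
  have poly: "poly ?p z = z ^ m - 1" for z by (simp add: poly_monom)
  \<comment> \<open>The derivative m X^(m-1) vanishes at most at 0, which is not a root of X^m -
    1.\<close>
  have "rsquarefree ?p"
    unfolding rsquarefree_roots
    using assms by (auto simp: poly_monom pderiv_diff pderiv_monom power_0_left)
  moreover have "lead_coeff ?p = 1"
  proof -
    have "degree (Polynomial.monom 1 m + (- 1) :: complex poly) = degree (Polynomial.monom 1 m :: complex poly)"
      by (rule degree_add_eq_left) (simp add: degree_monom_eq assms)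
    then have "degree ?p = m" by (simp add: degree_monom_eq)
    then show ?thesis using assms by simp
  qed
  ultimately have decomp: "(\<Prod>z | z ^ m = 1. [:-z, 1:]) = ?p"
    using complex_poly_decompose_rsquarefree[of ?p] by (simp add: poly_monom)
  have "(\<Prod>z | z ^ m = 1. inverse w - z) = inverse w ^ m - 1"
    using arg_cong[OF decomp, of "\<lambda>p. poly p (inverse w)"] by (simp add: poly_prod poly_monom)
  then have "w ^ m * (\<Prod>z | z ^ m = 1. inverse w - z) = 1 - w ^ m"
    using False by (simp add: field_simps)
  moreover have "w ^ m * (\<Prod>z | z ^ m = 1. inverse w - z) = (\<Prod>z | z ^ m = 1. w * (inverse w - z))"
    using card_roots_unity_eq[OF assms] by (simp add: prod.distrib)
  ultimately have "(\<Prod>z | z ^ m = 1. 1 - w * z) = 1 - w ^ m"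
    using False by (simp add: right_diff_distrib)
  \<comment> \<open>Inversion permutes the roots of unity. It produces the negative exponents that
    match the shift from r/m to (r + j)/m in \<open>entry_distribution\<close>.\<close>
  moreover have "(\<Prod>z | z ^ m = 1. 1 - w * z) = (\<Prod>z | z ^ m = 1. 1 - w * inverse z)"
    by (rule prod.reindex_bij_witness[of _ inverse inverse]) (auto simp: power_inverse)
  moreover have "(\<Prod>z | z ^ m = 1. 1 - w * inverse z) = (\<Prod>j<m. 1 - w * inverse (exp (2 * of_real pi * \<i> * of_nat j / of_nat m)))"
    using bij_betw_roots_unity[of m] complex_roots_unity[of m] assms
    by (intro prod.reindex_bij_betw[symmetric]) simp
  ultimately show ?thesis by (simp add: exp_minus)
qed (use assms in simp)

section \<open>Multilinear expansion of products of entries\<close>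

definition merom_prod :: "(nat \<Rightarrow> complex^'n::finite \<Rightarrow> complex) \<Rightarrow> nat \<Rightarrow> complex^'n \<Rightarrow> complex" where
  "merom_prod u m = (\<lambda>z\<in>generic. \<Prod>j<m. u j z)"

lemma merom_prod_Suc: "merom_prod u (Suc m) = merom_prod u m \<otimes>\<^bsub>merom_ring\<^esub> u m"
  by (auto simp: merom_prod_def merom_ops cong: restrict_cong)

lemma merom_prod_0: "merom_prod u 0 = \<one>\<^bsub>merom_ring\<^esub>"
  by (simp add: merom_prod_def merom_ops)

lemma merom_prod_C: "(\<And>j. j < m \<Longrightarrow> u j \<in> C_units) \<Longrightarrow> merom_prod u m \<in> C_units"
  by (induction m) (auto simp: merom_prod_0 merom_prod_Suc one_E_units C_units_mult)

lemma ksym_merom_prod: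
  fixes us :: "(complex^'n::finite \<Rightarrow> complex) list"
  assumes "set us \<subseteq> C_units" "set vs \<subseteq> C_units" "\<And>j. j < m \<Longrightarrow> u j \<in> C_units" "length us + length vs + 1 = CARD('n)"
  shows "ksym (us @ merom_prod u m # vs) = (\<Sum>j<m. ksym (us @ u j # vs))"
  using assms(3)
proof (induction m)
  case 0
  \<comment> \<open>The empty product 1 lies in E(V), so its symbol vanishes like the empty
    sum.\<close>
  then show ?case using assms one_E_units by (auto simp: merom_prod_0 intro!: ksym_E)
next
  case (Suc m)
  then show ?case
    using ksym_mult[OF assms(1,2) merom_prod_C[of m u] _ assms(4), of "u m"] by (simp add: merom_prod_Suc)
qed

text \<open>The prefix \<open>us\<close> collects the slots already expanded, so that the induction
  treats one slot at a time. A choice of one factor in each slot is an extensional function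
  k.\<close>

lemma ksym_merom_prods:
  fixes us :: "(complex^'n::finite \<Rightarrow> complex) list"
  assumes "distinct is" "set us \<subseteq> C_units" "\<And>i j. i \<in> set is \<Longrightarrow> j < m i \<Longrightarrow> u i j \<in> C_units"
    "length us + length is = CARD('n)"
  shows "ksym (us @ map (\<lambda>i. merom_prod (u i) (m i)) is) =
    (\<Sum>k\<in>PiE (set is) (\<lambda>i. {..<m i}). ksym (us @ map (\<lambda>i. u i (k i)) is))"
  using assms
proof (induction "is" arbitrary: us)
  case (Cons i "is")
  let ?P = "PiE (set is) (\<lambda>i. {..<m i})"
  have "ksym (us @ map (\<lambda>i. merom_prod (u i) (m i)) (i # is)) =
     (\<Sum>j<m i. ksym (us @ u i j # map (\<lambda>i. merom_prod (u i) (m i)) is))"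
    using Cons.prems by (simp add: ksym_merom_prod merom_prod_C image_subset_iff)
  also have "\<dots> = (\<Sum>j<m i. \<Sum>k\<in>?P. ksym (us @ u i j # map (\<lambda>i. u i (k i)) is))"
  proof (rule sum.cong[OF refl])
    fix j assume "j \<in> {..<m i}"
    then show "ksym (us @ u i j # map (\<lambda>i. merom_prod (u i) (m i)) is) = (\<Sum>k\<in>?P. ksym (us @ u i j # map (\<lambda>i. u i (k i)) is))"
      using Cons.IH[of "us @ [u i j]"] Cons.prems by simp
  qed
  also have "\<dots> = (\<Sum>(j, k)\<in>{..<m i} \<times> ?P. ksym (us @ u i j # map (\<lambda>i. u i (k i)) is))"
    by (simp add: sum.cartesian_product)
  also have "\<dots> = (\<Sum>(j, k)\<in>{..<m i} \<times> ?P. ksym (us @ map (\<lambda>i'. u i' ((k(i := j)) i')) (i # is)))"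
  proof (rule sum.cong[OF refl], clarify)
    fix j k
    have e: "map (\<lambda>i'. u i' ((k(i := j)) i')) is = map (\<lambda>i. u i (k i)) is" using Cons.prems by auto
    show "ksym (us @ u i j # map (\<lambda>i. u i (k i)) is) = ksym (us @ map (\<lambda>i'. u i' ((k(i := j)) i')) (i # is))"
      by (simp only: list.map fun_upd_same e)
  qed
  \<comment> \<open>A function on the enlarged set of slots is a pair of its value at i and a
    function on the rest, combined by update.\<close>
  also have "\<dots> = (\<Sum>k\<in>PiE (set (i # is)) (\<lambda>i. {..<m i}). ksym (us @ map (\<lambda>i. u i (k i)) (i # is)))"
    using Cons.prems(1) inj_combinator[of i "set is" "\<lambda>i. {..<m i}"]
    by (simp add: PiE_insert_eq sum.reindex o_def case_prod_unfold)
  finally show ?case .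
qed simp

lemma coords_simps [simp]: "distinct coords" "set coords = UNIV" "length (coords :: 'n::{finite,linorder} list) = CARD('n)"
  by (simp_all add: coords_def)

definition coord_form :: "rat \<Rightarrow> 'n::finite \<Rightarrow> 'n form" where
  "coord_form c i = (\<lambda>x. c * x $ i)"

lemma nonzero_coord_form: "c \<noteq> 0 \<Longrightarrow> nonzero_form (r, coord_form c i)"
proof -
  assume "c \<noteq> 0"
  then have "coord_form c i (axis i 1) \<noteq> 0" by (simp add: coord_form_def)
  then have "coord_form c i \<noteq> (\<lambda>x. 0)" by metis
  then show ?thesis by (simp add: nonzero_form_def coord_form_def dual_smult coord_dual)
qed

text \<open>With w the exponential of the pair (r/m, l/m), the j-th factor is 1 - w e(-j/m), and w^m
  is the exponential of (r, l).\<close>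

lemma entry_distribution:
  assumes "m > 0"
  shows "entry (r, l) = merom_prod (\<lambda>j. entry ((r + of_nat j) / of_nat m, \<lambda>x. l x / of_nat m)) m"
proof -
  have "1 - exp (2 * of_real pi * \<i> * (form_ext l z - of_rat r)) =
    (\<Prod>j<m. 1 - exp (2 * of_real pi * \<i> * (form_ext (\<lambda>x. l x / of_nat m) z - of_rat ((r + of_nat j) / of_nat m))))" for z
  proof -
    let ?w = "exp (2 * of_real pi * \<i> * ((form_ext l z - of_rat r) / of_nat m))"
    have f: "form_ext (\<lambda>x. l x / of_nat m) z = form_ext l z / of_nat m"
      using form_ext_smult[of "1 / of_nat m" l z] by (simp add: of_rat_divide)
    have "2 * of_real pi * \<i> * (form_ext (\<lambda>x. l x / of_nat m) z - of_rat ((r + of_nat j) / of_nat m)) =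
       2 * of_real pi * \<i> * ((form_ext l z - of_rat r) / of_nat m) + - (2 * of_real pi * \<i> * of_nat j / of_nat m)" for j
      using assms by (simp add: f of_rat_divide of_rat_add field_simps)
    then have "(\<Prod>j<m. 1 - exp (2 * of_real pi * \<i> * (form_ext (\<lambda>x. l x / of_nat m) z - of_rat ((r + of_nat j) / of_nat m))))
      = (\<Prod>j<m. 1 - ?w * exp (- (2 * of_real pi * \<i> * of_nat j / of_nat m)))"
      by (simp only: exp_add)
    also have "\<dots> = 1 - ?w ^ m" by (rule prod_roots_of_unity[OF assms])
    also have "?w ^ m = exp (2 * of_real pi * \<i> * (form_ext l z - of_rat r))"
      using assms by (simp flip: exp_of_nat_mult)
    finally show ?thesis by simp
  qed
  then show ?thesis
    by (auto simp: entry_def one_minus_eps_eq merom_prod_def cong: restrict_cong)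
qed

section \<open>Boxes and their decomposition into cosets\<close>

definition form_box :: "(rat \<times> ('n::finite) form) list \<Rightarrow> rat^'n \<Rightarrow> int" where
  "form_box ps x = of_bool (\<forall>(r, l)\<in>set ps. l x - r \<in> \<int>)"

text \<open>One list gives both shadows: its box is the coset of a modulo d
  (\<open>coset_fn_box\<close>), and its entries are those of the symbol defining \<xi>
  (\<open>map_std_factor\<close>).\<close>

definition coset_pairs :: "rat^('n::{finite,linorder}) \<Rightarrow> nat \<Rightarrow> (rat \<times> 'n form) list" where
  "coset_pairs a d = map (\<lambda>i. (a $ i / of_nat d, coord_form (1 / of_nat d) i)) coords"

lemma coset_fn_Ints:
  assumes "d > 0"
  shows "coset_fn a d x = of_bool (\<forall>i. (x $ i - a $ i) / of_nat d \<in> \<int>)"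
proof -
  have "(\<exists>k::int. x $ i = a $ i + of_nat d * of_int k) \<longleftrightarrow> (x $ i - a $ i) / of_nat d \<in> \<int>" for i
  proof
    assume "(x $ i - a $ i) / of_nat d \<in> \<int>"
    then obtain k :: int where "(x $ i - a $ i) / of_nat d = of_int k" by (elim Ints_cases)
    then have "x $ i = a $ i + of_nat d * of_int k" using assms by (simp add: field_simps)
    then show "\<exists>k::int. x $ i = a $ i + of_nat d * of_int k" ..
  qed (use assms in auto)
  then show ?thesis by (simp add: coset_fn_def)
qed

lemma coset_fn_box:
  fixes a :: "rat^('n::{finite,linorder})"
  assumes "d > 0"
  shows "coset_fn a d = form_box (coset_pairs a d)"
  by (rule ext)
    (simp add: coset_fn_Ints[OF assms] form_box_def coset_pairs_def coord_form_def diff_divide_distrib)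

definition coset_sym :: "rat^('n::{finite,linorder}) \<Rightarrow> nat \<Rightarrow> 'n ktilde" where
  "coset_sym a d = ksym (map entry (coset_pairs a d))"

lemma std_factor_entry: "std_factor a d i = entry (a $ i / of_nat d, coord_form (1 / of_nat d) i)"
proof -
  have "form_ext (coord_form c i) z = of_rat c * z $ i" for c z
    unfolding coord_form_def by (simp add: form_ext_smult form_ext_coord)
  then show ?thesis
    by (simp add: std_factor_def entry_def one_minus_eps_eq of_rat_divide diff_divide_distrib)
qed

lemma map_std_factor: "map (std_factor a d) coords = map entry (coset_pairs a d)"
  by (simp add: coset_pairs_def std_factor_entry)

lemma set_coset_pairs_C: "d > 0 \<Longrightarrow> set (map entry (coset_pairs a d)) \<subseteq> C_units"
  by (auto simp: coset_pairs_def intro!: entry_C nonzero_coord_form)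

lemma length_coset_pairs [simp]: "length (coset_pairs (a :: rat^('n::{finite,linorder})) d) = CARD('n)"
  by (simp add: coset_pairs_def)

text \<open>An integer t is congruent modulo m to exactly one k < m, and a non-integer to none. This
  is the counterpart of \<open>entry_distribution\<close> for test functions.\<close>

lemma sum_of_bool_residue:
  fixes t :: rat
  assumes "m > 0"
  shows "(\<Sum>k<m. of_bool ((t - of_nat k) / of_nat m \<in> \<int>) :: int) = of_bool (t \<in> \<int>)"
proof (cases "t \<in> \<int>")
  case True
  then obtain T :: int where T: "t = of_int T" by (elim Ints_cases)
  have "(t - of_nat k) / of_nat m \<in> \<int> \<longleftrightarrow> k = nat (T mod int m)" if k: "k < m" for k
  proof -
    have "(t - of_nat k) / of_nat m = of_int (T - int k) / of_int (int m)" by (simp add: T)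
    then have "(t - of_nat k) / of_nat m \<in> \<int> \<longleftrightarrow> (int m) dvd (T - int k)"
      using of_int_div_of_int_in_Ints_iff[of "T - int k" "int m", where 'a = rat] assms by simp
    also have "\<dots> \<longleftrightarrow> T mod int m = int k"
      using k by (metis mod_eq_dvd_iff mod_pos_pos_trivial of_nat_0_le_iff of_nat_less_iff)
    also have "\<dots> \<longleftrightarrow> k = nat (T mod int m)" using assms by auto
    finally show ?thesis .
  qed
  then have "(\<Sum>k<m. of_bool ((t - of_nat k) / of_nat m \<in> \<int>) :: int) = (\<Sum>k<m. if k = nat (T mod int m) then 1 else 0)"
    by (intro sum.cong) auto
  also have "\<dots> = 1" using assms by (simp add: nat_less_iff)
  finally show ?thesis using True by simp
next
  case False
  have "(t - of_nat k) / of_nat m \<notin> \<int>" for k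
  proof
    assume "(t - of_nat k) / of_nat m \<in> \<int>"
    then have "(t - of_nat k) / of_nat m * of_nat m + of_nat k \<in> \<int>" by (intro Ints_add Ints_mult) auto
    then show False using False assms by simp
  qed
  then show ?thesis using False by simp
qed

text \<open>The solution of c_i x_i = r_i + k_i. If m_i = D c_i, then c_i x_i - r_i lies in k_i +
  m_i \<int> exactly if x_i lies in the coset of this point modulo D.\<close>

definition box_point :: "('n::finite \<Rightarrow> rat) \<Rightarrow> ('n \<Rightarrow> rat) \<Rightarrow> ('n \<Rightarrow> nat) \<Rightarrow> rat^'n" where
  "box_point r c k = (\<chi> i. (r i + of_nat (k i)) / c i)"

context
  fixes r c :: "'n::{finite,linorder} \<Rightarrow> rat" and m :: "'n \<Rightarrow> nat" and D :: nat
  assumes c: "\<And>i. c i > 0" and D: "D > 0" and m: "\<And>i. of_nat (m i) = of_nat D * c i"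
begin

lemma m_pos: "m i > 0"
proof -
  have "(of_nat (m i) :: rat) > 0" using c D m by simp
  then show ?thesis by simp
qed

text \<open>Each condition is split by residues modulo m_i; multiplying out the product of these
  sums gives one coset for each choice k of residues.\<close>

lemma box_decompose:
  "form_box (map (\<lambda>i. (r i, coord_form (c i) i)) coords) x =
    (\<Sum>k\<in>PiE UNIV (\<lambda>i. {..<m i}). coset_fn (box_point r c k) D x)"
proof -
  have of_bool_all: "of_bool (\<forall>i. P i) = (\<Prod>i\<in>UNIV. of_bool (P i) :: int)" for P :: "'n \<Rightarrow> bool"
    by (cases "\<forall>i. P i") (auto simp: prod_zero_iff)
  have div: "(c i * x $ i - r i - of_nat k) / of_nat (m i) = 1 / of_nat D * x $ i - (r i + of_nat k) / c i / of_nat D" for i k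
    using c[of i] D by (simp add: m field_simps)
  have "form_box (map (\<lambda>i. (r i, coord_form (c i) i)) coords) x = (\<Prod>i\<in>UNIV. of_bool (c i * x $ i - r i \<in> \<int>))"
    by (simp add: form_box_def coord_form_def of_bool_all)
  also have "\<dots> = (\<Prod>i\<in>UNIV. \<Sum>k<m i. of_bool ((c i * x $ i - r i - of_nat k) / of_nat (m i) \<in> \<int>))"
    by (simp only: sum_of_bool_residue[OF m_pos])
  also have "\<dots> = (\<Sum>k\<in>PiE UNIV (\<lambda>i. {..<m i}). \<Prod>i\<in>UNIV. of_bool ((c i * x $ i - r i - of_nat (k i)) / of_nat (m i) \<in> \<int>))"
    by (rule prod_sum_PiE) auto
  also have "\<dots> = (\<Sum>k\<in>PiE UNIV (\<lambda>i. {..<m i}). coset_fn (box_point r c k) D x)"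
    by (simp add: coset_fn_box D form_box_def coset_pairs_def coord_form_def box_point_def of_bool_all div)
  finally show ?thesis .
qed

text \<open>The index set is that of \<open>box_decompose\<close>, so box and symbol can be matched
  term by term.\<close>

lemma sym_decompose:
  "ksym (map (\<lambda>i. entry (r i, coord_form (c i) i)) coords) = (\<Sum>k\<in>PiE UNIV (\<lambda>i. {..<m i}). coset_sym (box_point r c k) D)"
proof -
  let ?u = "\<lambda>i j. entry ((r i + of_nat j) / of_nat (m i), \<lambda>x. coord_form (c i) i x / of_nat (m i))"
  \<comment> \<open>Because c_i / m_i = 1/D for every i, all factors live on the common level
    D.\<close>
  have form: "(\<lambda>x. coord_form (c i) i x / of_nat (m i)) = coord_form (1 / of_nat D) i" for i
    using c[of i] by (auto simp: coord_form_def m)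
  have u: "?u i j = entry (box_point r c (\<lambda>_. j) $ i / of_nat D, coord_form (1 / of_nat D) i)" for i j
    using c[of i] by (simp add: form) (simp add: box_point_def m mult.commute)
  have "ksym (map (\<lambda>i. entry (r i, coord_form (c i) i)) coords) = ksym ([] @ map (\<lambda>i. merom_prod (?u i) (m i)) coords)"
    unfolding append_Nil by (intro arg_cong[where f = ksym] map_cong refl entry_distribution m_pos)
  also have "\<dots> = (\<Sum>k\<in>PiE (set coords) (\<lambda>i. {..<m i}). ksym ([] @ map (\<lambda>i. ?u i (k i)) coords))"
    by (rule ksym_merom_prods) (use D in \<open>auto simp: form intro!: entry_C nonzero_coord_form\<close>)
  also have "\<dots> = (\<Sum>k\<in>PiE UNIV (\<lambda>i. {..<m i}). coset_sym (box_point r c k) D)"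
    unfolding u coset_sym_def coset_pairs_def by (simp add: box_point_def o_def)
  finally show ?thesis .
qed

end

section \<open>The map on test functions\<close>

lemma entry_shift:
  assumes "r - s \<in> \<int>"
  shows "entry (r, l) = entry (s, l)"
proof -
  obtain k :: int where k: "r = s + of_int k" using assms by (elim Ints_cases) (simp add: algebra_simps)
  have "exp (2 * of_real pi * \<i> * (w - of_rat r)) = exp (2 * of_real pi * \<i> * (w - of_rat s))" for w :: complex
  proof -
    have "2 * of_real pi * \<i> * (w - of_rat r) = 2 * of_real pi * \<i> * (w - of_rat s) + 2 * of_real pi * \<i> * of_int (- k)"
      by (simp add: k of_rat_add algebra_simps)
    moreover have "exp (2 * of_real pi * \<i> * of_int (- k)) = (1 :: complex)"
      unfolding exp_two_pi_i_eq_1 by blast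
    ultimately show ?thesis by (simp only: exp_add mult_1_right)
  qed
  then show ?thesis by (simp add: entry_def one_minus_eps_eq)
qed

text \<open>For D > 0, the representative of x + D\<int>^n in the cube [0, D)^n.\<close>

definition rep_mod :: "nat \<Rightarrow> rat^'n \<Rightarrow> rat^'n" where
  "rep_mod D x = (\<chi> i. of_nat D * frac (x $ i / of_nat D))"

lemma frac_eq_frac_iff: "frac x = frac y \<longleftrightarrow> x - y \<in> \<int>" for x y :: rat
proof -
  have "frac x = frac y \<longleftrightarrow> x - frac y \<in> \<int>" by (simp add: frac_unique_iff frac_ge_0 frac_lt_1)
  also have "x - frac y = (x - y) + of_int \<lfloor>y\<rfloor>" by (simp add: frac_def)
  finally show ?thesis by simp
qed

lemma rep_mod_eq_iff:
  assumes "D > 0"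
  shows "rep_mod D x = rep_mod D y \<longleftrightarrow> (\<forall>i. (x $ i - y $ i) / of_nat D \<in> \<int>)"
  using assms by (simp add: rep_mod_def vec_eq_iff frac_eq_frac_iff diff_divide_distrib)

lemma rep_mod_diff:
  assumes "D > 0"
  shows "(rep_mod D x $ i - x $ i) / of_nat D \<in> \<int>"
  using assms by (simp add: rep_mod_def diff_divide_distrib frac_def)

lemma rep_mod_idem [simp]: "D > 0 \<Longrightarrow> rep_mod D (rep_mod D x) = rep_mod D x"
  by (simp add: rep_mod_eq_iff rep_mod_diff)

lemma coset_fn_rep: "D > 0 \<Longrightarrow> coset_fn x D y = of_bool (rep_mod D x = rep_mod D y)"
  by (simp add: coset_fn_Ints rep_mod_eq_iff) (metis minus_diff_eq minus_divide_left minus_in_Ints_iff)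

lemma coset_sym_rep:
  assumes "D > 0" shows "coset_sym (rep_mod D x) D = coset_sym x D"
proof -
  have "map entry (coset_pairs (rep_mod D x) D) = map entry (coset_pairs x D)"
    unfolding coset_pairs_def using rep_mod_diff[OF assms, of x]
    by (auto intro!: entry_shift simp: diff_divide_distrib)
  then show ?thesis by (simp add: coset_sym_def)
qed

text \<open>Cosets modulo D are disjoint, so among the representatives in \<open>T\<close> only that
  of y has a non-zero coefficient.\<close>

lemma coset_sym_level:
  assumes "D > 0" "finite T" "T \<subseteq> range (rep_mod D)" "rep_mod D y \<in> T"
  shows "coset_sym y D = (\<Sum>t\<in>T. zscale (coset_fn y D t) (coset_sym t D))"
proof -
  have "(\<Sum>t\<in>T. zscale (coset_fn y D t) (coset_sym t D)) = (\<Sum>t\<in>T. if t = rep_mod D y then coset_sym t D else 0)"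
  proof (rule sum.cong[OF refl])
    fix t assume "t \<in> T"
    then have "rep_mod D t = t" using assms by auto
    then show "zscale (coset_fn y D t) (coset_sym t D) = (if t = rep_mod D y then coset_sym t D else 0)"
      using assms(1) by (auto simp: coset_fn_rep)
  qed
  also have "\<dots> = coset_sym y D" using assms by (simp add: coset_sym_rep)
  finally show ?thesis by simp
qed

definition pres_sum :: "(int \<times> (rat^('n::{finite,linorder})) \<times> nat) list \<Rightarrow> 'n ktilde" where
  "pres_sum ps = (\<Sum>(b, a, d)\<leftarrow>ps. zscale b (coset_sym a d))"

lemma finite_PiE_lessThan [simp]: "finite (PiE (UNIV :: 'n::finite set) (\<lambda>i. {..<m i :: nat}))"
  by (rule finite_PiE) auto

text \<open>Expansions over all sufficiently large sets of representatives modulo \<open>D\<close>: two presentations of a test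
  function can be compared over a common one.\<close>

definition level_expansion ::
    "nat \<Rightarrow> (rat^('n::{finite,linorder})) set \<Rightarrow> (rat^('n::{finite,linorder}) \<Rightarrow> int) \<Rightarrow> 'n ktilde \<Rightarrow> bool" where
  "level_expansion D P \<phi> x \<longleftrightarrow> finite P \<and> P \<subseteq> range (rep_mod D) \<and>
    (\<forall>T. finite T \<longrightarrow> P \<subseteq> T \<longrightarrow> T \<subseteq> range (rep_mod D) \<longrightarrow> x = (\<Sum>t\<in>T. zscale (\<phi> t) (coset_sym t D)))"

lemma level_expansionD:
  "level_expansion D P \<phi> x \<Longrightarrow> finite T \<Longrightarrow> P \<subseteq> T \<Longrightarrow> T \<subseteq> range (rep_mod D) \<Longrightarrow>
    x = (\<Sum>t\<in>T. zscale (\<phi> t) (coset_sym t D))"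
  unfolding level_expansion_def by blast

text \<open>A coset modulo d splits into (D/d)^n cosets modulo D. The decompositions of box and
  symbol, taken with scaling 1/d, achieve this for the function and its value at once.\<close>

lemma coset_sym_refine:
  fixes a :: "rat^('n::{finite,linorder})"
  assumes "D > 0" "d > 0" "d dvd D"
  shows "\<exists>P. level_expansion D P (coset_fn a d) (coset_sym a d)"
proof -
  let ?m = "\<lambda>i :: 'n. D div d" and ?c = "\<lambda>i :: 'n. 1 / of_nat d :: rat" and ?r = "\<lambda>i. a $ i / of_nat d"
  let ?K = "PiE UNIV (\<lambda>i. {..<?m i})" and ?y = "box_point ?r ?c"
  have c: "\<And>i. ?c i > 0" using assms by simp
  have m: "\<And>i. of_nat (?m i) = of_nat D * ?c i" using assms by (auto elim!: dvdE)
  note S = sym_decompose[of ?c D ?m ?r, OF c assms(1) m] and B = box_decompose[of ?c D ?m ?r, OF c assms(1) m]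
  have "coset_sym a d = (\<Sum>t\<in>T. zscale (coset_fn a d t) (coset_sym t D))"
    if T: "finite T" "rep_mod D ` ?y ` ?K \<subseteq> T" "T \<subseteq> range (rep_mod D)" for T
  proof -
    have "coset_sym a d = (\<Sum>k\<in>?K. coset_sym (?y k) D)"
      using S by (simp add: coset_sym_def coset_pairs_def o_def)
    also have "\<dots> = (\<Sum>k\<in>?K. \<Sum>t\<in>T. zscale (coset_fn (?y k) D t) (coset_sym t D))"
      using T assms(1) by (intro sum.cong refl coset_sym_level) auto
    also have "\<dots> = (\<Sum>t\<in>T. zscale (\<Sum>k\<in>?K. coset_fn (?y k) D t) (coset_sym t D))"
      by (subst sum.swap) (simp add: zscale.scale_sum_left)
    also have "\<dots> = (\<Sum>t\<in>T. zscale (coset_fn a d t) (coset_sym t D))"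
      using B assms(2) by (simp add: coset_fn_box coset_pairs_def)
    finally show ?thesis .
  qed
  moreover have "finite (rep_mod D ` ?y ` ?K)" by (intro finite_imageI finite_PiE_lessThan)
  ultimately have "level_expansion D (rep_mod D ` ?y ` ?K) (coset_fn a d) (coset_sym a d)"
    unfolding level_expansion_def by (intro conjI image_mono subset_UNIV allI impI)
  then show ?thesis ..
qed

lemma presented_Cons: "presented ((b, a, d) # ps) x = b * coset_fn a d x + presented ps x"
  by (simp add: presented_def)

lemma pres_sum_refine:
  fixes ps :: "(int \<times> (rat^('n::{finite,linorder})) \<times> nat) list"
  assumes "D > 0" "\<And>b a d. (b, a, d) \<in> set ps \<Longrightarrow> d > 0 \<and> d dvd D"
  shows "\<exists>P. level_expansion D P (presented ps) (pres_sum ps)"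
  using assms(2)
proof (induction ps)
  case Nil
  show ?case by (rule exI[of _ "{}"]) (simp add: level_expansion_def pres_sum_def presented_def)
next
  case (Cons p ps)
  obtain b a d where p: "p = (b, a, d)" by (cases p)
  have d: "d > 0" "d dvd D" using Cons.prems[of b a d] p by auto
  obtain P where P: "level_expansion D P (coset_fn a d) (coset_sym a d)"
    using coset_sym_refine[OF assms(1) d] by blast
  obtain Q where Q: "level_expansion D Q (presented ps) (pres_sum ps)"
    using Cons.IH Cons.prems by (meson list.set_intros(2))
  have "pres_sum (p # ps) = (\<Sum>t\<in>T. zscale (presented (p # ps) t) (coset_sym t D))"
    if T: "finite T" "P \<union> Q \<subseteq> T" "T \<subseteq> range (rep_mod D)" for T
  proof -
    have PT: "coset_sym a d = (\<Sum>t\<in>T. zscale (coset_fn a d t) (coset_sym t D))"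
      using P T by (intro level_expansionD[of D P]) auto
    have QT: "pres_sum ps = (\<Sum>t\<in>T. zscale (presented ps t) (coset_sym t D))"
      using Q T by (intro level_expansionD[of D Q]) auto
    have "pres_sum (p # ps) = zscale b (coset_sym a d) + pres_sum ps" by (simp add: pres_sum_def p)
    also have "\<dots> = zscale b (\<Sum>t\<in>T. zscale (coset_fn a d t) (coset_sym t D)) +
        (\<Sum>t\<in>T. zscale (presented ps t) (coset_sym t D))"
      by (simp only: PT[symmetric] QT[symmetric])
    also have "\<dots> = (\<Sum>t\<in>T. zscale (presented (p # ps) t) (coset_sym t D))"
      by (simp add: p presented_Cons zscale.scale_left_distrib sum.distrib zscale.scale_sum_right)
    finally show ?thesis .
  qed
  then have "level_expansion D (P \<union> Q) (presented (p # ps)) (pres_sum (p # ps))"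
    using P Q unfolding level_expansion_def by blast
  then show ?case ..
qed

text \<open>Over a common modulus and a common set of representatives, the coefficient of each coset
  symbol is a value of the presented function, hence the same for both lists. The definition of
  \<open>xi_std\<close> rests on this.\<close>

lemma pres_sum_cong:
  fixes ps qs :: "(int \<times> (rat^('n::{finite,linorder})) \<times> nat) list"
  assumes "ps \<in> presentations" "qs \<in> presentations" "presented ps = presented qs"
  shows "pres_sum ps = pres_sum qs"
proof -
  define D where "D = prod_list (map (\<lambda>(b, a, d). d) (ps @ qs))"
  have pos: "d > 0" if "(b, a, d) \<in> set (ps @ qs)" for b a d
    using assms(1,2) that by (auto simp: presentations_def)
  then have D: "D > 0" unfolding D_def by (intro Nat.gr0I) (force simp: prod_list_zero_iff)
  have dvd: "d dvd D" if "(b, a, d) \<in> set (ps @ qs)" for b a d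
    unfolding D_def using that by (intro prod_list_dvd) force
  obtain P where P: "level_expansion D P (presented ps) (pres_sum ps)"
    using pres_sum_refine[OF D, of ps] pos dvd by (metis Un_iff set_append)
  obtain Q where Q: "level_expansion D Q (presented qs) (pres_sum qs)"
    using pres_sum_refine[OF D, of qs] pos dvd by (metis Un_iff set_append)
  have T: "finite (P \<union> Q)" "P \<union> Q \<subseteq> range (rep_mod D)"
    using P Q unfolding level_expansion_def by blast+
  show ?thesis
    using level_expansionD[OF P T(1) Un_upper1 T(2)] level_expansionD[OF Q T(1) Un_upper2 T(2)]
    by (simp only: assms(3))
qed

section \<open>The standard distribution with values in \<open>ktilde\<close>\<close>

definition xi_std_lift :: "(rat^('n::{finite,linorder}) \<Rightarrow> int) \<Rightarrow> 'n ktilde" where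
  "xi_std_lift f = pres_sum (SOME ps. ps \<in> presentations \<and> presented ps = f)"

lemma xi_std_lift_presented: "ps \<in> presentations \<Longrightarrow> xi_std_lift (presented ps) = pres_sum ps"
proof -
  assume ps: "ps \<in> presentations"
  then have "(SOME qs. qs \<in> presentations \<and> presented qs = presented ps) \<in> presentations \<and>
     presented (SOME qs. qs \<in> presentations \<and> presented qs = presented ps) = presented ps"
    by (intro someI[of "\<lambda>qs. qs \<in> presentations \<and> presented qs = presented ps"]) simp
  then show ?thesis unfolding xi_std_lift_def using ps by (intro pres_sum_cong) auto
qed

lemma test_fns_carrier: "carrier test_fns = presented ` presentations"
  by (simp add: test_fns_def)

lemma presented_append: "presented (ps @ qs) = (\<lambda>x. presented ps x + presented qs x)"
  by (rule ext) (simp add: presented_def)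

definition scale_pres :: "int \<Rightarrow> (int \<times> (rat^'n) \<times> nat) list \<Rightarrow> (int \<times> (rat^'n) \<times> nat) list" where
  "scale_pres k ps = map (\<lambda>p. (k * fst p, snd p)) ps"

lemma presented_scale: "presented (scale_pres k ps) = (\<lambda>x. k * presented ps x)"
proof
  show "presented (scale_pres k ps) x = k * presented ps x" for x
    by (induction ps) (auto simp: scale_pres_def presented_def algebra_simps)
qed

lemma presentations_append: "ps \<in> presentations \<Longrightarrow> qs \<in> presentations \<Longrightarrow> ps @ qs \<in> presentations"
  by (auto simp: presentations_def)

lemma presentations_scale: "ps \<in> presentations \<Longrightarrow> scale_pres k ps \<in> presentations"
  by (auto simp: scale_pres_def presentations_def)

lemma test_fns_add: "f \<in> carrier test_fns \<Longrightarrow> g \<in> carrier test_fns \<Longrightarrow> (\<lambda>x. f x + g x) \<in> carrier test_fns"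
  unfolding test_fns_carrier by (auto simp flip: presented_append intro: imageI presentations_append)

lemma test_fns_scale: "f \<in> carrier test_fns \<Longrightarrow> (\<lambda>x. k * f x) \<in> carrier test_fns"
  unfolding test_fns_carrier by (auto simp flip: presented_scale intro: imageI presentations_scale)

lemma test_fns_zero: "(\<lambda>x. 0) \<in> carrier test_fns"
  unfolding test_fns_carrier by (rule image_eqI[of _ _ "[]"]) (auto simp: presented_def presentations_def)

lemma test_fns_sum:
  "(\<And>i. i \<in> A \<Longrightarrow> f i \<in> carrier test_fns) \<Longrightarrow> (\<lambda>x. \<Sum>i\<in>A. f i x) \<in> carrier test_fns"
  by (induction A rule: infinite_finite_induct) (auto simp: test_fns_zero test_fns_add)

lemma coset_fn_test: "d > 0 \<Longrightarrow> coset_fn a d \<in> carrier test_fns"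
  unfolding test_fns_carrier
  by (rule image_eqI[of _ _ "[(1, a, d)]"]) (auto simp: presented_def presentations_def)

lemma xi_std_lift_coset:
  fixes a :: "rat^('n::{finite,linorder})"
  assumes "d > 0" shows "xi_std_lift (coset_fn a d) = coset_sym a d"
proof -
  have "[(1, a, d)] \<in> presentations" using assms by (simp add: presentations_def)
  moreover have "presented [(1, a, d)] = coset_fn a d" by (simp add: presented_def fun_eq_iff)
  ultimately show ?thesis using xi_std_lift_presented[of "[(1, a, d)]"] by (simp add: pres_sum_def)
qed

lemma xi_std_lift_add:
  fixes f g :: "rat^('n::{finite,linorder}) \<Rightarrow> int"
  assumes "f \<in> carrier test_fns" "g \<in> carrier test_fns"
  shows "xi_std_lift (\<lambda>x. f x + g x) = xi_std_lift f + xi_std_lift g"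
  using assms unfolding test_fns_carrier
  by (auto simp: xi_std_lift_presented presentations_append simp flip: presented_append) (simp add: pres_sum_def)

lemma xi_std_lift_scale:
  fixes f :: "rat^('n::{finite,linorder}) \<Rightarrow> int"
  assumes "f \<in> carrier test_fns"
  shows "xi_std_lift (\<lambda>x. k * f x) = zscale k (xi_std_lift f)"
proof -
  obtain ps where ps: "ps \<in> presentations" "f = presented ps" using assms by (auto simp: test_fns_carrier)
  have "pres_sum (scale_pres k ps) = zscale k (pres_sum ps)"
    by (induction ps) (auto simp: scale_pres_def pres_sum_def zscale.scale_right_distrib)
  then show ?thesis
    using ps xi_std_lift_presented[OF presentations_scale[OF ps(1)], of k] by (simp add: xi_std_lift_presented presented_scale)
qed

lemma xi_std_lift_zero: "xi_std_lift (\<lambda>x. 0) = 0"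
  using xi_std_lift_presented[of "[]"] by (simp add: presented_def[abs_def] presentations_def pres_sum_def)

lemma xi_std_lift_sum:
  fixes f :: "'b \<Rightarrow> rat^('n::{finite,linorder}) \<Rightarrow> int"
  assumes "\<And>i. i \<in> A \<Longrightarrow> f i \<in> carrier test_fns" "finite A"
  shows "xi_std_lift (\<lambda>x. \<Sum>i\<in>A. f i x) = (\<Sum>i\<in>A. xi_std_lift (f i))"
  using assms(2,1) by (induction A) (auto simp: xi_std_lift_zero xi_std_lift_add test_fns_sum)

lemma coset_sym_closed: "d > 0 \<Longrightarrow> coset_sym a d \<in> ktilde_carrier"
  unfolding coset_sym_def by (intro ksym_closed set_coset_pairs_C) simp_all

lemma pres_sum_closed: "ps \<in> presentations \<Longrightarrow> pres_sum ps \<in> ktilde_carrier"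
  by (induction ps) (auto simp: pres_sum_def presentations_def coset_sym_closed)

lemma xi_std_lift_closed: "f \<in> carrier test_fns \<Longrightarrow> xi_std_lift f \<in> ktilde_carrier"
  unfolding test_fns_carrier by (auto simp: xi_std_lift_presented pres_sum_closed)

text \<open>The fold in the multiplicative quotient group is the image of the additive
  \<open>pres_sum\<close>, and \<open>pres_sum_cong\<close> makes the description by
  \<open>descend\<close> unambiguous.\<close>

lemma xi_std_eq:
  fixes f :: "rat^('n::{finite,linorder}) \<Rightarrow> int"
  assumes "f \<in> carrier test_fns"
  shows "xi_std f = ktilde_val (xi_std_lift f)"
proof -
  let ?\<phi> = "\<lambda>ps. foldr (\<lambda>(b, a, d) y.
          K_tilde_class CARD('n) (K_symbol R_ring (map (std_factor a d) coords))
            [^]\<^bsub>K_tilde CARD('n)\<^esub> b \<otimes>\<^bsub>K_tilde CARD('n)\<^esub> y)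
        ps \<one>\<^bsub>K_tilde CARD('n)\<^esub>"
  have fold: "?\<phi> ps = ktilde_val (pres_sum ps)" if "ps \<in> presentations" for ps :: "(int \<times> (rat^('n::{finite,linorder})) \<times> nat) list"
    using that
  proof (induction ps)
    case Nil
    then show ?case by (simp add: pres_sum_def ktilde_val_0)
  next
    case (Cons p ps)
    obtain b a d where p: "p = (b, a, d)" by (cases p)
    have d: "d > 0" and ps: "ps \<in> presentations" using Cons.prems p by (auto simp: presentations_def)
    have "ktilde_val (pres_sum (p # ps)) = ktilde_val (zscale b (coset_sym a d) + pres_sum ps)"
      by (simp add: pres_sum_def p)
    also have "\<dots> = ktilde_val (coset_sym a d) [^]\<^bsub>K_tilde CARD('n)\<^esub> b \<otimes>\<^bsub>K_tilde CARD('n)\<^esub> ktilde_val (pres_sum ps)"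
      using coset_sym_closed[OF d, of a] pres_sum_closed[OF ps] by (simp add: ktilde_val_add ktilde_val_scale)
    also have "ktilde_val (coset_sym a d) = K_tilde_class CARD('n) (K_symbol R_ring (map (std_factor a d) coords))"
      unfolding coset_sym_def map_std_factor by (rule ktilde_val_sym[OF set_coset_pairs_C[OF d]]) simp
    finally show ?case using Cons.IH[OF ps] by (simp add: p)
  qed
  obtain ps where ps: "ps \<in> presentations" "f = presented ps" using assms by (auto simp: test_fns_carrier)
  have "xi_std (presented ps) = ?\<phi> ps"
    unfolding xi_std_def
  proof (rule descend_eq[OF ps(1)])
    fix qs :: "(int \<times> (rat^('n::{finite,linorder})) \<times> nat) list" assume "qs \<in> presentations" "presented qs = presented ps"
    then have "pres_sum qs = pres_sum ps" using ps pres_sum_cong by blast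
    then show "?\<phi> qs = ?\<phi> ps" by (simp only: fold[OF \<open>qs \<in> presentations\<close>] fold[OF ps(1)])
  qed
  then show ?thesis using ps fold[OF ps(1)] by (simp add: xi_std_lift_presented)
qed

section \<open>Values on boxes given by multiples of coordinates\<close>

lemma common_denominator:
  fixes S :: "rat set"
  assumes "finite S"
  shows "\<exists>N::nat. N > 0 \<and> (\<forall>s\<in>S. of_nat N * s \<in> \<int>)"
  using assms
proof (induction S)
  case (insert s S)
  then obtain N where N: "N > 0" "\<forall>s\<in>S. of_nat N * s \<in> \<int>" by blast
  obtain p q :: int where pq: "s = of_int p / of_int q" "q > 0"
    by (metis Fract_of_int_quotient Rat_cases)
  have "of_nat (N * nat q) * s = of_int (int N * p)" using pq by simp
  then have "of_nat (N * nat q) * s \<in> \<int>" by (metis Ints_of_int)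
  moreover have "of_nat (N * nat q) * t \<in> \<int>" if "t \<in> S" for t
  proof -
    have "of_nat (nat q) * (of_nat N * t) \<in> \<int>" using N that by (blast intro: Ints_mult[OF Ints_of_nat])
    then show ?thesis by (simp add: mult_ac)
  qed
  ultimately show ?case using N pq by (intro exI[of _ "N * nat q"]) auto
qed (simp add: exI[of _ 1])

text \<open>Once D clears the denominators of all c_i, box and symbol decompose into cosets modulo D
  and their symbols over the same index set.\<close>

lemma xi_std_lift_box_pos:
  fixes c r :: "'n::{finite,linorder} \<Rightarrow> rat"
  assumes c: "\<And>i. c i > 0"
  shows "form_box (map (\<lambda>i. (r i, coord_form (c i) i)) coords) \<in> carrier test_fns"
    and "xi_std_lift (form_box (map (\<lambda>i. (r i, coord_form (c i) i)) coords)) = ksym (map (\<lambda>i. entry (r i, coord_form (c i) i)) coords)"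
proof -
  obtain D :: nat where D: "D > 0" "\<forall>s\<in>range c. of_nat D * s \<in> \<int>"
    using common_denominator[of "range c"] by auto
  define m where "m = (\<lambda>i. nat \<lfloor>of_nat D * c i\<rfloor>)"
  have m: "of_nat (m i) = of_nat D * c i" for i
  proof -
    have "of_nat D * c i \<in> \<int>" using D by blast
    then obtain k :: int where k: "of_nat D * c i = of_int k" by (elim Ints_cases)
    moreover have "of_nat D * c i > 0" using D c by simp
    ultimately have "k > 0" by simp
    then show ?thesis using k by (simp add: m_def)
  qed
  let ?K = "PiE UNIV (\<lambda>i. {..<m i})"
  have B: "form_box (map (\<lambda>i. (r i, coord_form (c i) i)) coords) = (\<lambda>x. \<Sum>k\<in>?K. coset_fn (box_point r c k) D x)"
    using box_decompose[of c D m r, OF c D(1) m] by blast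
  show "form_box (map (\<lambda>i. (r i, coord_form (c i) i)) coords) \<in> carrier test_fns"
    unfolding B using D by (intro test_fns_sum coset_fn_test)
  show "xi_std_lift (form_box (map (\<lambda>i. (r i, coord_form (c i) i)) coords)) = ksym (map (\<lambda>i. entry (r i, coord_form (c i) i)) coords)"
    unfolding B using D sym_decompose[of c D m r, OF c D(1) m]
    by (simp add: xi_std_lift_sum coset_fn_test xi_std_lift_coset)
qed

lemma ksym_mult_E_list:
  fixes us :: "(complex^'n::finite \<Rightarrow> complex) list"
  assumes "set us \<subseteq> C_units" "length us + length is = CARD('n)"
    "\<And>i. i \<in> set is \<Longrightarrow> g i \<in> C_units \<and> (\<exists>e\<in>E_units. f i = e \<otimes>\<^bsub>merom_ring\<^esub> g i)"
  shows "ksym (us @ map f is) = ksym (us @ map g is)"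
  using assms
proof (induction "is" arbitrary: us)
  case (Cons i "is")
  obtain e where e: "e \<in> E_units" "f i = e \<otimes>\<^bsub>merom_ring\<^esub> g i" "g i \<in> C_units" using Cons.prems(3)[of i] by auto
  have fC: "f j \<in> C_units" if "j \<in> set (i # is)" for j
    using Cons.prems(3)[OF that] by (auto intro!: C_units_mult)
  have "ksym (us @ map f (i # is)) = ksym (us @ g i # map f is)"
    using ksym_mult_E[of us "map f is" "g i" e] e fC Cons.prems by auto
  also have "\<dots> = ksym ((us @ [g i]) @ map g is)"
    using Cons.IH[of "us @ [g i]"] Cons.prems e by simp
  finally show ?case by simp
qed simp

text \<open>For t the exponential of (r, l) one has 1 - t = -t (1 - 1/t); the shift by 1/2 in the
  first factor accounts for its sign.\<close>

lemma entry_neg: "entry (r, l) = eps (r + 1/2) l \<otimes>\<^bsub>merom_ring\<^esub> entry (- r, \<lambda>x. - l x)"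
proof (rule merom_eqI)
  fix z :: "complex^'a" assume z: "z \<in> generic"
  let ?t = "2 * of_real pi * \<i> * (form_ext l z - of_rat r)"
  have e: "eps (r + 1/2) l z = - exp ?t"
  proof -
    have "2 * of_real pi * \<i> * (form_ext l z - of_rat (r + 1/2)) = ?t - of_real pi * \<i>"
      by (simp add: of_rat_add of_rat_divide algebra_simps)
    then show ?thesis using z by (simp add: eps_def exp_diff)
  qed
  have "form_ext (\<lambda>x. - l x) z = - form_ext l z" using form_ext_smult[of "-1" l z] by simp
  then have "2 * of_real pi * \<i> * (form_ext (\<lambda>x. - l x) z - of_rat (- r)) = - ?t" by (simp add: of_rat_minus algebra_simps)
  moreover have "entry (- r, \<lambda>x. - l x) z = 1 - exp (2 * of_real pi * \<i> * (form_ext (\<lambda>x. - l x) z - of_rat (- r)))"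
    using z by (simp add: entry_def one_minus_eps_eq)
  ultimately have n: "entry (- r, \<lambda>x. - l x) z = 1 - exp (- ?t)" by (simp only:)
  have p: "entry (r, l) z = 1 - exp ?t" using z by (simp add: entry_def one_minus_eps_eq)
  have "1 - exp ?t = - exp ?t * (1 - exp (- ?t))"
    by (simp only: exp_minus) (simp add: right_diff_distrib)
  then show "entry (r, l) z = (eps (r + 1/2) l \<otimes>\<^bsub>merom_ring\<^esub> entry (- r, \<lambda>x. - l x)) z"
    by (simp only: merom_apply(1)[OF z] e n p)
qed (auto simp: entry_def)

text \<open>Negating a pair leaves its integrality condition unchanged and alters its entry by a
  factor in E(V) only (\<open>entry_neg\<close>). Arbitrary signs are thus reduced to
  \<open>xi_std_lift_box_pos\<close>.\<close>

lemma xi_std_lift_box: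
  fixes c r :: "'n::{finite,linorder} \<Rightarrow> rat"
  assumes c: "\<And>i. c i \<noteq> 0"
  defines "ps \<equiv> map (\<lambda>i. (r i, coord_form (c i) i)) coords"
  shows "form_box ps \<in> carrier test_fns" "xi_std_lift (form_box ps) = ksym (map entry ps)"
proof -
  let ?qs = "map (\<lambda>i. (sgn (c i) * r i, coord_form \<bar>c i\<bar> i)) coords"
  have box: "form_box ps = form_box ?qs"
  proof
    fix x
    have "coord_form \<bar>c i\<bar> i x - sgn (c i) * r i \<in> \<int> \<longleftrightarrow> coord_form (c i) i x - r i \<in> \<int>" for i
    proof (cases "c i > 0")
      case False
      then have "c i < 0" using c[of i] by simp
      then have "coord_form \<bar>c i\<bar> i x - sgn (c i) * r i = - (coord_form (c i) i x - r i)"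
        by (simp add: coord_form_def)
      then show ?thesis using minus_in_Ints_iff by metis
    qed simp
    then show "form_box ps x = form_box ?qs x" by (simp add: ps_def form_box_def)
  qed
  have c': "\<bar>c i\<bar> > 0" for i using c by simp
  note X = xi_std_lift_box_pos[OF c', of "\<lambda>i. sgn (c i) * r i"]
  show "form_box ps \<in> carrier test_fns" unfolding box by (rule X(1))
  have "ksym ([] @ map (\<lambda>i. entry (r i, coord_form (c i) i)) coords) =
      ksym ([] @ map (\<lambda>i. entry (sgn (c i) * r i, coord_form \<bar>c i\<bar> i)) coords)"
  proof (rule ksym_mult_E_list)
    fix i :: 'n
    have "\<exists>e\<in>E_units. entry (r i, coord_form (c i) i) = e \<otimes>\<^bsub>merom_ring\<^esub> entry (sgn (c i) * r i, coord_form \<bar>c i\<bar> i)"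
    proof (cases "c i > 0")
      case True
      have "entry (r i, coord_form (c i) i) \<in> carrier merom_ring"
        using entry_C[OF nonzero_coord_form[OF c]] C_units_Units merom.Units_closed by blast
      then show ?thesis using True one_E_units by (intro bexI[of _ "\<one>\<^bsub>merom_ring\<^esub>"]) auto
    next
      case False
      then have neg: "c i < 0" using c[of i] by simp
      have d: "coord_form (c i) i \<in> dual" using nonzero_coord_form[OF c[of i], of 0 i] by (simp add: nonzero_form_def)
      have "(\<lambda>x. - coord_form (c i) i x) = coord_form \<bar>c i\<bar> i" using neg by (auto simp: coord_form_def)
      then show ?thesis using entry_neg[of "r i" "coord_form (c i) i"] eps_E_units[OF d, of "r i + 1/2"] neg by auto
    qed
    then show "entry (sgn (c i) * r i, coord_form \<bar>c i\<bar> i) \<in> C_units \<and>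
      (\<exists>e\<in>E_units. entry (r i, coord_form (c i) i) = e \<otimes>\<^bsub>merom_ring\<^esub> entry (sgn (c i) * r i, coord_form \<bar>c i\<bar> i))"
      using entry_C[OF nonzero_coord_form, of "\<bar>c i\<bar>" "sgn (c i) * r i" i] c[of i] by simp
  qed auto
  then show "xi_std_lift (form_box ps) = ksym (map entry ps)"
    unfolding box X(2) by (simp add: ps_def o_def)
qed

section \<open>Test functions and bases\<close>

lemma finite_bounded_denominator:
  "finite {t :: rat^'n. (\<forall>i. 0 \<le> t $ i \<and> t $ i < of_nat D) \<and> (\<forall>i. of_nat M * t $ i \<in> \<int>)}" if "M > 0"
proof (rule finite_subset)
  show "{t :: rat^'n. (\<forall>i. 0 \<le> t $ i \<and> t $ i < of_nat D) \<and> (\<forall>i. of_nat M * t $ i \<in> \<int>)} \<subseteq>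
    (\<lambda>k. \<chi> i. of_int (k i) / of_nat M) ` PiE UNIV (\<lambda>_. {0..int (D * M)})"
  proof clarify
    fix t :: "rat^'n" assume b: "\<forall>i. 0 \<le> t $ i \<and> t $ i < of_nat D" and i: "\<forall>i. of_nat M * t $ i \<in> \<int>"
    have "\<forall>i. \<exists>k::int. of_nat M * t $ i = of_int k" using i by (metis Ints_cases)
    then obtain k :: "'n \<Rightarrow> int" where k: "\<And>i. of_nat M * t $ i = of_int (k i)" by metis
    have "0 \<le> k i \<and> k i \<le> int (D * M)" for i
    proof -
      have "0 \<le> (of_int (k i) :: rat)" using b by (simp flip: k)
      moreover have "(of_int (k i) :: rat) \<le> of_int (int (D * M))"
      proof -
        have "of_nat M * t $ i \<le> of_nat M * (of_nat D :: rat)" using b by (intro mult_left_mono) (auto intro: less_imp_le)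
        then show ?thesis by (simp add: k mult.commute)
      qed
      ultimately show ?thesis by (simp only: of_int_le_iff of_int_0_le_iff)
    qed
    moreover have "t = (\<chi> i. of_int (k i) / of_nat M)" using that by (simp add: vec_eq_iff k[symmetric])
    ultimately show "t \<in> (\<lambda>k. \<chi> i. of_int (k i) / of_nat M) ` PiE UNIV (\<lambda>_. {0..int (D * M)})"
      by (intro image_eqI[of _ _ k]) auto
  qed
qed (intro finite_imageI finite_PiE; simp)

text \<open>Periodicity reduces the function to representatives in the cube [0, D)^n, and the bound
  M on denominators leaves finitely many of them. The criterion is there because an invertible
  matrix may move d\<int>^n to a lattice of another shape.\<close>

lemma test_fns_criterion:
  fixes g :: "rat^'n::finite \<Rightarrow> int"
  assumes D: "D > 0" and M: "M > 0"
    and per: "\<And>x y. (\<forall>i. (x $ i - y $ i) / of_nat D \<in> \<int>) \<Longrightarrow> g x = g y"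
    and supp: "\<And>x i. g x \<noteq> 0 \<Longrightarrow> of_nat M * x $ i \<in> \<int>"
  shows "g \<in> carrier test_fns"
proof -
  let ?T = "{t :: rat^'n. t \<in> range (rep_mod D) \<and> (\<forall>i. of_nat M * t $ i \<in> \<int>)}"
  have "?T \<subseteq> {t :: rat^'n. (\<forall>i. 0 \<le> t $ i \<and> t $ i < of_nat D) \<and> (\<forall>i. of_nat M * t $ i \<in> \<int>)}"
    using D by (auto simp: rep_mod_def frac_ge_0 frac_lt_1)
  moreover have "finite {t :: rat^'n. (\<forall>i. 0 \<le> t $ i \<and> t $ i < of_nat D) \<and> (\<forall>i. of_nat M * t $ i \<in> \<int>)}"
    by (rule finite_bounded_denominator[OF M])
  ultimately have fin: "finite ?T" by (rule finite_subset)
  have "g x = (\<Sum>t\<in>?T. g t * coset_fn t D x)" for x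
  proof -
    have "(\<Sum>t\<in>?T. g t * coset_fn t D x) = (\<Sum>t\<in>?T. if t = rep_mod D x then g t else 0)"
      using D by (intro sum.cong refl) (auto simp: coset_fn_rep)
    also have "\<dots> = (if rep_mod D x \<in> ?T then g (rep_mod D x) else 0)" using fin by simp
    also have "\<dots> = g (rep_mod D x)" using supp[of "rep_mod D x"] by auto
    also have "\<dots> = g x" using rep_mod_diff[OF D] by (intro per) blast
    finally show ?thesis by simp
  qed
  then have "g = (\<lambda>x. \<Sum>t\<in>?T. g t * coset_fn t D x)" by (rule ext)
  moreover have "(\<lambda>x. \<Sum>t\<in>?T. g t * coset_fn t D x) \<in> carrier test_fns"
    using D by (intro test_fns_sum test_fns_scale coset_fn_test)
  ultimately show ?thesis by simp
qed

lemma common_denominator_matrix: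
  fixes A :: "rat^'n::finite^'m::finite"
  shows "\<exists>N::nat. N > 0 \<and> (\<forall>i j. of_nat N * A $ i $ j \<in> \<int>)"
  using common_denominator[of "range (\<lambda>(i, j). A $ i $ j)"] by auto

text \<open>Clearing the denominators of \<gamma> by N gives the period d N. Those of a and of
  \<gamma>^-1 control the support, since x is recovered from x \<gamma> by means of
  \<gamma>^-1.\<close>

lemma test_act_coset_fn:
  fixes \<gamma> :: "rat^'n::finite^'n"
  assumes \<gamma>: "invertible \<gamma>" and d: "d > 0"
  shows "test_act \<gamma> (coset_fn a d) \<in> carrier test_fns"
proof -
  obtain N where N: "N > 0" "\<And>i j. of_nat N * \<gamma> $ i $ j \<in> \<int>" using common_denominator_matrix[of \<gamma>] by blast
  let ?g = "matrix_inv \<gamma>"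
  obtain M2 where M2: "M2 > 0" "\<And>i j. of_nat M2 * ?g $ i $ j \<in> \<int>" using common_denominator_matrix[of ?g] by blast
  obtain M1 where M1: "M1 > 0" "\<And>j. of_nat M1 * a $ j \<in> \<int>" using common_denominator[of "range (($) a)"] by auto
  show ?thesis
  proof (rule test_fns_criterion[of "d * N" "M1 * M2"])
    fix x y :: "rat^'n" assume xy: "\<forall>i. (x $ i - y $ i) / of_nat (d * N) \<in> \<int>"
    have "((x v* \<gamma>) $ j - (y v* \<gamma>) $ j) / of_nat d \<in> \<int>" for j
    proof -
      have "((x v* \<gamma>) $ j - (y v* \<gamma>) $ j) / of_nat d = (\<Sum>i\<in>UNIV. (x $ i - y $ i) / of_nat (d * N) * (of_nat N * \<gamma> $ i $ j))"
      proof -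
        have "(x $ i - y $ i) / of_nat (d * N) * (of_nat N * \<gamma> $ i $ j) = (x $ i * \<gamma> $ i $ j - y $ i * \<gamma> $ i $ j) / of_nat d" for i
        proof -
          have "u / of_nat (d * N) * (of_nat N * v) = u * v / of_nat d" for u v :: rat
            using N(1) d by (simp add: field_simps)
          then show ?thesis by (simp only: left_diff_distrib)
        qed
        then show ?thesis
          by (simp only: vector_matrix_mult_def vec_lambda_beta sum_subtractf[symmetric] sum_divide_distrib)
      qed
      also have "\<dots> \<in> \<int>" by (intro Ints_sum, rule Ints_mult) (use xy N(2) in auto)
      finally show ?thesis .
    qed
    then have "rep_mod d (x v* \<gamma>) = rep_mod d (y v* \<gamma>)" using d by (simp add: rep_mod_eq_iff)
    then show "test_act \<gamma> (coset_fn a d) x = test_act \<gamma> (coset_fn a d) y"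
      using d by (simp add: test_act_def coset_fn_rep)
  next
    fix x i assume "test_act \<gamma> (coset_fn a d) x \<noteq> 0"
    then have "\<forall>j. \<exists>k::int. (x v* \<gamma>) $ j = a $ j + of_nat d * of_int k"
      by (simp add: test_act_def coset_fn_def of_bool_def split: if_splits)
    then obtain k :: "'n \<Rightarrow> int" where k: "\<And>j. (x v* \<gamma>) $ j = a $ j + of_nat d * of_int (k j)" by metis
    have "of_nat M1 * (x v* \<gamma>) $ j \<in> \<int>" for j
      using M1(2) by (simp add: k distrib_left)
    then have "(\<Sum>j\<in>UNIV. (of_nat M1 * (x v* \<gamma>) $ j) * (of_nat M2 * ?g $ j $ i)) \<in> \<int>"
      using M2(2) by (intro Ints_sum, rule Ints_mult)
    moreover have xi: "x $ i = (\<Sum>j\<in>UNIV. (x v* \<gamma>) $ j * ?g $ j $ i)"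
    proof -
      have "x $ i = ((x v* \<gamma>) v* ?g) $ i" by (simp add: vector_matrix_mul_assoc matrix_inv[OF \<gamma>])
      then show ?thesis by (simp only: vector_matrix_mult_def[of "x v* \<gamma>"] vec_lambda_beta)
    qed
    moreover have "of_nat (M1 * M2) * x $ i = (\<Sum>j\<in>UNIV. (of_nat M1 * (x v* \<gamma>) $ j) * (of_nat M2 * ?g $ j $ i))"
      by (subst xi) (simp add: sum_distrib_left mult_ac)
    ultimately show "of_nat (M1 * M2) * x $ i \<in> \<int>" by simp
  qed (use d N M1 M2 in auto)
qed

lemma test_act_closed:
  fixes \<gamma> :: "rat^'n::finite^'n"
  assumes \<gamma>: "invertible \<gamma>" and f: "f \<in> carrier test_fns"
  shows "test_act \<gamma> f \<in> carrier test_fns"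
proof -
  obtain ps where ps: "ps \<in> presentations" "f = presented ps" using f by (auto simp: test_fns_carrier)
  have "test_act \<gamma> (presented ps) \<in> carrier test_fns" using ps(1)
  proof (induction ps)
    case Nil
    then show ?case using test_fns_zero by (simp add: test_act_def presented_def)
  next
    case (Cons p ps)
    obtain b a d where p: "p = (b, a, d)" by (cases p)
    have d: "d > 0" "ps \<in> presentations" using Cons.prems p by (auto simp: presentations_def)
    have "test_act \<gamma> (presented (p # ps)) = (\<lambda>x. b * test_act \<gamma> (coset_fn a d) x + test_act \<gamma> (presented ps) x)"
      by (simp add: p test_act_def presented_Cons)
    then show ?case using Cons.IH[OF d(2)] test_act_coset_fn[OF \<gamma> d(1)] by (simp add: test_fns_add test_fns_scale)
  qed
  then show ?thesis using ps by simp
qed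

lemma test_act_inverse:
  assumes "invertible \<gamma>"
  shows "test_act \<gamma> (test_act (matrix_inv \<gamma>) f) = f" "test_act (matrix_inv \<gamma>) (test_act \<gamma> f) = f"
  by (simp_all add: test_act_def vector_matrix_mul_assoc matrix_inv[OF assms])

lemma test_act_box: "test_act \<gamma> (form_box ps) = form_box (map (\<lambda>(r, l). (r, form_act \<gamma> l)) ps)"
  by (force simp: test_act_def form_box_def form_act_def)

section \<open>Bases of the dual space\<close>

definition basis :: "('n \<Rightarrow> ('n::finite) form) \<Rightarrow> bool" where
  "basis L \<longleftrightarrow> (\<forall>i. L i \<in> dual) \<and> (\<forall>c. (\<forall>x. (\<Sum>i\<in>UNIV. c i * L i x) = 0) \<longrightarrow> (\<forall>i. c i = 0))"

text \<open>Let the rows of B hold the coefficients of the forms. Independence makes the kernel of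
  the transpose trivial, and a left inverse G of the transpose is the matrix sought.\<close>

lemma basis_standardize:
  fixes L :: "'n \<Rightarrow> ('n::finite) form"
  assumes L: "basis L"
  obtains \<gamma> where "invertible \<gamma>" "\<And>i. form_act \<gamma> (L i) = (\<lambda>x. x $ i)"
proof -
  define B :: "rat^'n^'n" where "B = (\<chi> i j. L i (axis j 1))"
  have dual: "L i \<in> dual" for i using L by (simp add: basis_def)
  have B: "(B *v x) $ i = L i x" for x i
    by (simp add: B_def matrix_vector_mult_def dual_expand[OF dual, of i x] mult.commute)
  have "c = 0" if c: "transpose B *v c = 0" for c
  proof -
    have e1: "(\<Sum>i\<in>UNIV. c $ i * L i (axis j 1)) = 0" for j
      using c by (simp add: vec_eq_iff matrix_vector_mult_def transpose_def B_def mult.commute)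
    have e2: "(\<Sum>i\<in>UNIV. c $ i * L i x) = (\<Sum>j\<in>UNIV. x $ j * (\<Sum>i\<in>UNIV. c $ i * L i (axis j 1)))" for x
    proof -
      have "(\<Sum>i\<in>UNIV. c $ i * L i x) = (\<Sum>i\<in>UNIV. \<Sum>j\<in>UNIV. x $ j * (c $ i * L i (axis j 1)))"
        by (subst dual_expand[OF dual]) (simp add: sum_distrib_left mult.left_commute)
      also have "\<dots> = (\<Sum>j\<in>UNIV. \<Sum>i\<in>UNIV. x $ j * (c $ i * L i (axis j 1)))" by (rule sum.swap)
      finally show ?thesis by (simp add: sum_distrib_left)
    qed
    have "(\<Sum>i\<in>UNIV. c $ i * L i x) = 0" for x by (subst e2) (simp add: e1)
    then have "\<forall>i. c $ i = 0"
      using spec[OF conjunct2[OF L[unfolded basis_def]], of "\<lambda>i. c $ i"] by (simp only: simp_thms)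
    then show ?thesis by (simp add: vec_eq_iff)
  qed
  then have "\<forall>c. transpose B *v c = 0 \<longrightarrow> c = 0" by (intro allI impI)
  then obtain G where G: "G ** transpose B = mat 1"
    unfolding matrix_left_invertible_ker[symmetric] by (rule exE)
  have "form_act G (L i) = (\<lambda>x. x $ i)" for i
  proof
    fix x
    have "form_act G (L i) x = (B *v (x v* G)) $ i" by (simp add: form_act_def B)
    also have "\<dots> = (x v* (G ** transpose B)) $ i" by (simp add: vector_matrix_mul_assoc[symmetric])
    finally show "form_act G (L i) x = x $ i" by (simp add: G)
  qed
  moreover have "invertible G" using G invertible_right_inverse by blast
  ultimately show thesis by (rule that[rotated])
qed

lemma standardize_unique:
  fixes \<gamma> \<gamma>' :: "rat^'n::finite^'n"
  assumes "invertible \<gamma>" "\<And>i. form_act \<gamma> (L i) = (\<lambda>x. x $ i)" "\<And>i. form_act \<gamma>' (L i) = (\<lambda>x. x $ i)"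
  shows "\<gamma>' = \<gamma>"
proof -
  have L: "L i x = (x v* matrix_inv \<gamma>) $ i" for i x
    using form_act_inverse(1)[OF assms(1), of "L i"] assms(2)[of i] by (metis form_act_def)
  have "x v* \<gamma>' v* matrix_inv \<gamma> = x" for x
    using L assms(3) by (auto simp: vec_eq_iff form_act_def fun_eq_iff)
  then have "x v* \<gamma>' v* matrix_inv \<gamma> v* \<gamma> = x v* \<gamma>" for x by simp
  then have e: "x v* \<gamma>' = x v* \<gamma>" for x
    by (simp only: vector_matrix_mul_assoc matrix_mul_assoc[symmetric] matrix_inv(2)[OF assms(1)] matrix_mul_rid)
  have row: "(axis i 1 v* g) = g $ i" for i and g :: "rat^'n^'n"
    by (simp add: vec_eq_iff vector_matrix_mult_def axis_def if_distrib if_distribR cong: if_cong)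
  show ?thesis using e row by (metis vec_eq_iff)
qed

lemma bij_betw_coords: "bij_betw ((!) (coords :: 'n::{finite,linorder} list)) {..<CARD('n)} UNIV"
  by (rule bij_betw_nth) auto

lemma list_as_coords:
  assumes "length ls = CARD('n::{finite,linorder})"
  obtains L where "ls = map L (coords :: 'n list)"
proof
  let ?f = "inv_into {..<CARD('n)} ((!) (coords :: 'n list))"
  show "ls = map (\<lambda>i. ls ! ?f i) (coords :: 'n list)"
    using assms bij_betw_coords[where 'n = 'n]
    by (intro nth_equalityI) (auto simp: inv_into_f_f bij_betw_def)
qed

lemma to_std_eq:
  fixes L :: "'n::{finite,linorder} \<Rightarrow> 'n form"
  assumes "invertible \<gamma>" "\<And>i. form_act \<gamma> (L i) = (\<lambda>x. x $ i)"
  shows "to_std (map L coords) = \<gamma>"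
  unfolding to_std_def
proof (rule the_equality)
  fix \<gamma>' :: "rat^('n::{finite,linorder})^('n::{finite,linorder})"
  assume *: "invertible \<gamma>' \<and> (\<forall>i<CARD('n). form_act \<gamma>' (map L coords ! i) = (\<lambda>x. x $ (coords ! i)))"
  have "form_act \<gamma>' (L i) = (\<lambda>x. x $ i)" for i
  proof -
    obtain k where "k < CARD('n)" "i = coords ! k"
      using bij_betw_coords[where 'n = 'n] by (metis UNIV_I bij_betw_imp_surj_on imageE lessThan_iff)
    then show ?thesis using * by simp
  qed
  then show "\<gamma>' = \<gamma>" using standardize_unique[OF assms] by blast
qed (use assms in simp)

definition basis_list :: "('n::{finite,linorder}) form list \<Rightarrow> bool" where
  "basis_list ls \<longleftrightarrow> (\<exists>L. basis L \<and> ls = map L coords)"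

definition xi_lift :: "('n::{finite,linorder}) form list \<Rightarrow> (rat^('n::{finite,linorder}) \<Rightarrow> int) \<Rightarrow> 'n ktilde" where
  "xi_lift ls f = ktilde_act (to_std ls) (xi_std_lift (test_act (to_std ls) f))"

lemma basis_list_std:
  assumes "basis_list ls"
  obtains L where "ls = map L coords" "invertible (to_std ls)"
    "\<And>i. form_act (to_std ls) (L i) = (\<lambda>x. x $ i)" "basis L"
proof -
  obtain L where L: "basis L" "ls = map L coords" using assms by (auto simp: basis_list_def)
  obtain \<gamma> where \<gamma>: "invertible \<gamma>" "\<And>i. form_act \<gamma> (L i) = (\<lambda>x. x $ i)" using basis_standardize[OF L(1)] by blast
  have e: "to_std ls = \<gamma>" unfolding L(2) by (rule to_std_eq[OF \<gamma>])
  show thesis by (rule that[OF L(2)]) (simp_all only: e L(1) \<gamma>)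
qed

lemma xi_eq:
  fixes ls :: "('n::{finite,linorder}) form list"
  assumes "basis_list ls" "f \<in> carrier test_fns"
  shows "xi ls f = ktilde_val (xi_lift ls f)"
proof -
  obtain L where inv: "invertible (to_std ls)" using basis_list_std[OF assms(1)] by blast
  show ?thesis
    using test_act_closed[OF inv assms(2)] assms(2)
    by (simp add: xi_def xi_lift_def xi_std_eq K_tilde_act_val[OF inv] xi_std_lift_closed)
qed

lemma xi_lift_closed: "basis_list ls \<Longrightarrow> f \<in> carrier test_fns \<Longrightarrow> xi_lift ls f \<in> ktilde_carrier"
  by (elim basis_list_std) (simp add: xi_lift_def ktilde_act_closed xi_std_lift_closed test_act_closed)

lemma xi_lift_zero: "basis_list ls \<Longrightarrow> xi_lift ls (\<lambda>x. 0) = 0"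
  by (elim basis_list_std) (simp add: xi_lift_def test_act_def xi_std_lift_zero ktilde_act_0)

lemma xi_lift_add:
  assumes "basis_list ls" "f \<in> carrier test_fns" "g \<in> carrier test_fns"
  shows "xi_lift ls (\<lambda>x. f x + g x) = xi_lift ls f + xi_lift ls g"
proof -
  obtain L where inv: "invertible (to_std ls)" using basis_list_std[OF assms(1)] by blast
  have "test_act (to_std ls) (\<lambda>x. f x + g x) = (\<lambda>x. test_act (to_std ls) f x + test_act (to_std ls) g x)"
    by (simp add: test_act_def)
  then show ?thesis
    using test_act_closed[OF inv] assms by (simp add: xi_lift_def xi_std_lift_add ktilde_act_add[OF inv])
qed

lemma xi_lift_scale:
  assumes "basis_list ls" "f \<in> carrier test_fns"
  shows "xi_lift ls (\<lambda>x. k * f x) = zscale k (xi_lift ls f)"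
proof -
  obtain L where inv: "invertible (to_std ls)" using basis_list_std[OF assms(1)] by blast
  have "test_act (to_std ls) (\<lambda>x. k * f x) = (\<lambda>x. k * test_act (to_std ls) f x)"
    by (simp add: test_act_def)
  then show ?thesis
    using test_act_closed[OF inv] assms by (simp add: xi_lift_def xi_std_lift_scale ktilde_act_scale[OF inv])
qed

definition multiple_of :: "rat \<times> ('n::finite) form \<Rightarrow> 'n form \<Rightarrow> bool" where
  "multiple_of p l \<longleftrightarrow> (\<exists>c. c \<noteq> 0 \<and> snd p = (\<lambda>x. c * l x))"

lemma merom_act_entry:
  assumes "invertible \<gamma>" "l \<in> dual"
  shows "merom_act \<gamma> (entry (r, l)) = entry (r, form_act (matrix_inv \<gamma>) l)"
  by (simp add: entry_def merom_act_one_minus_eps[OF assms])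

text \<open>The matrix \<open>to_std ls\<close> carries the box to one for multiples of coordinates,
  where \<open>xi_std_lift_box\<close> applies; acting back on the symbol restores the original
  entries. The value mentions the pairs but not the basis, which is what allows different bases to
  be compared.\<close>

lemma xi_lift_box:
  fixes ls :: "('n::{finite,linorder}) form list"
  assumes ls: "basis_list ls" and ps: "list_all2 multiple_of ps ls"
  shows "form_box ps \<in> carrier test_fns" "xi_lift ls (form_box ps) = ksym (map entry ps)"
proof -
  let ?\<gamma> = "to_std ls"
  obtain L where L: "ls = map L coords" and inv: "invertible ?\<gamma>" and std: "\<And>i. form_act ?\<gamma> (L i) = (\<lambda>x. x $ i)"
    using basis_list_std[OF ls] by metis
  have "length ps = CARD('n)" using list_all2_lengthD[OF ps] L by simp
  then obtain p :: "'n \<Rightarrow> rat \<times> 'n form" where p: "ps = map p coords" by (rule list_as_coords[where 'n = 'n])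
  have "\<forall>i. multiple_of (p i) (L i)"
    using ps by (auto simp: p L list.rel_map list_all2_same)
  then have "\<forall>i. \<exists>c. c \<noteq> 0 \<and> snd (p i) = (\<lambda>x. c * L i x)" unfolding multiple_of_def .
  from choice[OF this] obtain c where c: "\<And>i. c i \<noteq> 0" "\<And>i. snd (p i) = (\<lambda>x. c i * L i x)" by blast
  define r where "r = fst \<circ> p"
  have ps_eq: "ps = map (\<lambda>i. (r i, \<lambda>x. c i * L i x)) coords"
    by (auto simp: p r_def prod_eq_iff c)
  let ?qs = "map (\<lambda>i. (r i, coord_form (c i) i)) coords"
  have fa: "form_act ?\<gamma> (\<lambda>x. c i * L i x) = coord_form (c i) i" for i
    using std[of i] by (auto simp: form_act_def coord_form_def fun_eq_iff)
  have fi: "form_act (matrix_inv ?\<gamma>) (coord_form (c i) i) = (\<lambda>x. c i * L i x)" for i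
    by (simp add: fa[symmetric] form_act_inverse[OF inv])
  have ta: "test_act ?\<gamma> (form_box ps) = form_box ?qs"
    by (simp add: test_act_box ps_eq fa o_def)
  note X = xi_std_lift_box[of c r, OF c(1)]
  show "form_box ps \<in> carrier test_fns"
    using test_act_closed[OF invertible_matrix_inv[OF inv] X(1)] test_act_inverse(2)[OF inv, of "form_box ps"] by (simp add: ta)
  have d: "coord_form (c i) i \<in> dual" for i using nonzero_coord_form[OF c(1)[of i], of 0 i] by (simp add: nonzero_form_def)
  show "xi_lift ls (form_box ps) = ksym (map entry ps)"
    unfolding xi_lift_def ta X(2) ktilde_act_sym[OF inv]
    by (simp add: ps_eq o_def merom_act_entry[OF inv d] fi)
qed

text \<open>Additive identities between distributions need only be checked on boxes for one basis,
  chosen at will. After transport to coordinates these boxes are the cosets modulo some d, whence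
  the common factor c, which is 1/d in the proof.\<close>

lemma test_fns_span_induct [consumes 2, case_names box zero add scale]:
  fixes ls :: "('n::{finite,linorder}) form list"
  assumes f: "f \<in> carrier test_fns" and ls: "basis_list ls"
    and box: "\<And>rs c. length rs = CARD('n) \<Longrightarrow> c > 0 \<Longrightarrow> P (form_box (map2 (\<lambda>r l. (r, \<lambda>x. c * l x)) rs ls))"
    and zero: "P (\<lambda>x. 0)"
    and add: "\<And>f g. f \<in> carrier test_fns \<Longrightarrow> g \<in> carrier test_fns \<Longrightarrow> P f \<Longrightarrow> P g \<Longrightarrow> P (\<lambda>x. f x + g x)"
    and scale: "\<And>f k. f \<in> carrier test_fns \<Longrightarrow> P f \<Longrightarrow> P (\<lambda>x. k * f x)"
  shows "P f"
proof -
  let ?\<gamma> = "to_std ls"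
  obtain L where L: "ls = map L coords" and inv: "invertible ?\<gamma>" and std: "\<And>i. form_act ?\<gamma> (L i) = (\<lambda>x. x $ i)"
    using basis_list_std[OF ls] by metis
  note inv' = invertible_matrix_inv[OF inv]
  obtain ps where ps: "ps \<in> presentations" "test_act ?\<gamma> f = presented ps"
    using test_act_closed[OF inv f] by (auto simp: test_fns_carrier)
  have fi: "form_act (matrix_inv ?\<gamma>) (coord_form c i) = (\<lambda>x. c * L i x)" for i c
  proof -
    have "coord_form c i = form_act ?\<gamma> (\<lambda>x. c * L i x)"
      using std[of i] by (auto simp: form_act_def coord_form_def fun_eq_iff)
    then show ?thesis by (simp add: form_act_inverse[OF inv])
  qed
  have "P (test_act (matrix_inv ?\<gamma>) (presented ps))" using ps(1)
  proof (induction ps)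
    case Nil
    then show ?case using zero by (simp add: presented_def[abs_def] test_act_def)
  next
    case (Cons p ps)
    obtain b a d where p: "p = (b, a, d)" by (cases p)
    have d: "d > 0" "ps \<in> presentations" using Cons.prems p by (auto simp: presentations_def)
    let ?g = "test_act (matrix_inv ?\<gamma>) (coset_fn a d)" and ?h = "test_act (matrix_inv ?\<gamma>) (presented ps)"
    have "test_act (matrix_inv ?\<gamma>) (presented (p # ps)) = (\<lambda>x. b * ?g x + ?h x)"
      by (simp add: p test_act_def presented_Cons)
    moreover have "?g = form_box (map (\<lambda>i. (a $ i / of_nat d, \<lambda>x. (1 / of_nat d) * L i x)) coords)"
      by (simp add: coset_fn_box[OF d(1)] coset_pairs_def test_act_box fi o_def)
    moreover have "map2 (\<lambda>r l. (r, \<lambda>x. (1 / of_nat d) * l x)) (map (\<lambda>i. a $ i / of_nat d) coords) ls =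
        map (\<lambda>i. (a $ i / of_nat d, \<lambda>x. (1 / of_nat d) * L i x)) coords"
      unfolding L by (rule nth_equalityI) auto
    ultimately have g: "test_act (matrix_inv ?\<gamma>) (presented (p # ps)) = (\<lambda>x. b * ?g x + ?h x)"
      "?g = form_box (map2 (\<lambda>r l. (r, \<lambda>x. (1 / of_nat d) * l x)) (map (\<lambda>i. a $ i / of_nat d) coords) ls)" by simp_all
    have "P ?g" unfolding g(2) by (rule box) (use d(1) in simp_all)
    moreover have "?g \<in> carrier test_fns" by (rule test_act_closed[OF inv' coset_fn_test[OF d(1)]])
    moreover have "?h \<in> carrier test_fns"
      using d(2) by (intro test_act_closed[OF inv']) (simp add: test_fns_carrier)
    moreover have "P ?h" by (rule Cons.IH[OF d(2)])
    ultimately show ?case unfolding g(1) by (intro add scale test_fns_scale)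
  qed
  then show ?thesis by (simp add: ps(2)[symmetric] test_act_inverse[OF inv])
qed

section \<open>The relation between bases\<close>

lemma coords_index:
  fixes i :: "'n::{finite,linorder}"
  obtains k where "k < CARD('n)" "i = coords ! k"
  using in_set_conv_nth[of i coords] by auto

lemma list_all2_multiple_of:
  assumes "length rs = length ls" "c > 0"
  shows "list_all2 multiple_of (map2 (\<lambda>r l. (r, \<lambda>x. c * l x)) rs ls) ls"
  using assms by (auto simp: list_all2_conv_all_nth multiple_of_def intro!: exI[of _ c])

lemma indep_familyD:
  "indep_family l I \<Longrightarrow> (\<And>x. (\<Sum>i\<in>I. c i * l i x) = 0) \<Longrightarrow> i \<in> I \<Longrightarrow> c i = 0"
  unfolding indep_family_def by simp

text \<open>A box for one basis is also a box for the other, and \<open>xi_lift_box\<close> assigns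
  it the same symbol in both cases.\<close>

lemma xi_lift_scaling:
  fixes ls ls' :: "('n::{finite,linorder}) form list"
  assumes ls: "basis_list ls" and ls': "basis_list ls'"
    and s: "list_all2 (\<lambda>l l'. \<exists>s. s \<noteq> 0 \<and> l = (\<lambda>x. s * l' x)) ls ls'" and f: "f \<in> carrier test_fns"
  shows "xi_lift ls f = xi_lift ls' f"
  using f ls
proof (induction rule: test_fns_span_induct)
  case (box rs c)
  let ?ps = "map2 (\<lambda>r l. (r, \<lambda>x. c * l x)) rs ls"
  have len: "length rs = length ls" using box ls by (auto simp: basis_list_def)
  have 1: "list_all2 multiple_of ?ps ls"
    by (rule list_all2_multiple_of[OF len box(2)])
  have "list_all2 multiple_of ?ps ls'"
  proof (rule list_all2_all_nthI)
    show "length ?ps = length ls'" using len list_all2_lengthD[OF s] by simp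
    fix k assume k: "k < length ?ps"
    then obtain t where t: "t \<noteq> 0" "ls ! k = (\<lambda>x. t * (ls' ! k) x)" using list_all2_nthD[OF s, of k] by auto
    then have "snd (?ps ! k) = (\<lambda>x. (c * t) * (ls' ! k) x)" using k by (simp add: mult.assoc)
    then show "multiple_of (?ps ! k) (ls' ! k)" using t box unfolding multiple_of_def by (intro exI[of _ "c * t"]) simp
  qed
  then show ?case using xi_lift_box(2)[OF ls 1] xi_lift_box(2)[OF ls'] by simp
qed (use ls ls' in \<open>auto simp: xi_lift_zero xi_lift_add xi_lift_scale\<close>)

text \<open>On a box, \<gamma> changes the forms of the pairs, and acting with \<gamma> on the
  resulting symbol changes them back.\<close>

lemma xi_lift_equivariant:
  fixes ls :: "('n::{finite,linorder}) form list"
  assumes \<gamma>: "invertible \<gamma>" and ls: "basis_list ls" and ls': "basis_list (map (form_act \<gamma>) ls)"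
    and f: "f \<in> carrier test_fns"
  shows "ktilde_act \<gamma> (xi_lift (map (form_act \<gamma>) ls) (test_act \<gamma> f)) = xi_lift ls f"
  using f ls
proof (induction rule: test_fns_span_induct)
  case (box rs c)
  let ?ps = "map2 (\<lambda>r l. (r, \<lambda>x. c * l x)) rs ls"
  have len: "length rs = length ls" using box ls by (auto simp: basis_list_def)
  have 1: "list_all2 multiple_of ?ps ls"
    by (rule list_all2_multiple_of[OF len box(2)])
  let ?qs = "map (\<lambda>(r, l). (r, form_act \<gamma> l)) ?ps"
  have 2: "list_all2 multiple_of ?qs (map (form_act \<gamma>) ls)"
    using len box by (auto simp: list_all2_conv_all_nth multiple_of_def form_act_def fun_eq_iff intro!: exI[of _ c])
  have dual: "l \<in> dual" if "(r, l) \<in> set ?ps" for r l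
    using that ls by (auto simp: basis_list_def basis_def set_zip intro!: dual_smult)
  have entry: "merom_act \<gamma> (entry (r, form_act \<gamma> l)) = entry (r, l)" if "(r, l) \<in> set ?ps" for r l
    using merom_act_entry[OF \<gamma> form_act_dual[OF dual[OF that]]] form_act_inverse[OF \<gamma>] by simp
  have "map (\<lambda>p. merom_act \<gamma> (entry (case p of (r, l) \<Rightarrow> (r, form_act \<gamma> l)))) ?ps = map entry ?ps"
  proof (rule map_cong[OF refl])
    fix p assume p: "p \<in> set ?ps"
    obtain r l where "p = (r, l)" by (cases p)
    then show "merom_act \<gamma> (entry (case p of (r, l) \<Rightarrow> (r, form_act \<gamma> l))) = entry p"
      using p by (simp only: prod.case entry)
  qed
  then have "map (merom_act \<gamma>) (map entry ?qs) = map entry ?ps" by (simp only: map_map o_def)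
  then show ?case
    by (simp only: test_act_box xi_lift_box(2)[OF ls' 2] xi_lift_box(2)[OF ls 1] ktilde_act_sym[OF \<gamma>])
next
  case zero
  then show ?case using ls ls' by (simp add: test_act_def xi_lift_zero ktilde_act_0[OF \<gamma>])
next
  case (add f g)
  have "test_act \<gamma> (\<lambda>x. f x + g x) = (\<lambda>x. test_act \<gamma> f x + test_act \<gamma> g x)" by (simp add: test_act_def)
  then show ?case using add ls ls' by (simp add: xi_lift_add test_act_closed[OF \<gamma>] ktilde_act_add[OF \<gamma>])
next
  case (scale f k)
  have "test_act \<gamma> (\<lambda>x. k * f x) = (\<lambda>x. k * test_act \<gamma> f x)" by (simp add: test_act_def)
  then show ?case using scale ls ls' by (simp add: xi_lift_scale test_act_closed[OF \<gamma>] ktilde_act_scale[OF \<gamma>])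
qed

section \<open>Tuples in general position\<close>

lemma ng_tuples_basis:
  fixes ls :: "('n::{finite,linorder}) form list"
  assumes "ls \<in> ng_tuples (CARD('n) - 1)"
  shows "basis_list ls"
proof -
  let ?n = "CARD('n)"
  have len: "length ls = ?n" and ld: "set ls \<subseteq> dual" using assms by (auto simp: ng_tuples_def)
  have ind: "indep_family ((!) ls) {..<?n}"
  proof -
    \<comment> \<open>Tuples of length n carry the index n - 1, so this is the full set of
      positions.\<close>
    have "{..<?n} \<subseteq> {..?n - 1}" by (auto simp: less_eq_Suc_le)
    then show ?thesis using assms unfolding ng_tuples_def by auto
  qed
  obtain L :: "'n \<Rightarrow> 'n form" where L: "ls = map L coords" using list_as_coords[where 'n = 'n, OF len] by blast
  have "basis L"
    unfolding basis_def
  proof (intro conjI allI impI)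
    show "L i \<in> dual" for i using ld L by auto
    fix c :: "'n \<Rightarrow> rat" and i :: 'n assume c: "\<forall>x. (\<Sum>i\<in>UNIV. c i * L i x) = 0"
    let ?d = "\<lambda>k. c (coords ! k)"
    have "(\<Sum>k\<in>{..<?n}. ?d k * (ls ! k) x) = (\<Sum>i\<in>UNIV. c i * L i x)" for x
    proof -
      have "(\<Sum>k\<in>{..<?n}. ?d k * (ls ! k) x) = (\<Sum>k\<in>{..<?n}. c (coords ! k) * L (coords ! k) x)"
        by (simp add: L)
      also have "\<dots> = (\<Sum>i\<in>UNIV. c i * L i x)"
        by (rule sum.reindex_bij_betw[OF bij_betw_coords])
      finally show ?thesis .
    qed
    then have "(\<Sum>k\<in>{..<?n}. ?d k * (ls ! k) x) = 0" for x using c by simp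
    then have "?d k = 0" if "k < ?n" for k using indep_familyD[OF ind, of ?d k] that by simp
    moreover obtain k where "k < ?n" "i = coords ! k"
      by (rule coords_index[of i])
    ultimately show "c i = 0" by simp
  qed
  then show ?thesis unfolding basis_list_def using L by (intro exI[of _ L] conjI)
qed

lemma indep_family_reindex:
  assumes "inj_on h I" "indep_family l (h ` I)"
  shows "indep_family (\<lambda>i. l (h i)) I"
  unfolding indep_family_def
proof (intro allI impI ballI)
  fix c i assume c: "\<forall>x. (\<Sum>i\<in>I. c i * l (h i) x) = 0" and i: "i \<in> I"
  let ?d = "\<lambda>j. c (inv_into I h j)"
  have "(\<Sum>j\<in>h ` I. ?d j * l j x) = 0" for x
    using c assms(1) by (simp add: sum.reindex)
  then have "?d (h i) = 0" by (rule indep_familyD[OF assms(2)]) (use i in simp)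
  then show "c i = 0" using i assms(1) by simp
qed

lemma indep_family_cong: "(\<And>i. i \<in> I \<Longrightarrow> l i = l' i) \<Longrightarrow> indep_family l I \<longleftrightarrow> indep_family l' I"
  unfolding indep_family_def by (simp cong: sum.cong)

lemma nth_delete_nth: "i < length xs \<Longrightarrow> k < length xs - 1 \<Longrightarrow> delete_nth i xs ! k = xs ! (if k < i then k else Suc k)"
  by (auto simp: delete_nth_def nth_append)

lemma delete_nth_ng_tuples:
  assumes ls: "ls \<in> ng_tuples (Suc k)" and i: "i \<le> Suc k"
  shows "delete_nth i ls \<in> ng_tuples k"
  unfolding ng_tuples_def
proof (intro CollectI conjI allI impI)
  have len: "length ls = Suc (Suc k)" using ls by (simp add: ng_tuples_def)
  show "length (delete_nth i ls) = k + 1" using len i by simp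
  show "set (delete_nth i ls) \<subseteq> dual" using ls set_delete_nth[of i ls] by (auto simp: ng_tuples_def)
  fix I assume I: "I \<subseteq> {..k}" "card I \<le> CARD('a)"
  \<comment> \<open>The injection that skips i matches positions of the shortened list with those of
    \<open>ls\<close>.\<close>
  let ?h = "\<lambda>j. if j < i then j else Suc j"
  have inj: "inj_on ?h I" by (auto simp: inj_on_def split: if_splits)
  have "?h ` I \<subseteq> {..Suc k}" using I by auto
  moreover have "card (?h ` I) \<le> CARD('a)" by (simp only: card_image[OF inj] I(2))
  ultimately have "indep_family ((!) ls) (?h ` I)" using ls by (simp add: ng_tuples_def)
  then have "indep_family (\<lambda>j. ls ! ?h j) I" by (rule indep_family_reindex[OF inj])
  moreover have "delete_nth i ls ! j = ls ! ?h j" if "j \<in> I" for j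
    using that I i len by (intro nth_delete_nth) auto
  ultimately show "indep_family ((!) (delete_nth i ls)) I" by (subst indep_family_cong) auto
qed

lemma map_form_act_ng_tuples:
  assumes \<gamma>: "invertible \<gamma>" and ls: "ls \<in> ng_tuples k"
  shows "map (form_act \<gamma>) ls \<in> ng_tuples k"
  unfolding ng_tuples_def
proof (intro CollectI conjI allI impI)
  have len: "length ls = k + 1" using ls by (simp add: ng_tuples_def)
  show "length (map (form_act \<gamma>) ls) = k + 1" using len by simp
  show "set (map (form_act \<gamma>) ls) \<subseteq> dual" using ls by (auto simp: ng_tuples_def form_act_dual)
  fix I assume I: "I \<subseteq> {..k}" "card I \<le> CARD('a)"
  then have ind: "indep_family ((!) ls) I" using ls by (simp add: ng_tuples_def)
  show "indep_family ((!) (map (form_act \<gamma>) ls)) I"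
    unfolding indep_family_def
  proof (intro allI impI)
    fix c assume c: "\<forall>x. (\<Sum>i\<in>I. c i * (map (form_act \<gamma>) ls ! i) x) = 0"
    have "(\<Sum>i\<in>I. c i * (ls ! i) x) = 0" for x
    proof -
      \<comment> \<open>Evaluation at x \<gamma>^-1 undoes the action, so a relation among the
        images is one among the forms.\<close>
      have "(\<Sum>i\<in>I. c i * (ls ! i) x) = (\<Sum>i\<in>I. c i * (map (form_act \<gamma>) ls ! i) (x v* matrix_inv \<gamma>))"
        using I(1) len by (intro sum.cong refl) (auto simp: form_act_def vector_matrix_mul_assoc matrix_inv[OF \<gamma>])
      then show ?thesis using c by simp
    qed
    then show "\<forall>i\<in>I. c i = 0" using indep_familyD[OF ind, of c] by blast
  qed
qed

lemma sum_list_delete_nth: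
  fixes g :: "'a \<Rightarrow> rat"
  assumes "i < length xs"
  shows "(\<Sum>x\<leftarrow>xs. g x) = g (xs ! i) + (\<Sum>x\<leftarrow>delete_nth i xs. g x)"
proof -
  have "(\<Sum>x\<leftarrow>xs. g x) = (\<Sum>x\<leftarrow>take i xs @ xs ! i # drop (Suc i) xs. g x)"
    using id_take_nth_drop[OF assms] by simp
  then show ?thesis by (simp add: delete_nth_def)
qed

text \<open>The value of the last pair is the sum of the values of the others, so integrality of all
  values but one forces that of the remaining one.\<close>

lemma form_box_delete_nth:
  fixes ps :: "(rat \<times> 'n::finite form) list"
  assumes i: "i \<le> length ps"
  shows "form_box (delete_nth i (ps @ [pair_sum ps])) = form_box ps"
proof (cases "i = length ps")
  case False
  then have i: "i < length ps" using i by simp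
  have set: "set ps = insert (ps ! i) (set (delete_nth i ps))"
    by (subst id_take_nth_drop[OF i]) (auto simp: delete_nth_def)
  show ?thesis
  proof
    fix x :: "rat^'n"
    let ?g = "\<lambda>p :: rat \<times> 'n form. snd p x - fst p"
    have "(\<Sum>p\<leftarrow>ps. ?g p) = ?g (pair_sum ps)" by (simp add: pair_sum_def sum_list_subtractf)
    then have eq: "?g (pair_sum ps) = ?g (ps ! i) + (\<Sum>p\<leftarrow>delete_nth i ps. ?g p)" using sum_list_delete_nth[OF i, of ?g] by simp
    have "(\<Sum>p\<leftarrow>qs. ?g p) \<in> \<int>" if "\<forall>p\<in>set qs. ?g p \<in> \<int>" for qs
      using that by (induction qs) auto
    \<comment> \<open>The sum over the pairs that are kept is integral, so the total is integral
      exactly if the omitted value is.\<close>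
    then have "(\<forall>p\<in>set (delete_nth i ps). ?g p \<in> \<int>) \<Longrightarrow> ?g (pair_sum ps) \<in> \<int> \<longleftrightarrow> ?g (ps ! i) \<in> \<int>"
      unfolding eq by (intro add_in_Ints_iff_right) blast
    then have "(\<forall>p\<in>set (delete_nth i ps @ [pair_sum ps]). ?g p \<in> \<int>) \<longleftrightarrow> (\<forall>p\<in>set ps. ?g p \<in> \<int>)"
      unfolding set by auto
    then show "form_box (delete_nth i (ps @ [pair_sum ps])) x = form_box ps x"
      using i by (simp add: form_box_def delete_nth_snoc case_prod_unfold)
  qed
qed (simp add: delete_nth_last)

lemma list_all2_delete_nth: "list_all2 P xs ys \<Longrightarrow> list_all2 P (delete_nth i xs) (delete_nth i ys)"
  by (simp add: delete_nth_def list_all2_appendI list_all2_takeI list_all2_dropI)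

lemma dual_in_basis:
  fixes L :: "'n::finite \<Rightarrow> 'n form"
  assumes "basis L" "l \<in> dual"
  obtains c where "\<And>x. l x = (\<Sum>i\<in>UNIV. c i * L i x)"
proof -
  obtain \<gamma> where \<gamma>: "invertible \<gamma>" "\<And>i. form_act \<gamma> (L i) = (\<lambda>x. x $ i)"
    using basis_standardize[OF assms(1)] by blast
  have L: "L i x = (x v* matrix_inv \<gamma>) $ i" for i x
    using form_act_inverse(1)[OF \<gamma>(1), of "L i"] \<gamma>(2)[of i] by (metis form_act_def)
  have "l x = (\<Sum>i\<in>UNIV. form_act \<gamma> l (axis i 1) * L i x)" for x
  proof -
    have "l x = form_act \<gamma> l (x v* matrix_inv \<gamma>)"
      by (simp add: form_act_def vector_matrix_mul_assoc matrix_inv[OF \<gamma>(1)])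
    also have "\<dots> = (\<Sum>i\<in>UNIV. (x v* matrix_inv \<gamma>) $ i * form_act \<gamma> l (axis i 1))"
      by (rule dual_expand[OF form_act_dual[OF assms(2)]])
    finally show ?thesis by (simp add: L mult.commute)
  qed
  then show thesis by (rule that)
qed

text \<open>The first n forms are a basis. A vanishing coefficient c_k would leave a dependence
  among the n forms other than \<lambda>_k, against general position.\<close>

lemma last_in_span:
  fixes ls :: "('n::{finite,linorder}) form list"
  assumes ls: "ls \<in> ng_tuples CARD('n)"
  obtains c where "\<And>k. k < CARD('n) \<Longrightarrow> c k \<noteq> 0"
    "\<And>x. (ls ! CARD('n)) x = (\<Sum>k<CARD('n). c k * (ls ! k) x)"
proof -
  let ?n = "CARD('n)"
  have len: "length ls = Suc ?n" and ld: "set ls \<subseteq> dual" using ls by (auto simp: ng_tuples_def)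
  have n: "?n = Suc (?n - 1)" by simp
  have "delete_nth ?n ls \<in> ng_tuples (?n - 1)" using delete_nth_ng_tuples[of ls "?n - 1" ?n] ls n by simp
  then obtain L where L: "basis L" "delete_nth ?n ls = map L coords" using ng_tuples_basis unfolding basis_list_def by blast
  have Lk: "L (coords ! k) = ls ! k" if "k < ?n" for k
    using arg_cong[OF L(2), of "\<lambda>xs. xs ! k"] that len by (simp add: nth_delete_nth)
  have "ls ! ?n \<in> dual" using ld len by (auto intro: nth_mem)
  then obtain d where d: "\<And>x. (ls ! ?n) x = (\<Sum>i\<in>UNIV. d i * L i x)" using dual_in_basis[OF L(1)] by blast
  define c where "c = (\<lambda>k. d (coords ! k))"
  have c: "(ls ! ?n) x = (\<Sum>k<?n. c k * (ls ! k) x)" for x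
  proof -
    have "(\<Sum>k<?n. c k * (ls ! k) x) = (\<Sum>k<?n. d (coords ! k) * L (coords ! k) x)"
      by (intro sum.cong) (auto simp: c_def Lk)
    also have "\<dots> = (\<Sum>i\<in>UNIV. d i * L i x)" by (rule sum.reindex_bij_betw[OF bij_betw_coords])
    finally show ?thesis by (simp add: d)
  qed
  have "c k \<noteq> 0" if k: "k < ?n" for k
  proof
    assume ck: "c k = 0"
    let ?I = "{..?n} - {k}"
    have "card ?I = ?n" using k by simp
    then have ind: "indep_family ((!) ls) ?I" using ls by (auto simp: ng_tuples_def)
    \<comment> \<open>The dependence has coefficient -1 at the last form and c_j at the others, with
      the position k omitted.\<close>
    have "(\<Sum>j\<in>?I. (if j = ?n then -1 else c j) * (ls ! j) x) = 0" for x
    proof -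
      have I: "?I = insert ?n ({..<?n} - {k})" using k by auto
      have "(\<Sum>j\<in>?I. (if j = ?n then -1 else c j) * (ls ! j) x) = - (ls ! ?n) x + (\<Sum>j\<in>{..<?n} - {k}. c j * (ls ! j) x)"
        unfolding I by (subst sum.insert) (auto intro!: sum.cong)
      also have "(\<Sum>j\<in>{..<?n} - {k}. c j * (ls ! j) x) = (\<Sum>j<?n. c j * (ls ! j) x)"
        using k ck by (simp add: sum_diff1)
      finally show ?thesis by (simp add: c)
    qed
    then have "(if ?n = ?n then -1 else c ?n) = 0"
      by (rule indep_familyD[OF ind, of "\<lambda>j. if j = ?n then -1 else c j" ?n]) (use k in simp)
    then show False by simp
  qed
  then show thesis using c that by blast
qed

lemma xi_lift_cocycle:
  fixes ls :: "('n::{finite,linorder}) form list"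
  assumes ls: "ls \<in> ng_tuples CARD('n)" and f: "f \<in> carrier test_fns"
  shows "(\<Sum>i\<le>CARD('n). zscale ((-1) ^ i) (xi_lift (delete_nth i ls) f)) = 0"
proof -
  let ?n = "CARD('n)"
  have len: "length ls = Suc ?n" and ld: "set ls \<subseteq> dual" using ls by (auto simp: ng_tuples_def)
  have n: "?n = Suc (?n - 1)" by simp
  have bas: "basis_list (delete_nth i ls)" if "i \<le> ?n" for i
    using delete_nth_ng_tuples[of ls "?n - 1" i] ls n that by (intro ng_tuples_basis) simp
  obtain c where c0: "\<And>k. k < ?n \<Longrightarrow> c k \<noteq> 0" and c: "\<And>x. (ls ! ?n) x = (\<Sum>k<?n. c k * (ls ! k) x)"
    using last_in_span[OF ls] by blast
  \<comment> \<open>The first n forms, rescaled so that they add up to the last one; the scalars may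
    be negative.\<close>
  define ms where "ms = map (\<lambda>k x. c k * (ls ! k) x) [0..<?n]"
  have ms_basis: "basis_list ms"
  proof -
    obtain L where L: "basis L" "delete_nth ?n ls = map L coords" using bas[of ?n] unfolding basis_list_def by blast
    have Lk: "L (coords ! k) = ls ! k" if "k < ?n" for k
      using arg_cong[OF L(2), of "\<lambda>xs. xs ! k"] that len by (simp add: nth_delete_nth)
    have clen: "length (map c [0..<?n]) = ?n" by simp
    obtain C :: "'n \<Rightarrow> rat" where C: "map c [0..<?n] = map C coords"
      by (rule list_as_coords[where 'n = 'n, OF clen])
    have Ck: "C (coords ! k) = c k" if "k < ?n" for k
      using arg_cong[OF C, of "\<lambda>xs. xs ! k"] that by simp
    have "C i \<noteq> 0" for i
    proof -
      obtain k where "k < ?n" "i = coords ! k"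
        by (rule coords_index[of i])
      then show ?thesis using c0 Ck by simp
    qed
    have "basis (\<lambda>i x. C i * L i x)"
      unfolding basis_def
    proof (intro conjI allI impI)
      show "(\<lambda>x. C i * L i x) \<in> dual" for i using L(1) by (simp add: basis_def dual_smult)
      fix e i assume "\<forall>x. (\<Sum>i\<in>UNIV. e i * (C i * L i x)) = 0"
      then have "\<forall>x. (\<Sum>i\<in>UNIV. (e i * C i) * L i x) = 0" by (simp add: mult.assoc)
      then have "e i * C i = 0" using spec[OF conjunct2[OF L(1)[unfolded basis_def]], of "\<lambda>i. e i * C i"] by blast
      then show "e i = 0" using \<open>C i \<noteq> 0\<close> by simp
    qed
    moreover have "ms = map (\<lambda>i x. C i * L i x) coords"
      by (rule nth_equalityI) (auto simp: ms_def Lk Ck)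
    ultimately show ?thesis unfolding basis_list_def by blast
  qed
  \<comment> \<open>Boxes are taken over \<open>ms\<close> rather than over the first entries of
    \<open>ls\<close>: as all pairs then carry the same factor b, their sum has a multiple of the
    last form as its form.\<close>
  from f ms_basis show ?thesis
  proof (induction rule: test_fns_span_induct)
    case (box rs b)
    define ps where "ps = map2 (\<lambda>r l. (r, \<lambda>x. b * l x)) rs ms"
    have plen: "length ps = ?n" using box by (simp add: ps_def ms_def)
    have psk: "ps ! k = (rs ! k, \<lambda>x. b * (c k * (ls ! k) x))" if "k < ?n" for k
      using that box by (simp add: ps_def ms_def)
    \<comment> \<open>A vanishing partial sum would be a relation among the first k forms of
      \<open>ls\<close> whose first coefficient is b c_0, which is not zero.\<close>
    have nz: "nonzero_form (pair_sum (take k ps))" if k: "0 < k" "k \<le> ?n" for k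
    proof -
      have snd: "snd (pair_sum (take k ps)) = (\<lambda>x. \<Sum>j<k. (b * c j) * (ls ! j) x)"
      proof
        fix x
        have "snd (pair_sum (take k ps)) x = (\<Sum>j<k. snd (take k ps ! j) x)"
          using k plen by (simp add: pair_sum_def sum_list_sum_nth atLeast0LessThan)
        also have "\<dots> = (\<Sum>j<k. (b * c j) * (ls ! j) x)"
          using k by (intro sum.cong) (auto simp: psk mult.assoc)
        finally show "snd (pair_sum (take k ps)) x = (\<Sum>j<k. (b * c j) * (ls ! j) x)" .
      qed
      have "snd (pair_sum (take k ps)) \<noteq> (\<lambda>x. 0)"
      proof
        assume "snd (pair_sum (take k ps)) = (\<lambda>x. 0)"
        then have "(\<Sum>j<k. (b * c j) * (ls ! j) x) = 0" for x unfolding snd by meson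
        moreover have "indep_family ((!) ls) {..<k}"
        proof -
          have "{..<k} \<subseteq> {..?n}" "card {..<k} \<le> ?n" using k by auto
          then show ?thesis using ls unfolding ng_tuples_def by blast
        qed
        ultimately have "b * c 0 = 0" using k indep_familyD[of "(!) ls" "{..<k}" "\<lambda>j. b * c j" 0] by simp
        then show False using box c0[of 0] by simp
      qed
      moreover have "snd (pair_sum (take k ps)) \<in> dual"
      proof -
        have "ls ! j \<in> dual" if "j < k" for j using ld len that k by (auto intro: nth_mem)
        then show ?thesis unfolding snd dual_iff
          by (auto simp: dual_add dual_scale distrib_left sum.distrib sum_distrib_left mult_ac)
      qed
      ultimately show ?thesis by (simp add: nonzero_form_def)
    qed
    have nzp: "nonzero_form p" if "p \<in> set ps" for p :: "rat \<times> 'n form"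
    proof -
      from that obtain k where "k < length ps" "ps ! k = p" unfolding in_set_conv_nth by blast
      then have k: "k < ?n" "p = ps ! k" using plen by auto
      have "{k} \<subseteq> {..?n}" "card {k} \<le> ?n" using k by (auto simp: Suc_leI)
      then have ind: "indep_family ((!) ls) {k}" using ls unfolding ng_tuples_def by blast
      have "snd p \<noteq> (\<lambda>x. 0)"
      proof
        assume "snd p = (\<lambda>x. 0)"
        then have "(\<Sum>i\<in>{k}. (b * c i) * (ls ! i) x) = 0" for x using k psk[of k] by (auto simp: fun_eq_iff)
        then have "b * c k = 0" by (rule indep_familyD[OF ind, of "\<lambda>j. b * c j" k]) simp
        then show False using box c0[of k] k by simp
      qed
      moreover have "snd p \<in> dual"
        using k psk[of k] ld len by (auto intro!: dual_smult nth_mem)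
      ultimately show ?thesis by (simp add: nonzero_form_def)
    qed
    \<comment> \<open>Each pair, the sum included, is a multiple of the form in the same position.
      Deleting position i in both lists therefore leaves a box to which \<open>xi_lift_box\<close>
      applies.\<close>
    have all: "list_all2 multiple_of (ps @ [pair_sum ps]) ls"
    proof (rule list_all2_all_nthI)
      show "length (ps @ [pair_sum ps]) = length ls" using plen len by simp
      fix k assume k: "k < length (ps @ [pair_sum ps])"
      show "multiple_of ((ps @ [pair_sum ps]) ! k) (ls ! k)"
      proof (cases "k < ?n")
        case True
        then have "snd ((ps @ [pair_sum ps]) ! k) = (\<lambda>x. (b * c k) * (ls ! k) x)"
          using plen by (simp add: nth_append psk mult.assoc)
        then show ?thesis unfolding multiple_of_def using box c0[OF True] by (intro exI[of _ "b * c k"]) simp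
      next
        case False
        then have kn: "k = ?n" using k plen by simp
        have "snd (pair_sum ps) x = b * (ls ! ?n) x" for x
        proof -
          have "snd (pair_sum ps) x = (\<Sum>j<?n. snd (ps ! j) x)"
            using plen by (simp add: pair_sum_def sum_list_sum_nth atLeast0LessThan)
          also have "\<dots> = (\<Sum>j<?n. b * (c j * (ls ! j) x))" by (intro sum.cong) (auto simp: psk)
          finally show ?thesis by (simp add: c sum_distrib_left)
        qed
        then show ?thesis unfolding multiple_of_def kn using box plen by (intro exI[of _ b]) (auto simp: nth_append)
      qed
    qed
    have "(\<Sum>i\<le>?n. zscale ((-1) ^ i) (xi_lift (delete_nth i ls) (form_box ps))) =
      (\<Sum>i\<le>?n. zscale ((-1) ^ i) (ksym (map entry (delete_nth i (ps @ [pair_sum ps])))))"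
    proof (rule sum.cong[OF refl])
      fix i assume "i \<in> {..?n}"
      then have i: "i \<le> ?n" by simp
      have "xi_lift (delete_nth i ls) (form_box (delete_nth i (ps @ [pair_sum ps]))) = ksym (map entry (delete_nth i (ps @ [pair_sum ps])))"
        by (rule xi_lift_box(2)[OF bas[OF i] list_all2_delete_nth[OF all]])
      then show "zscale ((-1) ^ i) (xi_lift (delete_nth i ls) (form_box ps)) = zscale ((-1) ^ i) (ksym (map entry (delete_nth i (ps @ [pair_sum ps]))))"
        using form_box_delete_nth[of i ps] i plen by simp
    qed
    also have "\<dots> = 0" using plen nz nzp by (intro ksym_cocycle) auto
    finally show ?case by (simp only: ps_def)
  next
    case zero
    then show ?case using bas by (simp add: xi_lift_zero)
  next
    case (add f g)
    have "(\<Sum>i\<le>?n. zscale ((-1) ^ i) (xi_lift (delete_nth i ls) (\<lambda>x. f x + g x))) =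
      (\<Sum>i\<le>?n. zscale ((-1) ^ i) (xi_lift (delete_nth i ls) f) + zscale ((-1) ^ i) (xi_lift (delete_nth i ls) g))"
      using add bas by (intro sum.cong) (auto simp: xi_lift_add zscale.scale_right_distrib)
    then show ?case using add by (simp add: sum.distrib)
  next
    case (scale f k)
    have "(\<Sum>i\<le>?n. zscale ((-1) ^ i) (xi_lift (delete_nth i ls) (\<lambda>x. k * f x))) =
      (\<Sum>i\<le>?n. zscale k (zscale ((-1) ^ i) (xi_lift (delete_nth i ls) f)))"
      using scale bas by (intro sum.cong) (auto simp: xi_lift_scale mult.commute)
    also have "\<dots> = zscale k (\<Sum>i\<le>?n. zscale ((-1) ^ i) (xi_lift (delete_nth i ls) f))"
      by (rule zscale.scale_sum_right[symmetric])
    finally show ?case by (simp only: scale zscale.scale_zero_right)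
  qed
qed

section \<open>The cochain\<close>

definition scale_forms :: "rat list \<Rightarrow> ('n::finite) form list \<Rightarrow> 'n form list" where
  "scale_forms cs ls = map2 (\<lambda>c l x. c * l x) cs ls"

lemma orbit_eq: "orbit ls = {scale_forms cs ls | cs. length cs = length ls \<and> (\<forall>c\<in>set cs. c > 0)}"
  by (simp add: orbit_def scale_forms_def)

lemma length_scale_forms [simp]: "length cs = length ls \<Longrightarrow> length (scale_forms cs ls) = length ls"
  by (simp add: scale_forms_def)

lemma nth_scale_forms: "length cs = length ls \<Longrightarrow> k < length ls \<Longrightarrow> scale_forms cs ls ! k = (\<lambda>x. cs ! k * (ls ! k) x)"
  by (simp add: scale_forms_def)

lemma orbit_self: "ls \<in> orbit ls"
proof -
  have "scale_forms (replicate (length ls) 1) ls = ls"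
    by (rule nth_equalityI) (auto simp: nth_scale_forms)
  then show ?thesis unfolding orbit_eq by (intro CollectI exI[of _ "replicate (length ls) 1"]) auto
qed

lemma delete_nth_orbit:
  assumes i: "i < length ls"
  shows "(\<lambda>ls. take i ls @ drop (Suc i) ls) ` orbit ls = orbit (delete_nth i ls)"
proof -
  have scale_delete_nth: "delete_nth i (scale_forms cs ls) = scale_forms (delete_nth i cs) (delete_nth i ls)" if "length cs = length ls" for cs
    using that i by (intro nth_equalityI) (auto simp: nth_scale_forms nth_delete_nth)
  have "delete_nth i ` orbit ls = orbit (delete_nth i ls)"
  proof
    show "delete_nth i ` orbit ls \<subseteq> orbit (delete_nth i ls)"
      using i set_delete_nth by (fastforce simp: orbit_eq scale_delete_nth)
    show "orbit (delete_nth i ls) \<subseteq> delete_nth i ` orbit ls"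
    proof
      fix ms assume "ms \<in> orbit (delete_nth i ls)"
      then obtain cs where cs: "ms = scale_forms cs (delete_nth i ls)" "length cs = length ls - 1" "\<forall>c\<in>set cs. c > 0"
        using i by (auto simp: orbit_eq)
      \<comment> \<open>For surjectivity any positive scalar may be inserted at the deleted
        position; 1 is taken.\<close>
      let ?ds = "take i cs @ 1 # drop i cs"
      have "length ?ds = length ls" "delete_nth i ?ds = cs" using cs(2) i by (auto simp: delete_nth_def)
      moreover have "\<forall>c\<in>set ?ds. c > 0" using cs(3) by (auto dest: in_set_takeD in_set_dropD)
      ultimately have "ms = delete_nth i (scale_forms ?ds ls)" "scale_forms ?ds ls \<in> orbit ls"
        using cs(1) by (auto simp only: scale_delete_nth orbit_eq)
      then show "ms \<in> delete_nth i ` orbit ls" by blast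
    qed
  qed
  then show ?thesis by (simp add: delete_nth_def[abs_def])
qed

lemma form_act_orbit: "map (form_act \<gamma>) ` orbit ls = orbit (map (form_act \<gamma>) ls)"
proof -
  have "map (form_act \<gamma>) (scale_forms cs ls) = scale_forms cs (map (form_act \<gamma>) ls)" if "length cs = length ls" for cs
    using that by (intro nth_equalityI) (auto simp: nth_scale_forms form_act_def)
  then show ?thesis by (force simp: orbit_eq image_def)
qed

section \<open>Passage to orbits and chains\<close>

lemma xi_lift_orbit:
  fixes ls ls' :: "('n::{finite,linorder}) form list"
  assumes "ls \<in> ng_tuples (CARD('n) - 1)" "ls' \<in> ng_tuples (CARD('n) - 1)" "orbit ls = orbit ls'" "f \<in> carrier test_fns"
  shows "xi_lift ls f = xi_lift ls' f"
proof -
  obtain cs where cs: "ls = scale_forms cs ls'" "length cs = length ls'" "\<forall>c\<in>set cs. c > 0"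
    using orbit_self[of ls] unfolding assms(3) unfolding orbit_eq by blast
  have "list_all2 (\<lambda>l l'. \<exists>s. s \<noteq> 0 \<and> l = (\<lambda>x. s * l' x)) ls ls'"
  proof (rule list_all2_all_nthI)
    show "length ls = length ls'" using cs by simp
    fix k assume "k < length ls"
    then have k: "k < length ls'" using cs by simp
    then have "cs ! k \<noteq> 0" using cs(2,3) nth_mem[of k cs] by force
    then show "\<exists>s. s \<noteq> 0 \<and> ls ! k = (\<lambda>x. s * (ls' ! k) x)"
      using nth_scale_forms[OF cs(2) k] unfolding cs(1) by blast
  qed
  then show ?thesis using assms ng_tuples_basis by (intro xi_lift_scaling) auto
qed

text \<open>A representative is chosen; by \<open>xi_lift_orbit\<close> the choice does not affect
  the values on test functions.\<close>

definition xi_orbit :: "('n::{finite,linorder}) form list set \<Rightarrow> (rat^('n::{finite,linorder}) \<Rightarrow> int) \<Rightarrow> 'n ktilde" where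
  "xi_orbit Q = xi_lift (SOME ls. ls \<in> ng_tuples (CARD('n) - 1) \<and> orbit ls = Q)"

lemma xi_orbit_orbit:
  fixes ls :: "('n::{finite,linorder}) form list"
  assumes ls: "ls \<in> ng_tuples (CARD('n) - 1)" and f: "f \<in> carrier test_fns"
  shows "xi_orbit (orbit ls) f = xi_lift ls f"
proof -
  let ?P = "\<lambda>ms :: 'n form list. ms \<in> ng_tuples (CARD('n) - 1) \<and> orbit ms = orbit ls"
  have P: "?P (SOME ms. ?P ms)" by (rule someI[of ?P ls]) (intro conjI ls refl)
  show ?thesis unfolding xi_orbit_def by (rule xi_lift_orbit) (use P ls f in auto)
qed

text \<open>Linear extension from orbits, written as an explicit sum since the values lie in
  \<open>ktilde\<close> and not in a free abelian group.\<close>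

definition xi_chain :: "(('n::{finite,linorder}) form list set \<Rightarrow>\<^sub>0 int) \<Rightarrow> (rat^('n::{finite,linorder}) \<Rightarrow> int) \<Rightarrow> 'n ktilde" where
  "xi_chain c f = (\<Sum>Q\<in>Poly_Mapping.keys c. zscale (Poly_Mapping.lookup c Q) (xi_orbit Q f))"

text \<open>Over a common finite set of orbits two chains can be compared coefficient by
  coefficient, as additivity requires.\<close>

lemma xi_chain_superset:
  assumes "finite S" "Poly_Mapping.keys c \<subseteq> S"
  shows "xi_chain c f = (\<Sum>Q\<in>S. zscale (Poly_Mapping.lookup c Q) (xi_orbit Q f))"
  unfolding xi_chain_def using assms by (intro sum.mono_neutral_left) (auto simp: in_keys_iff)

lemma xi_chain_0 [simp]: "xi_chain 0 f = 0"
  by (simp add: xi_chain_def)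

lemma xi_chain_frag_of [simp]: "xi_chain (frag_of Q) f = xi_orbit Q f"
  by (simp add: xi_chain_def)

lemma xi_chain_add: "xi_chain (a + b) f = xi_chain a f + xi_chain b f"
proof -
  let ?S = "Poly_Mapping.keys a \<union> Poly_Mapping.keys b"
  have S: "finite ?S" "Poly_Mapping.keys a \<subseteq> ?S" "Poly_Mapping.keys b \<subseteq> ?S" "Poly_Mapping.keys (a + b) \<subseteq> ?S"
    using keys_add[of a b] by auto
  show ?thesis
    unfolding xi_chain_superset[OF S(1,2)] xi_chain_superset[OF S(1,3)] xi_chain_superset[OF S(1,4)]
    by (simp add: lookup_add zscale.scale_left_distrib sum.distrib)
qed

lemma xi_chain_uminus: "xi_chain (- a) f = - xi_chain a f"
proof -
  have "xi_chain (- a) f + xi_chain a f = 0" by (simp flip: xi_chain_add)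
  then show ?thesis by (simp add: eq_neg_iff_add_eq_0)
qed

lemma xi_chain_diff: "xi_chain (a - b) f = xi_chain a f - xi_chain b f"
  using xi_chain_add[of a "- b" f] by (simp add: xi_chain_uminus)

lemma xi_chain_cmul: "xi_chain (frag_cmul k a) f = zscale k (xi_chain a f)"
proof -
  have S: "Poly_Mapping.keys (frag_cmul k a) \<subseteq> Poly_Mapping.keys a" by (rule keys_cmul)
  show ?thesis
    unfolding xi_chain_superset[OF finite_keys S] xi_chain_def[of a] by (simp add: zscale.scale_sum_right)
qed

lemma xi_chain_sum: "xi_chain (sum g A) f = (\<Sum>i\<in>A. xi_chain (g i) f)"
  by (induction A rule: infinite_finite_induct) (auto simp: xi_chain_add)

lemma carrier_C_group: "carrier (C_group k) = {c. Poly_Mapping.keys c \<subseteq> orbit ` ng_tuples k}"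
  by (auto simp: C_group_def)

lemma xi_chain_closed:
  fixes c :: "('n::{finite,linorder}) form list set \<Rightarrow>\<^sub>0 int"
  assumes c: "c \<in> carrier (C_group (CARD('n) - 1))" and f: "f \<in> carrier test_fns"
  shows "xi_chain c f \<in> ktilde_carrier"
  unfolding xi_chain_def
proof (intro ktilde_carrier_sum ktilde_carrier_scale)
  fix Q assume "Q \<in> Poly_Mapping.keys c"
  then obtain ls where "ls \<in> ng_tuples (CARD('n) - 1)" "Q = orbit ls" using c by (auto simp: carrier_C_group)
  then show "xi_orbit Q f \<in> ktilde_carrier" using f by (simp add: xi_orbit_orbit xi_lift_closed ng_tuples_basis)
qed

lemma xi_chain_test_hom:
  fixes c :: "('n::{finite,linorder}) form list set \<Rightarrow>\<^sub>0 int"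
  assumes c: "c \<in> carrier (C_group (CARD('n) - 1))" and f: "f \<in> carrier test_fns" and g: "g \<in> carrier test_fns"
  shows "xi_chain c (\<lambda>x. f x + g x) = xi_chain c f + xi_chain c g"
proof -
  have "xi_orbit Q (\<lambda>x. f x + g x) = xi_orbit Q f + xi_orbit Q g" if "Q \<in> Poly_Mapping.keys c" for Q
  proof -
    obtain ls where "ls \<in> ng_tuples (CARD('n) - 1)" "Q = orbit ls" using c \<open>Q \<in> Poly_Mapping.keys c\<close> by (auto simp: carrier_C_group)
    then show ?thesis using f g by (simp add: xi_orbit_orbit xi_lift_add ng_tuples_basis test_fns_add)
  qed
  then show ?thesis by (simp add: xi_chain_def zscale.scale_right_distrib sum.distrib)
qed

lemma C_group_induct [consumes 1, case_names zero one diff]: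
  assumes "c \<in> carrier (C_group k)" "P 0" "\<And>ls. ls \<in> ng_tuples k \<Longrightarrow> P (frag_of (orbit ls))"
    "\<And>a b. P a \<Longrightarrow> P b \<Longrightarrow> P (a - b)"
  shows "P c"
  using assms by (intro frag_induction[of c "orbit ` ng_tuples k" P]) (auto simp: carrier_C_group)

lemma C_group_diff: "a \<in> carrier (C_group k) \<Longrightarrow> b \<in> carrier (C_group k) \<Longrightarrow> a - b \<in> carrier (C_group k)"
  using keys_diff[of a b] by (auto simp: carrier_C_group)

lemma boundary_orbit:
  assumes "ls \<in> ng_tuples k"
  shows "boundary k (frag_of (orbit ls)) = (\<Sum>i\<le>k. frag_cmul ((-1) ^ i) (frag_of (orbit (delete_nth i ls))))"
proof -
  have "(\<lambda>ls. take i ls @ drop (Suc i) ls) ` orbit ls = orbit (delete_nth i ls)" if "i \<le> k" for i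
    using assms that by (intro delete_nth_orbit) (auto simp: ng_tuples_def)
  then show ?thesis by (simp add: boundary_def)
qed

lemma boundary_closed:
  assumes "c \<in> carrier (C_group (Suc k))"
  shows "boundary (Suc k) c \<in> carrier (C_group k)"
  using assms
proof (induction rule: C_group_induct)
  case (one ls)
  have "frag_cmul ((-1) ^ i) (frag_of (orbit (delete_nth i ls))) \<in> carrier (C_group k)" if "i \<in> {..Suc k}" for i
    using delete_nth_ng_tuples[OF one, of i] that by (auto simp: carrier_C_group)
  then show ?case unfolding boundary_orbit[OF one] C_group_def by (intro sum_closed_free_Abelian_group)
qed (auto simp: boundary_def frag_extend_diff carrier_C_group[symmetric] C_group_diff, simp add: carrier_C_group)

lemma xi_chain_boundary:
  fixes c :: "('n::{finite,linorder}) form list set \<Rightarrow>\<^sub>0 int"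
  assumes "c \<in> carrier (C_group CARD('n))" "f \<in> carrier test_fns"
  shows "xi_chain (boundary CARD('n) c) f = 0"
  using assms(1)
proof (induction rule: C_group_induct)
  case (one ls)
  have n: "CARD('n) = Suc (CARD('n) - 1)" by simp
  have "delete_nth i ls \<in> ng_tuples (CARD('n) - 1)" if "i \<le> CARD('n)" for i
    using delete_nth_ng_tuples[of ls "CARD('n) - 1" i] one n that by simp
  then have "xi_chain (boundary CARD('n) (frag_of (orbit ls))) f = (\<Sum>i\<le>CARD('n). zscale ((-1) ^ i) (xi_lift (delete_nth i ls) f))"
    using assms(2) by (simp add: boundary_orbit[OF one] xi_chain_sum xi_chain_cmul xi_orbit_orbit)
  then show ?case using xi_lift_cocycle[OF one assms(2)] by simp
qed (auto simp: boundary_def frag_extend_diff xi_chain_diff)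

lemma C_act_orbit: "C_act \<gamma> (frag_of (orbit ls)) = frag_of (orbit (map (form_act \<gamma>) ls))"
  by (simp add: C_act_def form_act_orbit)

lemma C_act_closed:
  assumes "invertible \<gamma>" "c \<in> carrier (C_group k)"
  shows "C_act \<gamma> c \<in> carrier (C_group k)"
  using assms(2)
proof (induction rule: C_group_induct)
  case (one ls)
  show ?case unfolding C_act_orbit using map_form_act_ng_tuples[OF assms(1) one] by (simp add: carrier_C_group)
next
  case zero
  show ?case by (simp add: C_act_def carrier_C_group)
next
  case (diff a b)
  then show ?case by (simp add: C_act_def frag_extend_diff C_group_diff)
qed

lemma xi_chain_equivariant:
  fixes c :: "('n::{finite,linorder}) form list set \<Rightarrow>\<^sub>0 int"
  assumes \<gamma>: "invertible \<gamma>" and c: "c \<in> carrier (C_group (CARD('n) - 1))" and f: "f \<in> carrier test_fns"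
  shows "ktilde_act \<gamma> (xi_chain (C_act \<gamma> c) (test_act \<gamma> f)) = xi_chain c f"
  using c
proof (induction rule: C_group_induct)
  case zero
  show ?case by (simp add: C_act_def ktilde_act_0[OF \<gamma>])
next
  case (one ls)
  have g: "map (form_act \<gamma>) ls \<in> ng_tuples (CARD('n) - 1)" by (rule map_form_act_ng_tuples[OF \<gamma> one])
  show ?case unfolding C_act_orbit xi_chain_frag_of xi_orbit_orbit[OF g test_act_closed[OF \<gamma> f]] xi_orbit_orbit[OF one f]
    by (rule xi_lift_equivariant[OF \<gamma> ng_tuples_basis[OF one] ng_tuples_basis[OF g] f])
next
  case (diff a b)
  have "ktilde_act \<gamma> (x - y) = ktilde_act \<gamma> x - ktilde_act \<gamma> y" for x y
    using ktilde_act_add[OF \<gamma>, of "x - y" y] by simp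
  then show ?case using diff by (simp add: C_act_def frag_extend_diff xi_chain_diff)
qed

text \<open>Restricted in both arguments, because the elements of \<open>hom_group\<close> are
  extensional functions.\<close>

definition xi_cochain :: "(('n::{finite,linorder}) form list set \<Rightarrow>\<^sub>0 int) \<Rightarrow> (rat^('n::{finite,linorder}) \<Rightarrow> int) \<Rightarrow> 'n Kelem set" where
  "xi_cochain = (\<lambda>c\<in>carrier (C_group (CARD('n) - 1)). \<lambda>f\<in>carrier test_fns. ktilde_val (xi_chain c f))"

lemma xi_cochain_apply:
  fixes c :: "('n::{finite,linorder}) form list set \<Rightarrow>\<^sub>0 int"
  shows "c \<in> carrier (C_group (CARD('n) - 1)) \<Longrightarrow> xi_cochain c = (\<lambda>f\<in>carrier test_fns. ktilde_val (xi_chain c f))"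
  by (simp add: xi_cochain_def)

lemma xi_cochain_Dist:
  fixes c :: "('n::{finite,linorder}) form list set \<Rightarrow>\<^sub>0 int"
  assumes c: "c \<in> carrier (C_group (CARD('n) - 1))"
  shows "xi_cochain c \<in> carrier (Dist (K_tilde CARD('n)))"
proof -
  have mult: "f \<otimes>\<^bsub>test_fns\<^esub> g = (\<lambda>x. f x + g x)" for f g :: "rat^('n::{finite,linorder}) \<Rightarrow> int"
    by (simp add: test_fns_def)
  show ?thesis
    unfolding Dist_def hom_group_def xi_cochain_apply[OF c]
    using xi_chain_closed[OF c]
    by (auto simp: hom_def mult test_fns_add xi_chain_test_hom[OF c] ktilde_val_add ktilde_val_closed)
qed

theorem theorem2p7:
  shows "\<exists>\<Xi> \<in> carrier (hom_group (C_group (CARD('n::{finite,linorder}) - 1)) (Dist (K_tilde CARD('n)))).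
    (\<forall>ls::'n form list. ls \<in> ng_tuples (CARD('n) - 1) \<longrightarrow> \<Xi> (frag_of (orbit ls)) = xi ls) \<and>
    coboundary (CARD('n) - 1) \<Xi> = \<one>\<^bsub>hom_group (C_group CARD('n)) (Dist (K_tilde CARD('n)))\<^esub> \<and>
    (\<forall>\<gamma>. invertible \<gamma> \<longrightarrow>
       cochain_act (dist_act (K_tilde_act CARD('n))) (CARD('n) - 1) \<gamma> \<Xi> = \<Xi>) \<and>
    \<Xi> \<in> cocycles (Dist (K_tilde CARD('n))) (dist_act (K_tilde_act CARD('n))) (CARD('n) - 1)"
proof -
  let ?n = "CARD('n)"
  let ?G = "C_group (?n - 1) :: ('n form list set \<Rightarrow>\<^sub>0 int) monoid"
  let ?M = "Dist (K_tilde ?n) :: ((rat^('n::{finite,linorder}) \<Rightarrow> int) \<Rightarrow> 'n Kelem set) monoid"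
  let ?\<Xi> = "xi_cochain :: ('n form list set \<Rightarrow>\<^sub>0 int) \<Rightarrow> (rat^('n::{finite,linorder}) \<Rightarrow> int) \<Rightarrow> 'n Kelem set"
  \<comment> \<open>The index type is non-empty, so n \<ge> 1 and the subtraction on naturals does
    not truncate.\<close>
  have n: "?n - 1 + 1 = ?n" by simp
  have carrier: "?\<Xi> \<in> carrier (hom_group ?G ?M)"
  proof -
    have "?\<Xi> (a + b) = ?\<Xi> a \<otimes>\<^bsub>?M\<^esub> ?\<Xi> b" if a: "a \<in> carrier ?G" and b: "b \<in> carrier ?G" for a b
    proof -
      have "a + b \<in> carrier ?G" using a b keys_add[of a b] by (auto simp: carrier_C_group)
      then show ?thesis
        using xi_chain_closed[OF a] xi_chain_closed[OF b]
        by (auto simp: xi_cochain_apply[OF a] xi_cochain_apply[OF b] xi_cochain_apply Dist_def hom_group_def xi_chain_add ktilde_val_add cong: restrict_cong)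
    qed
    moreover have "a \<otimes>\<^bsub>?G\<^esub> b = a + b" for a b by (simp add: C_group_def)
    ultimately have "?\<Xi> \<in> hom ?G ?M" by (intro homI xi_cochain_Dist) simp_all
    moreover have "?\<Xi> \<in> extensional (carrier ?G)" unfolding xi_cochain_def by (rule restrict_extensional)
    ultimately show ?thesis by (simp add: hom_group_def)
  qed
  \<comment> \<open>The orbits generate the chain group, so these values identify the cochain as the
    homomorphism induced by \<open>xi\<close>.\<close>
  moreover have "?\<Xi> (frag_of (orbit ls)) = xi ls" if ls: "ls \<in> ng_tuples (?n - 1)" for ls :: "'n form list"
  proof -
    have "frag_of (orbit ls) \<in> carrier ?G" using ls by (simp add: carrier_C_group)
    moreover have "xi ls = (\<lambda>f\<in>carrier test_fns. xi ls f)" by (simp add: xi_def cong: restrict_cong)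
    ultimately show ?thesis
      using ng_tuples_basis[OF ls] by (simp add: xi_cochain_apply xi_orbit_orbit[OF ls] xi_eq cong: restrict_cong)
  qed
  moreover have cob: "coboundary (?n - 1) ?\<Xi> = \<one>\<^bsub>hom_group (C_group ?n) ?M\<^esub>"
  proof -
    have "?\<Xi> (boundary ?n c) = \<one>\<^bsub>?M\<^esub>" if c: "c \<in> carrier (C_group ?n)" for c
    proof -
      have "boundary ?n c \<in> carrier ?G" using boundary_closed[of c "?n - 1"] c by simp
      then show ?thesis
        by (simp add: xi_cochain_apply xi_chain_boundary[OF c] ktilde_val_0 Dist_def hom_group_def cong: restrict_cong)
    qed
    then show ?thesis unfolding coboundary_def n by (auto simp: hom_group_def cong: restrict_cong)
  qed
  moreover have act: "cochain_act (dist_act (K_tilde_act ?n)) (?n - 1) \<gamma> ?\<Xi> = ?\<Xi>" if \<gamma>: "invertible \<gamma>" for \<gamma>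
  proof -
    have "dist_act (K_tilde_act ?n) \<gamma> (?\<Xi> (C_act \<gamma> c)) = ?\<Xi> c" if c: "c \<in> carrier ?G" for c
    proof -
      note c' = C_act_closed[OF \<gamma> c]
      have "K_tilde_act ?n \<gamma> (?\<Xi> (C_act \<gamma> c) (test_act \<gamma> f)) = ktilde_val (xi_chain c f)" if f: "f \<in> carrier test_fns" for f
        using test_act_closed[OF \<gamma> f]
        by (simp add: xi_cochain_apply[OF c'] K_tilde_act_val[OF \<gamma>] xi_chain_closed[OF c'] xi_chain_equivariant[OF \<gamma> c f])
      then show ?thesis by (simp add: dist_act_def xi_cochain_apply[OF c] cong: restrict_cong)
    qed
    then show ?thesis unfolding cochain_act_def by (auto simp: xi_cochain_def cong: restrict_cong)
  qed
  moreover have "?\<Xi> \<in> cocycles ?M (dist_act (K_tilde_act ?n)) (?n - 1)"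
    using carrier cob act by (simp add: cocycles_def cochains_def)
  ultimately show ?thesis by blast
qed

end
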